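(* Let $n\ge1$. For all $k\in\mathbb N=\{0,1,2,\dots\}$, all $f\in\mathcal H^k(\mathbb R^n,\gamma_n)$ with $\|f\|_{L^\infty}\le 1$, and all $p\in[1,2]$, $$\big\||\nabla^k f|\big\|_{L^p}^{p}\ \ge\ C(p)^k\, W^{\ge k}(f),\qquad C(p)=\frac{2^{1-p}}{B\left(\frac12;\frac p2,\frac p2\right)},$$ where $B(x;a,b):=\int_0^x t^{a-1}(1-t)^{b-1}\,dt$ is the incomplete Beta function. Moreover there is an absolute constant $c>0$ with $C(p)\ge c$ for all $p\in[1,2]$.
   Context: $\gamma_n$ is the standard Gaussian measure on $\mathbb R^n$, with density $\varphi_n(x)=(2\pi)^{-n/2}e^{-|x|^2/2}$; all norms and inner products are with respect to $\gamma_n$. For $\kappa\in\mathbb N^n$, $|\kappa|=\sum_i\kappa_i$ and $D^\kappa:=\prod_{i=1}^n\frac{1}{\sqrt{\kappa_i!}}\partial_i^{\kappa_i}$ is the normalized weak partial derivative ($D^{0}$ is the identity). $\mathcal H^k(\mathbb R^n,\gamma_n):=\{f\in L^2(\gamma_n): D^\kappa f\in L^2(\gamma_n)\text{ for all }|\kappa|\le k\}$. $\nabla^kf:=(D^\kappa f)_{|\kappa|=k}$ and $|\nabla^kf|^2:=\sum_{|\kappa|=k}|D^\kappa f|^2$ (pointwise). For $f\in L^2(\gamma_n)$, $f^{\ge k}$ is the component of $f$ orthogonal in $L^2(\gamma_n)$ to the null space of $\nabla^k$ (polynomials of degree less than $k$), and $W^{\ge k}(f):=\|f^{\ge k}\|_{L^2}^2$;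 equivalently $W^{\ge k}(f)=\sum_{|\alpha|\ge k}\widehat f(\alpha)^2$, $\widehat f(\alpha)=\langle f,h_\alpha\rangle_{L^2}$, with $h_\alpha=(-1)^{|\alpha|}\varphi_n^{-1}D^\alpha\varphi_n$ the normalized Hermite polynomials. *)

theory Defs
  imports "HOL-Probability.Probability"
begin

definition gauss_density :: "real ^ 'n \<Rightarrow> real" where
  "gauss_density x = (2 * pi) powr (- (real CARD('n) / 2)) * exp (- (norm x)\<^sup>2 / 2)"

definition gauss :: "(real ^ 'n) measure" where
  "gauss = density lborel (\<lambda>x. ennreal (gauss_density x))"


subsection \<open>Norms and inner product with respect to the Gaussian measure\<close>

text \<open>Elements of \<open>L\<^sup>2\<close> are represented by Borel functions; every notion below depends
  only on their almost-everywhere class.\<close>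

definition gauss_L2 :: "(real ^ 'n \<Rightarrow> real) set" where
  "gauss_L2 = {f \<in> borel_measurable gauss. integrable gauss (\<lambda>x. (f x)\<^sup>2)}"

definition gauss_inner :: "(real ^ 'n \<Rightarrow> real) \<Rightarrow> (real ^ 'n \<Rightarrow> real) \<Rightarrow> real" where
  "gauss_inner f g = (\<integral>x. f x * g x \<partial>gauss)"

definition gauss_Lp_norm :: "real \<Rightarrow> (real ^ 'n \<Rightarrow> real) \<Rightarrow> real" where
  "gauss_Lp_norm p f = (\<integral>x. \<bar>f x\<bar> powr p \<partial>gauss) powr (1 / p)"

definition gauss_Linf_norm :: "(real ^ 'n \<Rightarrow> real) \<Rightarrow> ereal" where
  "gauss_Linf_norm f = esssup gauss (\<lambda>x. ereal \<bar>f x\<bar>)"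


subsection \<open>Weak derivatives\<close>

definition partial_deriv :: "'n \<Rightarrow> (real ^ 'n \<Rightarrow> real) \<Rightarrow> real ^ 'n \<Rightarrow> real" where
  "partial_deriv i f x = frechet_derivative f (at x) (axis i 1)"

definition iter_partial :: "'n list \<Rightarrow> (real ^ 'n \<Rightarrow> real) \<Rightarrow> real ^ 'n \<Rightarrow> real" where
  "iter_partial js f = foldr partial_deriv js f"

text \<open>\<open>C\<^sub>c\<^sup>\<infinity>\<close>: differentiability of all iterated partial derivatives makes them all continuous.\<close>

definition test_functions :: "(real ^ 'n \<Rightarrow> real) set" where
  "test_functions =
     {\<phi>. (\<forall>js x. iter_partial js \<phi> differentiable (at x)) \<and> compact (closure {x. \<phi> x \<noteq> 0})}"

definition locally_integrable :: "(real ^ 'n \<Rightarrow> real) \<Rightarrow> bool" where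
  "locally_integrable f \<longleftrightarrow> (\<forall>K. compact K \<longrightarrow> set_integrable lborel K f)"

abbreviation multi_order :: "('n::finite \<Rightarrow> nat) \<Rightarrow> nat" where
  "multi_order \<kappa> \<equiv> (\<Sum>i\<in>UNIV. \<kappa> i)"

text \<open>The unnormalized weak derivative \<open>\<Prod>\<^sub>i \<partial>\<^sub>i\<^bsup>\<kappa> i\<^esup> f = g\<close>. On test functions the partial
  derivatives commute, so the order of differentiation, given by the list \<open>js\<close>, does not matter.\<close>

definition weak_partial ::
  "('n \<Rightarrow> nat) \<Rightarrow> (real ^ 'n \<Rightarrow> real) \<Rightarrow> (real ^ 'n \<Rightarrow> real) \<Rightarrow> bool" where
  "weak_partial \<kappa> f g \<longleftrightarrow> locally_integrable f \<and> locally_integrable g \<and>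
     (\<forall>\<phi>\<in>test_functions. \<forall>js. (\<forall>i. count_list js i = \<kappa> i) \<longrightarrow>
        (\<integral>x. f x * iter_partial js \<phi> x \<partial>lborel)
          = (-1) ^ multi_order \<kappa> * (\<integral>x. g x * \<phi> x \<partial>lborel))"

text \<open>The normalized derivative \<open>D\<^sup>\<kappa> f\<close>. The choice picks a representative: weak
  derivatives are unique up to null sets. In particular \<open>D\<^sup>0 f = f\<close> almost everywhere.\<close>

definition weak_D :: "('n \<Rightarrow> nat) \<Rightarrow> (real ^ 'n \<Rightarrow> real) \<Rightarrow> real ^ 'n \<Rightarrow> real" where
  "weak_D \<kappa> f x = (\<Prod>i\<in>UNIV. 1 / sqrt (fact (\<kappa> i))) * (SOME g. weak_partial \<kappa> f g) x"

definition gauss_sobolev :: "nat \<Rightarrow> (real ^ 'n \<Rightarrow> real) set" where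
  "gauss_sobolev k = {f \<in> gauss_L2. \<forall>\<kappa>. multi_order \<kappa> \<le> k \<longrightarrow>
     (\<exists>g. weak_partial \<kappa> f g) \<and> weak_D \<kappa> f \<in> gauss_L2}"

definition grad_norm :: "nat \<Rightarrow> (real ^ 'n \<Rightarrow> real) \<Rightarrow> real ^ 'n \<Rightarrow> real" where
  "grad_norm k f x = sqrt (\<Sum>\<kappa> | multi_order \<kappa> = k. (weak_D \<kappa> f x)\<^sup>2)"


subsection \<open>High-degree weight\<close>

definition grad_null_space :: "nat \<Rightarrow> (real ^ 'n \<Rightarrow> real) set" where
  "grad_null_space k = {f \<in> gauss_sobolev k.
     \<forall>\<kappa>. multi_order \<kappa> = k \<longrightarrow> (AE x in gauss. weak_D \<kappa> f x = 0)}"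

text \<open>A representative of \<open>f\<^bsup>\<ge>k\<^esup>\<close>. It exists and is unique almost everywhere for
  \<open>f \<in> L\<^sup>2\<close>, the null space being finite-dimensional (polynomials of degree less than \<open>k\<close>).\<close>

definition high_part :: "nat \<Rightarrow> (real ^ 'n \<Rightarrow> real) \<Rightarrow> real ^ 'n \<Rightarrow> real" where
  "high_part k f = (SOME h. h \<in> gauss_L2 \<and> (\<lambda>x. f x - h x) \<in> grad_null_space k \<and>
     (\<forall>g\<in>grad_null_space k. gauss_inner h g = 0))"

definition high_weight :: "nat \<Rightarrow> (real ^ 'n \<Rightarrow> real) \<Rightarrow> real" where
  "high_weight k f = (gauss_Lp_norm 2 (high_part k f))\<^sup>2"


subsection \<open>The constant\<close>

definition incomplete_Beta :: "real \<Rightarrow> real \<Rightarrow> real \<Rightarrow> real" where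
  "incomplete_Beta x a b = integral {0..x} (\<lambda>t. t powr (a - 1) * (1 - t) powr (b - 1))"

definition C_const :: "real \<Rightarrow> real" where
  "C_const p = 2 powr (1 - p) / incomplete_Beta (1 / 2) (p / 2) (p / 2)"

end

theory Submission imports Defs begin

text \<open>
  Let \<open>X, Y\<close> be independent standard Gaussian vectors, \<open>\<rho> \<in> (0, 1)\<close> and \<open>s = sqrt (1 - \<rho>\<^sup>2)\<close>. The
  Ornstein-Uhlenbeck operator \<open>P u (x) = E u (\<rho> x + s Y)\<close> multiplies the Hermite coefficient of \<open>u\<close>
  at \<open>\<beta>\<close> by \<open>\<rho> ^ |\<beta>|\<close>. The theorem comes from estimating the quadratic form
  \<open>Q (\<rho>) = \<Sum> \<langle>D\<^sup>\<kappa> f, P D\<^sup>\<kappa> f\<rangle>\<close>, with the sum over \<open>|\<kappa>| = k\<close>, from both sides and then integrating in \<open>\<rho>\<close>.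

  From below (\<open>quadratic_form_lower\<close>): \<open>D\<^sup>\<kappa>\<close> shifts Hermite coefficients and multiplies them by square
  roots of binomial coefficients, and a multivariate Vandermonde identity sums these to
  \<open>Q (\<rho>) = \<Sum> binom (|\<alpha>|, k) \<rho> ^ (|\<alpha>| - k) (coef f \<alpha>)\<^sup>2\<close> over \<open>|\<alpha>| \<ge> k\<close>.

  From above (\<open>quadratic_form_upper\<close>): put \<open>G\<^sub>\<kappa> (x) = E f (\<rho> x + s Y) h\<^sub>\<kappa> (Y)\<close>. Gaussian integration by
  parts gives \<open>G\<^sub>\<kappa> = s ^ k P D\<^sup>\<kappa> f\<close>, hence \<open>|G| \<le> s ^ k P |\<nabla>\<^sup>k f|\<close>. On the other hand the numbers
  \<open>G\<^sub>\<kappa> (x)\<close> are Hermite coefficients of a function bounded by 1, so \<open>|G| \<le> 1\<close> by Bessel's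
  inequality. Therefore \<open>|G| \<le> |G| powr (p - 1) \<le> (s ^ k P |\<nabla>\<^sup>k f|) powr (p - 1)\<close>, and
  \<open>s ^ k Q (\<rho>) = E \<langle>\<nabla>\<^sup>k f, G\<rangle>\<close> is at most \<open>s powr (k (p - 1))\<close> times \<open>M = E |\<nabla>\<^sup>k f| powr p\<close>, by Young's
  inequality and because \<open>P\<close> does not increase \<open>L\<^sup>p\<close> norms.

  So \<open>Q (\<rho>) \<le> u (\<rho>) ^ k M\<close> with \<open>u = s powr (p - 2)\<close>. Multiply by \<open>k (1 - \<rho>) ^ (k - 1)\<close> and integrate over
  \<open>(0, 1)\<close> (\<open>hermite_weight_bound\<close>). On the left every Beta integral equals 1, which leaves
  \<open>W\<^sup>\<ge>\<^sup>k (f)\<close>. On the right \<open>u\<close> is nondecreasing, so \<open>(1 - \<rho>) u (\<rho>) \<le> U (\<rho>)\<close> where \<open>U\<close> is the integral of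
  \<open>u\<close> over \<open>(\<rho>, 1)\<close>; the integrand is at most \<open>k U ^ (k - 1) u = - (U ^ k)'\<close> and its integral at most
  \<open>U (0) ^ k\<close>. The substitution \<open>\<rho> = 1 - 2 t\<close> turns \<open>U (0)\<close> into \<open>1 / C (p)\<close> (\<open>C_const_eq\<close>), and
  \<open>1 \<le> U (0) \<le> 2\<close> gives the absolute constant. For \<open>k = 0\<close> the claim is
  \<open>|f| powr p \<ge> f\<^sup>2\<close>, which holds since \<open>|f| \<le> 1\<close>.

  Two bridges lead from the definitions to this argument. Weak derivatives are tested only against
  compactly supported smooth functions; cutting off products of one-variable functions extends the
  test to Hermite functions and yields the coefficients of \<open>D\<^sup>\<kappa> f\<close> (\<open>integral_He_weak_partial\<close>).
  Completeness of the Hermite polynomials (\<open>hermite_complete\<close>) identifies functions with equal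
  coefficients, in particular the null space of \<open>\<nabla>\<^sup>k\<close> and the high-degree part
  (\<open>null_space_eq_hermite_sum\<close>, \<open>coef_high_part\<close>).
\<close>

section \<open>The one-dimensional Gaussian measure and Hermite polynomials\<close>

abbreviation gauss1 :: "real measure" where
  "gauss1 \<equiv> density lborel (\<lambda>x. ennreal (std_normal_density x))"

interpretation gauss1: prob_space gauss1
  by (rule prob_space_normal_density) simp

lemma integral_gauss1_power_Suc_Suc:
  "(\<integral>x. x ^ Suc (Suc n) \<partial>gauss1) = real (Suc n) * (\<integral>x. x ^ n \<partial>gauss1)"
proof (cases "even n")
  case True
  then obtain k where k: "n = 2 * k" by (elim evenE)
  have e: "(\<integral>x. x ^ (2*j) \<partial>gauss1) = fact (2 * j) / (2 ^ j * fact j)" for j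
    using integral_std_normal_moment_even[of j] by (simp add: integral_density)
  have "(\<integral>x. x ^ Suc (Suc n) \<partial>gauss1) = fact (2 * Suc k) / (2 ^ Suc k * fact (Suc k))"
    using e[of "Suc k"] k by simp
  also have "\<dots> = ((2 * real k + 2) * (2 * real k + 1) * fact (2 * k)) / ((2 * 2 ^ k) * ((real k + 1) * fact k))"
    by (simp add: algebra_simps)
  also have "\<dots> = real (Suc n) * (fact (2 * k) / (2 ^ k * fact k))"
  proof -
    have "(2 * real k + 2) * (2 * real k + 1) * F / ((2 * P) * ((real k + 1) * G)) = (2 * real k + 1) * (F / (P * G))"
      if "P \<noteq> 0" "G \<noteq> 0" for F P G :: real
    proof -
      have "real k + 1 \<noteq> 0" by linarith
      then show ?thesis using that by (simp add: divide_simps)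
    qed
    from this[of "2 ^ k" "fact k" "fact (2 * k)"] show ?thesis using k by simp
  qed
  finally show ?thesis using e[of k] k by simp
next
  case False
  then obtain k where k: "n = 2 * k + 1" by (elim oddE)
  have e: "(\<integral>x. x ^ (2*j+1) \<partial>gauss1) = 0" for j
    using integral_std_normal_moment_odd[of j] by (simp add: integral_density)
  show ?thesis using e[of k] e[of "Suc k"] k by simp
qed

lemma integral_gauss1_id: "(\<integral>x. x \<partial>gauss1) = 0"
  using integral_std_normal_moment_odd[of 0] by (simp add: integral_density)

lemma integrable_gauss1_power: "integrable gauss1 (\<lambda>x. x ^ n)"
  using integrable_std_normal_moment[of n] by (simp add: integrable_density)

lemma integrable_gauss1_poly [simp, intro]: "integrable gauss1 (poly p)"
proof -
  have "integrable gauss1 (\<lambda>x. \<Sum>i\<le>degree p. coeff p i * x ^ i)"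
    by (intro Bochner_Integration.integrable_sum integrable_mult_right integrable_gauss1_power)
  then show ?thesis by (simp add: poly_altdef[abs_def])
qed

lemma integrable_gauss1_poly_mult [simp, intro]:
  "integrable gauss1 (\<lambda>x. poly p x * poly q x)"
  using integrable_gauss1_poly[of "p * q"] by (simp add: poly_mult[abs_def])

text \<open>By linearity it is enough to treat monomials, where the identity is the recursion of the Gaussian
  moments.\<close>

lemma gauss1_ibp:
  "(\<integral>x. x * poly p x \<partial>gauss1) = (\<integral>x. poly (pderiv p) x \<partial>gauss1)"
proof -
  have int: "integrable gauss1 (\<lambda>x. x * poly q x)" for q
    using integrable_gauss1_poly_mult[of "[:0,1:]" q] by simp
  have mono: "(\<integral>x. x * poly (monom c n) x \<partial>gauss1) = (\<integral>x. poly (pderiv (monom c n)) x \<partial>gauss1)" for c n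
  proof (cases n)
    case 0
    then show ?thesis by (simp add: integral_gauss1_id pderiv_monom poly_monom)
  next
    case (Suc m)
    have "(\<integral>x. x * poly (monom c n) x \<partial>gauss1) = c * (\<integral>x. x ^ Suc (Suc m) \<partial>gauss1)"
      using Suc by (simp add: poly_monom mult_ac flip: integral_mult_right_zero)
    then show ?thesis unfolding integral_gauss1_power_Suc_Suc
      using Suc by (simp add: pderiv_monom poly_monom mult_ac)
  qed
  have "(\<integral>x. x * poly (\<Sum>i\<in>I. monom (coeff p i) i) x \<partial>gauss1)
      = (\<integral>x. poly (pderiv (\<Sum>i\<in>I. monom (coeff p i) i)) x \<partial>gauss1)" if "finite I" for I
    using that
  proof (induction I)
    case (insert i I)
    then show ?case using mono[of "coeff p i" i] int
      by (simp add: pderiv_add distrib_left)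
  qed simp
  from this[of "{..degree p}"] show ?thesis by (simp add: poly_as_sum_of_monoms)
qed

text \<open>Probabilists' Hermite polynomials. This recursion is the adjoint of differentiation under the
  Gaussian measure, so orthogonality reduces to counting derivatives.\<close>

primrec He :: "nat \<Rightarrow> real poly" where
  "He 0 = 1"
| "He (Suc n) = [:0, 1:] * He n - pderiv (He n)"

lemma pderiv_He_Suc: "pderiv (He (Suc n)) = of_nat (Suc n) * He n"
proof (induction n)
  case 0 then show ?case by (simp add: pderiv_pCons)
next
  case (Suc n)
  have x: "pderiv ([:0, 1:] :: real poly) = 1" by (simp add: pderiv_pCons)
  have "pderiv (He (Suc (Suc n))) = He (Suc n) + [:0,1:] * pderiv (He (Suc n)) - pderiv (pderiv (He (Suc n)))"
    unfolding He.simps(2)[of "Suc n"] pderiv_diff pderiv_mult x by (simp add: algebra_simps del: He.simps(2))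
  also have "\<dots> = He (Suc n) + of_nat (Suc n) * ([:0,1:] * He n - pderiv (He n))"
    unfolding Suc.IH by (simp only: pderiv_mult pderiv_of_nat) (simp only: algebra_simps mult_zero_right add_0)
  also have "\<dots> = He (Suc n) + of_nat (Suc n) * He (Suc n)"
    by (simp only: He.simps(2))
  also have "\<dots> = of_nat (Suc (Suc n)) * He (Suc n)"
    by (simp only: of_nat_Suc algebra_simps mult_1)
  finally show ?case .
qed

lemma pderiv_He: "pderiv (He n) = of_nat n * He (n - 1)"
  by (cases n) (simp_all add: pderiv_He_Suc del: He.simps(2))

lemma He_rec: "He (Suc n) = [:0, 1:] * He n - of_nat n * He (n - 1)"
  by (simp only: He.simps(2) pderiv_He)

lemma degree_He [simp]: "degree (He n) = n" and lead_coeff_He: "coeff (He n) n = 1"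
proof -
  have "degree (He n) = n \<and> coeff (He n) n = 1"
  proof (induction n)
    case (Suc n)
    have d: "degree (pderiv (He n)) < Suc n" using Suc by (simp add: degree_pderiv)
    then have "degree (He (Suc n)) = Suc n"
      using Suc unfolding He.simps(2) diff_conv_add_uminus by (subst degree_add_eq_left) auto
    then show ?case using Suc d by (simp add: coeff_eq_0)
  qed simp
  then show "degree (He n) = n" "coeff (He n) n = 1" by auto
qed

text \<open>Raising the index of \<open>He\<close> is adjoint to differentiation; iterating this proves orthogonality.\<close>

lemma integral_He_Suc_mult:
  "(\<integral>x. poly (He (Suc a)) x * poly q x \<partial>gauss1) = (\<integral>x. poly (He a) x * poly (pderiv q) x \<partial>gauss1)"
proof -
  have "(\<integral>x. poly (He (Suc a)) x * poly q x \<partial>gauss1)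
     = (\<integral>x. x * poly (He a * q) x - poly (pderiv (He a)) x * poly q x \<partial>gauss1)"
    by (simp add: algebra_simps)
  also have "\<dots> = (\<integral>x. x * poly (He a * q) x \<partial>gauss1) - (\<integral>x. poly (pderiv (He a)) x * poly q x \<partial>gauss1)"
    using integrable_gauss1_poly_mult[of "[:0,1:]" "He a * q"] by (intro Bochner_Integration.integral_diff) auto
  also have "(\<integral>x. x * poly (He a * q) x \<partial>gauss1) = 
     (\<integral>x. poly (He a) x * poly (pderiv q) x + poly (pderiv (He a)) x * poly q x \<partial>gauss1)"
    unfolding gauss1_ibp
    by (rule Bochner_Integration.integral_cong) (simp_all add: pderiv_mult algebra_simps)
  finally show ?thesis by simp
qed

lemma He_orthogonal:
  "(\<integral>x. poly (He a) x * poly (He b) x \<partial>gauss1) = (if a = b then fact a else 0)"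
proof (induction a arbitrary: b)
  case 0
  have "(\<integral>x. poly (He (Suc c)) x * poly 1 x \<partial>gauss1) = 0" for c
    unfolding integral_He_Suc_mult by simp
  then show ?case using gauss1.prob_space by (cases b) (simp_all del: He.simps(2))
next
  case (Suc a)
  then show ?case unfolding integral_He_Suc_mult
    by (cases b) (simp_all add: pderiv_He_Suc mult.left_commute del: He.simps(2) of_nat_Suc)
qed

text \<open>The one-dimensional form of the intertwining between Hermite polynomials and rotations. Both sides
  satisfy the same three-term recursion in each index: expand \<open>He\<close> of index \<open>Suc k\<close> (or \<open>Suc b\<close>) and
  remove the factor \<open>w\<close> by integration by parts.\<close>

lemma integral_He_rotate:
  fixes \<rho> s :: real
  assumes rs: "\<rho>\<^sup>2 + s\<^sup>2 = 1"
  shows "(\<integral>w. poly (He k) (s * z - \<rho> * w) * poly (He b) (\<rho> * z + s * w) \<partial>gauss1)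
     = s ^ k * \<rho> ^ b * poly (He (k + b)) z"
proof -
  define A where "A k = pcompose (He k) [:s * z, - \<rho>:]" for k
  define B where "B k = pcompose (He k) [:\<rho> * z, s:]" for k
  define Q where "Q k b = (\<integral>w. poly (A k) w * poly (B b) w \<partial>gauss1)" for k b
  have pA: "poly (A k) w = poly (He k) (s * z - \<rho> * w)" for k w
    by (simp add: A_def poly_pcompose mult_ac)
  have pB: "poly (B k) w = poly (He k) (\<rho> * z + s * w)" for k w
    by (simp add: B_def poly_pcompose mult_ac)
  have dA: "poly (pderiv (A k)) w = - \<rho> * (real k * poly (A (k - 1)) w)" for k w
    unfolding A_def by (simp add: pderiv_pcompose pderiv_He pderiv_pCons poly_pcompose)
  have dB: "poly (pderiv (B k)) w = s * (real k * poly (B (k - 1)) w)" for k w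
    unfolding B_def by (simp add: pderiv_pcompose pderiv_He pderiv_pCons poly_pcompose)
  have ibp: "(\<integral>w. w * (poly (A k) w * poly (B b) w) \<partial>gauss1)
     = - \<rho> * real k * Q (k - 1) b + s * real b * Q k (b - 1)" for k b
  proof -
    have "(\<integral>w. w * (poly (A k) w * poly (B b) w) \<partial>gauss1) = (\<integral>w. w * poly (A k * B b) w \<partial>gauss1)" by simp
    also have "\<dots> = (\<integral>w. (- \<rho> * real k) * (poly (A (k-1)) w * poly (B b) w) + (s * real b) * (poly (A k) w * poly (B (b - 1)) w) \<partial>gauss1)"
      unfolding gauss1_ibp
      by (rule Bochner_Integration.integral_cong) (simp_all only: pderiv_mult poly_add poly_mult dA dB, simp add: algebra_simps)
    also have "\<dots> = - \<rho> * real k * Q (k - 1) b + s * real b * Q k (b - 1)"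
      unfolding Q_def by (subst Bochner_Integration.integral_add) (auto intro!: integrable_mult_right)
    finally show ?thesis .
  qed
  have intw: "integrable gauss1 (\<lambda>w. w * (poly (A k) w * poly (B b) w))" for k b
    using integrable_gauss1_poly_mult[of "[:0,1:]" "A k * B b"] by simp
  have recB: "Q 0 (Suc b) = \<rho> * z * Q 0 b - \<rho>\<^sup>2 * real b * Q 0 (b - 1)" for b
  proof -
    have "Q 0 (Suc b) = (\<integral>w. \<rho> * z * (poly (A 0) w * poly (B b) w) + s * (w * (poly (A 0) w * poly (B b) w))
       - real b * (poly (A 0) w * poly (B (b - 1)) w) \<partial>gauss1)"
      unfolding Q_def pB He_rec by (simp add: algebra_simps)
    also have "\<dots> = \<rho> * z * Q 0 b + s * (\<integral>w. w * (poly (A 0) w * poly (B b) w) \<partial>gauss1) - real b * Q 0 (b - 1)"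
      unfolding Q_def using intw by (simp add: integrable_mult_right)
    finally have "Q 0 (Suc b) = \<rho> * z * Q 0 b + (s * s - 1) * real b * Q 0 (b - 1)"
      unfolding ibp by (simp add: algebra_simps)
    moreover have "s * s - 1 = - \<rho>\<^sup>2" using rs by (simp add: power2_eq_square algebra_simps)
    ultimately show ?thesis by simp
  qed
  have recA: "Q (Suc k) b = s * z * Q k b - s\<^sup>2 * real k * Q (k - 1) b - \<rho> * s * real b * Q k (b - 1)" for k b
  proof -
    have "Q (Suc k) b = (\<integral>w. s * z * (poly (A k) w * poly (B b) w) - \<rho> * (w * (poly (A k) w * poly (B b) w))
       - real k * (poly (A (k - 1)) w * poly (B b) w) \<partial>gauss1)"
      unfolding Q_def pA He_rec by (simp add: algebra_simps)
    also have "\<dots> = s * z * Q k b - \<rho> * (\<integral>w. w * (poly (A k) w * poly (B b) w) \<partial>gauss1) - real k * Q (k - 1) b"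
      unfolding Q_def using intw by (simp add: integrable_mult_right)
    finally have "Q (Suc k) b = s * z * Q k b + (\<rho> * \<rho> - 1) * real k * Q (k - 1) b - \<rho> * s * real b * Q k (b - 1)"
      unfolding ibp by (simp add: algebra_simps)
    moreover have "\<rho> * \<rho> - 1 = - s\<^sup>2" using rs by (simp add: power2_eq_square algebra_simps)
    ultimately show ?thesis by simp
  qed
  have base: "Q 0 b = \<rho> ^ b * poly (He b) z" for b
  proof (induction b rule: less_induct)
    case (less b)
    show ?case
    proof (cases b)
      case 0 then show ?thesis using gauss1.prob_space by (simp add: Q_def pA pB)
    next
      case (Suc c)
      have 1: "real c * Q 0 (c - 1) = real c * (\<rho> ^ (c - 1) * poly (He (c - 1)) z)"
        using less[of "c - 1"] Suc by (cases c) auto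
      have 2: "Q 0 c = \<rho> ^ c * poly (He c) z" using less[of c] Suc by auto
      have 3: "\<rho> * (real c * \<rho> ^ (c - 1)) = real c * \<rho> ^ c" by (cases c) auto
      have "Q 0 b = \<rho> * z * Q 0 c - \<rho>\<^sup>2 * (real c * Q 0 (c - 1))"
        unfolding Suc recB by simp
      also have "\<dots> = \<rho> * z * (\<rho> ^ c * poly (He c) z) - \<rho> * (\<rho> * (real c * \<rho> ^ (c - 1))) * poly (He (c - 1)) z"
        unfolding 1 2 power2_eq_square by (simp only: mult_ac)
      also have "\<dots> = \<rho> * \<rho> ^ c * (z * poly (He c) z - real c * poly (He (c - 1)) z)"
        unfolding 3 by (simp add: algebra_simps)
      also have "z * poly (He c) z - real c * poly (He (c - 1)) z = poly (He (Suc c)) z"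
        unfolding He_rec by simp
      finally show ?thesis using Suc by (simp del: He.simps(2))
    qed
  qed
  have "Q k b = s ^ k * \<rho> ^ b * poly (He (k + b)) z"
  proof (induction k arbitrary: b rule: less_induct)
    case (less k)
    show ?case
    proof (cases k)
      case 0 then show ?thesis using base by simp
    next
      case (Suc c)
      have 1: "real c * Q (c - 1) b = real c * (s ^ (c - 1) * \<rho> ^ b * poly (He (c + b - 1)) z)"
        using less[of "c - 1" b] Suc by (cases c) auto
      have 2: "real b * Q c (b - 1) = real b * (s ^ c * \<rho> ^ (b - 1) * poly (He (c + b - 1)) z)"
        using less[of c "b - 1"] Suc by (cases b) auto
      have 3: "Q c b = s ^ c * \<rho> ^ b * poly (He (c + b)) z" using less[of c b] Suc by auto
      have 4: "s\<^sup>2 * (real c * s ^ (c - 1)) = real c * (s * s ^ c)" by (cases c) (auto simp: power2_eq_square)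
      have 5: "\<rho> * (real b * \<rho> ^ (b - 1)) = real b * \<rho> ^ b" by (cases b) auto
      have "Q k b = s * z * Q c b - s\<^sup>2 * (real c * Q (c - 1) b) - \<rho> * s * (real b * Q c (b - 1))"
        unfolding Suc recA by simp
      also have "\<dots> = s * z * (s ^ c * \<rho> ^ b * poly (He (c + b)) z)
         - (s\<^sup>2 * (real c * s ^ (c - 1))) * (\<rho> ^ b * poly (He (c + b - 1)) z)
         - (\<rho> * (real b * \<rho> ^ (b - 1))) * (s * s ^ c * poly (He (c + b - 1)) z)"
        unfolding 1 2 3 by (simp only: mult_ac)
      also have "\<dots> = s * s ^ c * \<rho> ^ b * (z * poly (He (c + b)) z - real (c + b) * poly (He (c + b - 1)) z)"
        unfolding 4 5 by (simp add: algebra_simps)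
      also have "z * poly (He (c + b)) z - real (c + b) * poly (He (c + b - 1)) z = poly (He (Suc (c + b))) z"
        unfolding He_rec by simp
      finally show ?thesis using Suc by (simp del: He.simps(2))
    qed
  qed
  then show ?thesis unfolding Q_def pA pB .
qed

text \<open>A class of weights that contains polynomials, bounded functions and \<open>exp (a * \<bar>x\<bar>)\<close>, is closed
  under products and consists of Gaussian-integrable functions. It serves every domination argument
  below.\<close>

definition exp_bounded :: "(real \<Rightarrow> real) \<Rightarrow> bool" where
  "exp_bounded w \<longleftrightarrow> w \<in> borel_measurable borel \<and> (\<exists>C c. \<forall>x. \<bar>w x\<bar> \<le> C * exp (c * \<bar>x\<bar>))"

lemma exp_boundedD [measurable_dest]: "exp_bounded w \<Longrightarrow> w \<in> borel_measurable borel"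
  by (simp add: exp_bounded_def)

lemma exp_bounded_bounded:
  "w \<in> borel_measurable borel \<Longrightarrow> (\<And>x. \<bar>w x\<bar> \<le> C) \<Longrightarrow> exp_bounded w"
  unfolding exp_bounded_def by (intro conjI exI[of _ C] exI[of _ 0] allI) auto

lemma exp_bounded_mult:
  assumes "exp_bounded v" "exp_bounded w" shows "exp_bounded (\<lambda>x. v x * w x)"
proof -
  obtain C c where v: "\<And>x. \<bar>v x\<bar> \<le> C * exp (c * \<bar>x\<bar>)" using assms by (auto simp: exp_bounded_def)
  obtain D d where w: "\<And>x. \<bar>w x\<bar> \<le> D * exp (d * \<bar>x\<bar>)" using assms by (auto simp: exp_bounded_def)
  have "\<bar>v x * w x\<bar> \<le> (C * D) * exp ((c + d) * \<bar>x\<bar>)" for x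
  proof -
    have "\<bar>v x * w x\<bar> \<le> (C * exp (c * \<bar>x\<bar>)) * (D * exp (d * \<bar>x\<bar>))"
      unfolding abs_mult by (rule mult_mono') (use v w in auto)
    then show ?thesis by (simp add: exp_add ring_distribs mult_ac)
  qed
  then show ?thesis using assms unfolding exp_bounded_def by (auto intro: borel_measurable_times)
qed

lemma exp_bounded_const: "exp_bounded (\<lambda>_. k)"
  by (rule exp_bounded_bounded[of _ "\<bar>k\<bar>"]) auto

lemma exp_bounded_abs: "exp_bounded u \<Longrightarrow> exp_bounded (\<lambda>x. \<bar>u x\<bar>)"
  by (auto simp: exp_bounded_def)

lemma exp_bounded_add:
  assumes u: "exp_bounded u" and v: "exp_bounded v" shows "exp_bounded (\<lambda>x. u x + v x)"
proof -
  obtain C c where C: "\<And>x. \<bar>u x\<bar> \<le> C * exp (c * \<bar>x\<bar>)" using u by (auto simp: exp_bounded_def)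
  obtain E d where E: "\<And>x. \<bar>v x\<bar> \<le> E * exp (d * \<bar>x\<bar>)" using v by (auto simp: exp_bounded_def)
  have "C \<ge> 0" "E \<ge> 0" using C[of 0] E[of 0] by auto
  have "\<bar>u x + v x\<bar> \<le> (C + E) * exp ((\<bar>c\<bar> + \<bar>d\<bar>) * \<bar>x\<bar>)" for x
  proof -
    have "C * exp (c * \<bar>x\<bar>) \<le> C * exp ((\<bar>c\<bar> + \<bar>d\<bar>) * \<bar>x\<bar>)" "E * exp (d * \<bar>x\<bar>) \<le> E * exp ((\<bar>c\<bar> + \<bar>d\<bar>) * \<bar>x\<bar>)"
      using \<open>C \<ge> 0\<close> \<open>E \<ge> 0\<close> by (auto intro!: mult_left_mono mult_right_mono)
    then show ?thesis unfolding distrib_right[of C E]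
      using C[of x] E[of x] abs_triangle_ineq[of "u x" "v x"] by linarith
  qed
  then show ?thesis using u v unfolding exp_bounded_def by (intro conjI) (auto intro: borel_measurable_add)
qed

lemma exp_bounded_exp: "exp_bounded (\<lambda>x. exp (a * \<bar>x\<bar>))"
  unfolding exp_bounded_def by (intro conjI exI[of _ 1] exI[of _ a] allI) auto

lemma power_le_fact_exp: "0 \<le> (x::real) \<Longrightarrow> x ^ n \<le> fact n * exp x"
proof -
  assume x: "0 \<le> x"
  have "(\<Sum>i\<in>{n}. inverse (fact i) * x ^ i) \<le> (\<Sum>i. inverse (fact i) * x ^ i)"
    by (rule sum_le_suminf) (use summable_exp[of x] x in auto)
  then show ?thesis by (simp add: exp_def field_simps)
qed

lemma exp_bounded_poly: "exp_bounded (poly p)"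
proof -
  have "\<bar>poly p x\<bar> \<le> (\<Sum>i\<le>degree p. \<bar>coeff p i\<bar> * fact i) * exp (1 * \<bar>x\<bar>)" for x
  proof -
    have "\<bar>poly p x\<bar> \<le> (\<Sum>i\<le>degree p. \<bar>coeff p i\<bar> * \<bar>x\<bar> ^ i)"
      unfolding poly_altdef by (rule order_trans[OF sum_abs]) (simp add: abs_mult power_abs)
    also have "\<dots> \<le> (\<Sum>i\<le>degree p. \<bar>coeff p i\<bar> * (fact i * exp \<bar>x\<bar>))"
      by (intro sum_mono mult_left_mono power_le_fact_exp) auto
    finally show ?thesis by (simp add: sum_distrib_right sum_distrib_left mult_ac)
  qed
  moreover have "poly p \<in> borel_measurable borel"
    by (intro borel_measurable_continuous_onI continuous_intros)
  ultimately show ?thesis unfolding exp_bounded_def by blast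
qed

lemma integrable_exp_gauss1: "integrable gauss1 (\<lambda>x. exp (a * x))"
proof -
  have "std_normal_density x * exp (a * x) = exp (a\<^sup>2 / 2) * normal_density a 1 x" for x
    by (simp add: normal_density_def exp_add[symmetric] field_simps power2_eq_square flip: exp_add)
  then show ?thesis
    by (subst integrable_density) (auto intro!: integrable_mult_right)
qed

lemma exp_bounded_integrable:
  assumes "exp_bounded w" shows "integrable gauss1 w"
proof -
  obtain C c where v: "\<And>x. \<bar>w x\<bar> \<le> C * exp (c * \<bar>x\<bar>)" using assms by (auto simp: exp_bounded_def)
  have C: "0 \<le> C" using v[of 0] by simp
  have [measurable]: "w \<in> borel_measurable borel" using assms by measurable
  show ?thesis
  proof (rule Bochner_Integration.integrable_bound)
    show "integrable gauss1 (\<lambda>x. C * (exp (c * x) + exp ((- c) * x)))"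
      by (intro integrable_mult_right Bochner_Integration.integrable_add integrable_exp_gauss1)
    have "\<bar>w x\<bar> \<le> C * (exp (c * x) + exp ((- c) * x))" for x
    proof -
      have "exp (c * \<bar>x\<bar>) \<le> exp (c * x) + exp ((- c) * x)"
        by (cases "x \<ge> 0") (auto simp: add_increasing2 add_increasing)
      then show ?thesis using v[of x] C by (meson mult_left_mono order_trans)
    qed
    then show "AE x in gauss1. norm (w x) \<le> norm (C * (exp (c * x) + exp ((- c) * x)))"
      using C by (intro AE_I2) (simp add: abs_mult)
  qed simp
qed

section \<open>Square-integrable functions and multivariate Hermite polynomials\<close>

definition L2 :: "'a measure \<Rightarrow> ('a \<Rightarrow> real) set" where
  "L2 M = {f \<in> borel_measurable M. integrable M (\<lambda>x. (f x)\<^sup>2)}"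

lemma gauss_L2_eq: "gauss_L2 = L2 gauss"
  by (simp add: gauss_L2_def L2_def)

lemma L2I: "f \<in> borel_measurable M \<Longrightarrow> integrable M (\<lambda>x. (f x)\<^sup>2) \<Longrightarrow> f \<in> L2 M"
  by (simp add: L2_def)

lemma L2_measurable [measurable_dest]: "f \<in> L2 M \<Longrightarrow> f \<in> borel_measurable M"
  by (simp add: L2_def)

lemma L2_integrable_sq: "f \<in> L2 M \<Longrightarrow> integrable M (\<lambda>x. (f x)\<^sup>2)"
  by (simp add: L2_def)

lemma L2_integrable_mult:
  assumes "f \<in> L2 M" "g \<in> L2 M" shows "integrable M (\<lambda>x. f x * g x)"
proof (rule Bochner_Integration.integrable_bound)
  show "integrable M (\<lambda>x. (f x)\<^sup>2 + (g x)\<^sup>2)" using assms by (auto intro: L2_integrable_sq)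
  show "(\<lambda>x. f x * g x) \<in> borel_measurable M" using assms by measurable
  have "\<bar>a * b\<bar> \<le> a\<^sup>2 + b\<^sup>2" for a b :: real
  proof -
    have "2 * (\<bar>a\<bar> * \<bar>b\<bar>) \<le> a\<^sup>2 + b\<^sup>2" using sum_squares_bound[of "\<bar>a\<bar>" "\<bar>b\<bar>"] by simp
    moreover have "0 \<le> \<bar>a\<bar> * \<bar>b\<bar>" by simp
    ultimately show ?thesis unfolding abs_mult by linarith
  qed
  then show "AE x in M. norm (f x * g x) \<le> norm ((f x)\<^sup>2 + (g x)\<^sup>2)" by simp
qed

lemma L2_cmult: "f \<in> L2 M \<Longrightarrow> (\<lambda>x. c * f x) \<in> L2 M"
  by (auto simp: L2_def power_mult_distrib intro: borel_measurable_times)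

lemma L2_add: "f \<in> L2 M \<Longrightarrow> g \<in> L2 M \<Longrightarrow> (\<lambda>x. f x + g x) \<in> L2 M"
  using L2_integrable_mult[of f M g] L2_integrable_sq[of f M] L2_integrable_sq[of g M]
  by (auto simp: L2_def power2_sum mult.assoc intro!: Bochner_Integration.integrable_add)

lemma L2_diff: "f \<in> L2 M \<Longrightarrow> g \<in> L2 M \<Longrightarrow> (\<lambda>x. f x - g x) \<in> L2 M"
  using L2_add[of f M "\<lambda>x. (-1) * g x"] L2_cmult[of g M "-1"] by simp

lemma L2_zero: "(\<lambda>x. 0) \<in> L2 M" by (simp add: L2_def)

lemma L2_sum: "(\<And>i. i \<in> I \<Longrightarrow> f i \<in> L2 M) \<Longrightarrow> (\<lambda>x. \<Sum>i\<in>I. f i x) \<in> L2 M"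
  by (induction I rule: infinite_finite_induct) (auto intro: L2_add L2_zero)

lemma L2_abs: "f \<in> L2 M \<Longrightarrow> (\<lambda>x. \<bar>f x\<bar>) \<in> L2 M"
  by (auto simp: L2_def)

lemma L2_bound:
  assumes "g \<in> L2 M" "f \<in> borel_measurable M" "AE x in M. \<bar>f x\<bar> \<le> \<bar>g x\<bar>"
  shows "f \<in> L2 M"
proof (rule L2I[OF assms(2)], rule Bochner_Integration.integrable_bound[OF L2_integrable_sq[OF assms(1)]])
  show "AE x in M. norm ((f x)\<^sup>2) \<le> norm ((g x)\<^sup>2)"
    using assms(3) by eventually_elim (simp add: abs_le_square_iff)
  show "(\<lambda>x. (f x)\<^sup>2) \<in> borel_measurable M" using assms(2) by simp
qed

lemma (in finite_measure) L2_bounded: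
  assumes "f \<in> borel_measurable M" "\<And>x. \<bar>f x\<bar> \<le> C" shows "f \<in> L2 M"
proof (rule L2_bound[OF _ assms(1)])
  show "(\<lambda>_. C) \<in> L2 M" by (simp add: L2_def)
  show "AE x in M. \<bar>f x\<bar> \<le> \<bar>C\<bar>"
    by (rule AE_I2) (rule order_trans[OF assms(2) abs_ge_self])
qed

lemma (in finite_measure) L2_integrable: "f \<in> L2 M \<Longrightarrow> integrable M f"
  using L2_integrable_mult[of f M "\<lambda>_. 1"] by (simp add: L2_def)

text \<open>The discriminant of the nonnegative quadratic polynomial \<open>t \<mapsto> \<integral>(f + t g)\<^sup>2\<close>.\<close>

lemma L2_cauchy_schwarz:
  assumes f: "f \<in> L2 M" and g: "g \<in> L2 M"
  shows "(\<integral>x. f x * g x \<partial>M)\<^sup>2 \<le> (\<integral>x. (f x)\<^sup>2 \<partial>M) * (\<integral>x. (g x)\<^sup>2 \<partial>M)"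
proof -
  define A B C where "A = (\<integral>x. (f x)\<^sup>2 \<partial>M)" and "B = (\<integral>x. f x * g x \<partial>M)" and "C = (\<integral>x. (g x)\<^sup>2 \<partial>M)"
  have C0: "C \<ge> 0" by (simp add: C_def)
  have A0: "A \<ge> 0" by (simp add: A_def)
  note int = L2_integrable_sq[OF f] L2_integrable_sq[OF g] L2_integrable_mult[OF f g]
  have q: "A + 2 * t * B + t\<^sup>2 * C \<ge> 0" for t
  proof -
    have "0 \<le> (\<integral>x. (f x + t * g x)\<^sup>2 \<partial>M)" by simp
    also have "\<dots> = (\<integral>x. (f x)\<^sup>2 + (2 * t) * (f x * g x) + t\<^sup>2 * (g x)\<^sup>2 \<partial>M)"
      by (simp add: power2_sum power_mult_distrib algebra_simps)
    also have "\<dots> = A + 2 * t * B + t\<^sup>2 * C"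
      unfolding A_def B_def C_def using int by simp
    finally show ?thesis .
  qed
  have "B\<^sup>2 \<le> A * C"
  proof (cases "C = 0")
    case True
    have "B = 0"
    proof (rule ccontr)
      assume "B \<noteq> 0"
      \<comment> \<open>If \<open>C = 0\<close> the polynomial is affine, and at this point it equals \<open>- 1\<close>.\<close>
      then show False using q[of "- (A + 1) / (2 * B)"] True A0 by (simp add: field_simps)
    qed
    then show ?thesis using True by simp
  next
    case False
    then have C: "C > 0" using C0 by simp
    have "A + 2 * (- B / C) * B + (- B / C)\<^sup>2 * C = A - B\<^sup>2 / C"
      using C by (simp add: field_simps power2_eq_square)
    then have "B\<^sup>2 / C \<le> A" using q[of "- B / C"] by linarith
    then show ?thesis using C by (simp add: field_simps)
  qed
  then show ?thesis by (simp add: A_def B_def C_def)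
qed

lemma measurable_vec_nth [measurable]:
  "f \<in> borel_measurable M \<Longrightarrow> (\<lambda>x. (f x :: real ^ 'n) $ i) \<in> borel_measurable M"
  by (rule measurable_compose[of f M borel "\<lambda>v. v $ i"])
     (auto intro!: borel_measurable_continuous_onI continuous_intros)

lemma measurable_vec_lambda:
  "vec_lambda \<in> measurable (\<Pi>\<^sub>M i\<in>(UNIV::'n::finite set). lborel) (borel :: (real ^ 'n) measure)"
proof (rule borel_measurable_euclidean_space[THEN iffD2], intro ballI)
  fix b :: "real ^ 'n" assume "b \<in> Basis"
  then obtain i where b: "b = axis i 1" by (auto simp: Basis_vec_def)
  have "(\<lambda>f. f i) \<in> borel_measurable (\<Pi>\<^sub>M i\<in>(UNIV::'n set). (lborel :: real measure))"
    using measurable_component_singleton[of i UNIV "\<lambda>_. lborel :: real measure"] by (simp add: measurable_lborel1 cong: measurable_cong_sets)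
  then show "(\<lambda>f. vec_lambda f \<bullet> b) \<in> borel_measurable (\<Pi>\<^sub>M i\<in>(UNIV::'n set). (lborel :: real measure))"
    by (simp add: b inner_axis)
qed

lemma Basis_vec_image: "(Basis :: (real ^ 'n) set) = (\<lambda>i. axis i 1) ` UNIV"
  by (auto simp: Basis_vec_def)

lemma prod_Basis_vec: "(\<Prod>b\<in>(Basis :: (real ^ 'n) set). f b) = (\<Prod>i\<in>UNIV. f (axis i 1))"
  unfolding Basis_vec_image by (subst prod.reindex) (auto simp: inj_on_def axis_eq_axis)

interpretation lborel_PiM: product_sigma_finite "\<lambda>_ :: 'n. lborel :: real measure"
  by standard

text \<open>Transfers the Fubini theorems for \<open>\<Pi>\<^sub>M\<close> to the type of vectors.\<close>

lemma lborel_eq_distr_vec_lambda: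
  "(lborel :: (real ^ 'n) measure) = distr (\<Pi>\<^sub>M i\<in>UNIV. lborel) borel vec_lambda"
proof (rule lborel_eqI)
  fix l u :: "real ^ 'n" assume le: "\<And>b. b \<in> Basis \<Longrightarrow> l \<bullet> b \<le> u \<bullet> b"
  have le': "l $ i \<le> u $ i" for i using le[of "axis i 1"] by (simp add: inner_axis)
  have "vec_lambda -` box l u \<inter> space (\<Pi>\<^sub>M i\<in>UNIV. lborel) = (\<Pi>\<^sub>E i\<in>UNIV. {l $ i <..< u $ i})"
    by (auto simp: mem_box_cart space_PiM PiE_iff)
  then have "emeasure (distr (\<Pi>\<^sub>M i\<in>UNIV. lborel) borel vec_lambda) (box l u)
     = emeasure (\<Pi>\<^sub>M i\<in>UNIV. lborel) (\<Pi>\<^sub>E i\<in>UNIV. {l $ i <..< u $ i})"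
    by (simp add: emeasure_distr measurable_vec_lambda)
  also have "\<dots> = (\<Prod>i\<in>UNIV. emeasure lborel {l $ i <..< u $ i})"
    by (subst lborel_PiM.emeasure_PiM) auto
  also have "\<dots> = (\<Prod>i\<in>UNIV. ennreal (u $ i - l $ i))"
    using le' by (simp add: emeasure_lborel_Ioo)
  also have "\<dots> = (\<Prod>b\<in>Basis. (u - l) \<bullet> b)"
    unfolding prod_Basis_vec using le' by (simp add: prod_ennreal inner_axis)
  finally show "emeasure (distr (\<Pi>\<^sub>M i\<in>UNIV. lborel) borel vec_lambda) (box l u) = ennreal (\<Prod>b\<in>Basis. (u - l) \<bullet> b)" .
qed simp

lemma lborel_vec_prod:
  fixes f :: "'n::finite \<Rightarrow> real \<Rightarrow> real"
  assumes f: "\<And>i. integrable lborel (f i)"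
  shows "integrable lborel (\<lambda>x::real^'n. \<Prod>i\<in>UNIV. f i (x $ i))"
    and "(\<integral>x. (\<Prod>i\<in>UNIV. f i ((x::real^'n) $ i)) \<partial>lborel) = (\<Prod>i\<in>UNIV. \<integral>x. f i x \<partial>lborel)"
proof -
  have [measurable]: "f i \<in> borel_measurable borel" for i
    using f[of i] by (simp add: integrable_iff_bounded)
  have m: "(\<lambda>x::real^'n. \<Prod>i\<in>UNIV. f i (x $ i)) \<in> borel_measurable borel" by measurable
  show "integrable lborel (\<lambda>x::real^'n. \<Prod>i\<in>UNIV. f i (x $ i))"
    unfolding lborel_eq_distr_vec_lambda
    by (subst integrable_distr_eq[OF measurable_vec_lambda m])
       (use lborel_PiM.product_integrable_prod[of UNIV f] f in simp)
  show "(\<integral>x. (\<Prod>i\<in>UNIV. f i ((x::real^'n) $ i)) \<partial>lborel) = (\<Prod>i\<in>UNIV. \<integral>x. f i x \<partial>lborel)"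
    unfolding lborel_eq_distr_vec_lambda[where 'n='n]
    by (subst integral_distr[OF measurable_vec_lambda m])
       (use lborel_PiM.product_integral_prod[of UNIV f] f in simp)
qed

lemma gauss_density_eq_prod: "gauss_density (x :: real ^ 'n) = (\<Prod>i\<in>UNIV. std_normal_density (x $ i))"
proof -
  have n: "(norm x)\<^sup>2 = (\<Sum>i\<in>UNIV. (x $ i)\<^sup>2)"
    by (simp add: norm_vec_def L2_set_def sum_nonneg)
  have "(2 * pi) powr (- (real CARD('n) / 2)) = (\<Prod>i\<in>(UNIV::'n set). 1 / sqrt (2 * pi))"
  proof -
    have "1 / sqrt (2 * pi) = (2 * pi) powr (- (1 / 2))"
      by (simp add: powr_minus_divide powr_half_sqrt)
    then show ?thesis by (simp add: powr_power)
  qed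
  then show ?thesis
    unfolding gauss_density_def normal_density_def n
    by (simp add: prod_dividef exp_sum[symmetric] sum_divide_distrib sum_negf power_one_over)
qed

lemma gauss_density_pos: "gauss_density x > 0"
  by (simp add: gauss_density_def)

lemma gauss_density_measurable [measurable]: "gauss_density \<in> borel_measurable borel"
  unfolding gauss_density_def[abs_def] by measurable

lemma sets_gauss [simp, measurable_cong]: "sets gauss = sets borel"
  by (simp add: gauss_def)

lemma space_gauss [simp]: "space gauss = UNIV"
  by (simp add: gauss_def)

lemma integrable_gauss_iff:
  "f \<in> borel_measurable borel \<Longrightarrow> integrable gauss f \<longleftrightarrow> integrable lborel (\<lambda>x. gauss_density x * f x)" for f :: "real^'n \<Rightarrow> real"
  unfolding gauss_def by (subst integrable_density) (auto simp: less_imp_le gauss_density_pos)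

lemma integral_gauss:
  "f \<in> borel_measurable borel \<Longrightarrow> (\<integral>x. f x \<partial>gauss) = (\<integral>x. gauss_density x * f x \<partial>lborel)" for f :: "real^'n \<Rightarrow> real"
  unfolding gauss_def by (subst integral_density) (auto simp: less_imp_le gauss_density_pos)

lemma AE_gauss_iff: "(AE x in gauss. P x) \<longleftrightarrow> (AE x in lborel. P x)"
  unfolding gauss_def by (subst AE_density) (auto simp: gauss_density_pos)

text \<open>Independence of the coordinates.\<close>

lemma gauss_prod:
  fixes f :: "'n::finite \<Rightarrow> real \<Rightarrow> real"
  assumes f: "\<And>i. integrable gauss1 (f i)"
  shows "integrable gauss (\<lambda>x::real^'n. \<Prod>i\<in>UNIV. f i (x $ i))"
    and "(\<integral>x. (\<Prod>i\<in>UNIV. f i ((x::real^'n) $ i)) \<partial>gauss) = (\<Prod>i\<in>UNIV. \<integral>x. f i x \<partial>gauss1)"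
proof -
  have [measurable]: "f i \<in> borel_measurable borel" for i
    using f[of i] by (simp add: integrable_iff_bounded)
  have m: "(\<lambda>x::real^'n. \<Prod>i\<in>UNIV. f i (x $ i)) \<in> borel_measurable borel" by measurable
  have f': "integrable lborel (\<lambda>x. std_normal_density x * f i x)" for i
    using f[of i] by (simp add: integrable_density)
  show "integrable gauss (\<lambda>x::real^'n. \<Prod>i\<in>UNIV. f i (x $ i))"
    unfolding integrable_gauss_iff[OF m]
    using lborel_vec_prod(1)[OF f'] by (simp add: gauss_density_eq_prod prod.distrib)
  have "(\<integral>x. (\<Prod>i\<in>UNIV. f i ((x::real^'n) $ i)) \<partial>gauss) = (\<Prod>i\<in>UNIV. \<integral>x. std_normal_density x * f i x \<partial>lborel)"
    unfolding integral_gauss[OF m]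
    using lborel_vec_prod(2)[OF f'] by (simp add: gauss_density_eq_prod prod.distrib)
  then show "(\<integral>x. (\<Prod>i\<in>UNIV. f i ((x::real^'n) $ i)) \<partial>gauss) = (\<Prod>i\<in>UNIV. \<integral>x. f i x \<partial>gauss1)"
    by (simp add: integral_density)
qed

interpretation gauss: prob_space "gauss :: (real ^ 'n) measure"
proof
  have 1: "integrable gauss (\<lambda>x::real^'n. 1::real)" "(\<integral>x. 1 \<partial>(gauss :: (real ^ 'n) measure)) = (1::real)"
    using gauss_prod[of "\<lambda>(_::'n) _. 1"] gauss1.prob_space by simp_all
  have "(\<integral>\<^sup>+x. ennreal 1 \<partial>(gauss :: (real ^ 'n) measure)) = ennreal 1"
    using nn_integral_eq_integral[OF 1(1)] 1(2) by simp
  then show "emeasure (gauss :: (real ^ 'n) measure) (space gauss) = 1"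
    by simp
qed

lemma prod_exp_bounded_L2:
  fixes w :: "'n::finite \<Rightarrow> real \<Rightarrow> real"
  assumes "\<And>i. exp_bounded (w i)"
  shows "(\<lambda>x::real^'n. \<Prod>i\<in>UNIV. w i (x $ i)) \<in> L2 gauss"
proof (rule L2I)
  have [measurable]: "w i \<in> borel_measurable borel" for i using assms by (rule exp_boundedD)
  show "(\<lambda>x::real^'n. \<Prod>i\<in>UNIV. w i (x $ i)) \<in> borel_measurable gauss" by measurable
  have "integrable gauss (\<lambda>x::real^'n. \<Prod>i\<in>UNIV. (w i (x $ i) * w i (x $ i)))"
    by (rule gauss_prod(1)[of "\<lambda>i x. w i x * w i x"]) (intro exp_bounded_integrable exp_bounded_mult assms)
  then show "integrable gauss (\<lambda>x::real^'n. (\<Prod>i\<in>UNIV. w i (x $ i))\<^sup>2)"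
    by (simp add: prod.distrib power2_eq_square)
qed

definition he :: "nat \<Rightarrow> real \<Rightarrow> real" where
  "he n x = poly (He n) x / sqrt (fact n)"

lemma exp_bounded_he: "exp_bounded (he n)"
proof -
  have "he n = poly (smult (1 / sqrt (fact n)) (He n))" by (auto simp: he_def fun_eq_iff)
  then show ?thesis using exp_bounded_poly by simp
qed

lemma he_orthonormal: "(\<integral>x. he a x * he b x \<partial>gauss1) = (if a = b then 1 else 0)"
proof -
  have "(\<integral>x. he a x * he b x \<partial>gauss1) = (\<integral>x. (1 / (sqrt (fact a) * sqrt (fact b))) * (poly (He a) x * poly (He b) x) \<partial>gauss1)"
    by (simp add: he_def field_simps)
  also have "\<dots> = (1 / (sqrt (fact a) * sqrt (fact b))) * (if a = b then fact a else 0)"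
    unfolding integral_mult_right_zero He_orthogonal ..
  finally show ?thesis by simp
qed

definition hermite :: "('n \<Rightarrow> nat) \<Rightarrow> real ^ 'n \<Rightarrow> real" where
  "hermite \<alpha> x = (\<Prod>i\<in>UNIV. he (\<alpha> i) (x $ i))"

lemma hermite_zero [simp]: "hermite (\<lambda>_. 0) x = 1"
  by (simp add: hermite_def he_def)

lemma hermite_L2: "hermite \<alpha> \<in> L2 gauss"
  unfolding hermite_def[abs_def] by (intro prod_exp_bounded_L2 exp_bounded_he)

lemma hermite_measurable [measurable]: "hermite \<alpha> \<in> borel_measurable borel"
  using L2_measurable[OF hermite_L2[of \<alpha>]] by (simp cong: measurable_cong_sets)

lemma hermite_orthonormal:
  "(\<integral>x. hermite \<alpha> x * hermite \<beta> x \<partial>gauss) = (if \<alpha> = \<beta> then 1 else 0)" for \<alpha> \<beta> :: "'n::finite \<Rightarrow> nat"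
proof -
  have "(\<integral>x. hermite \<alpha> x * hermite \<beta> x \<partial>gauss) = (\<Prod>i\<in>UNIV. \<integral>x. he (\<alpha> i) x * he (\<beta> i) x \<partial>gauss1)"
    unfolding hermite_def prod.distrib[symmetric]
    by (rule gauss_prod(2)[of "\<lambda>i x. he (\<alpha> i) x * he (\<beta> i) x"])
       (intro exp_bounded_integrable exp_bounded_mult exp_bounded_he)
  also have "\<dots> = (if \<alpha> = \<beta> then 1 else 0)"
  proof (cases "\<alpha> = \<beta>")
    case False
    then obtain i where "\<alpha> i \<noteq> \<beta> i" by auto
    then show ?thesis using False by (auto simp: he_orthonormal intro!: prod_zero)
  qed (simp add: he_orthonormal)
  finally show ?thesis .
qed

text \<open>The Hermite coefficient of \<open>f\<close> at the multi-index \<open>\<alpha>\<close>.\<close>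

definition coef :: "(real ^ 'n \<Rightarrow> real) \<Rightarrow> ('n \<Rightarrow> nat) \<Rightarrow> real" where
  "coef f \<alpha> = (\<integral>x. f x * hermite \<alpha> x \<partial>gauss)"

definition hermite_sum :: "('n::finite \<Rightarrow> nat) set \<Rightarrow> (real ^ 'n \<Rightarrow> real) \<Rightarrow> real ^ 'n \<Rightarrow> real" where
  "hermite_sum A f x = (\<Sum>\<alpha>\<in>A. coef f \<alpha> * hermite \<alpha> x)"

lemma hermite_sum_L2: "hermite_sum A f \<in> L2 gauss"
  unfolding hermite_sum_def[abs_def] by (intro L2_sum L2_cmult hermite_L2)

lemma inner_hermite_sum:
  assumes "g \<in> L2 gauss"
  shows "(\<integral>x. hermite_sum A f x * g x \<partial>gauss) = (\<Sum>\<alpha>\<in>A. coef f \<alpha> * coef g \<alpha>)"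
proof -
  have "(\<integral>x. hermite_sum A f x * g x \<partial>gauss) = (\<integral>x. (\<Sum>\<alpha>\<in>A. coef f \<alpha> * (g x * hermite \<alpha> x)) \<partial>gauss)"
    by (simp add: hermite_sum_def sum_distrib_right sum_distrib_left mult_ac)
  also have "\<dots> = (\<Sum>\<alpha>\<in>A. (\<integral>x. coef f \<alpha> * (g x * hermite \<alpha> x) \<partial>gauss))"
    by (intro Bochner_Integration.integral_sum integrable_mult_right L2_integrable_mult assms hermite_L2)
  finally show ?thesis by (simp add: coef_def)
qed

lemma coef_hermite: "coef (hermite \<alpha>) \<beta> = (if \<alpha> = \<beta> then 1 else 0)"
  by (simp add: coef_def hermite_orthonormal)

lemma coef_hermite_sum:
  "finite A \<Longrightarrow> coef (hermite_sum A f) \<beta> = (if \<beta> \<in> A then coef f \<beta> else 0)"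
  unfolding coef_def[of "hermite_sum A f"]
  by (subst inner_hermite_sum[OF hermite_L2]) (simp add: coef_hermite if_distrib cong: if_cong)

lemma coef_diff:
  "f \<in> L2 gauss \<Longrightarrow> g \<in> L2 gauss \<Longrightarrow> coef (\<lambda>x. f x - g x) \<alpha> = coef f \<alpha> - coef g \<alpha>"
  unfolding coef_def by (simp add: left_diff_distrib L2_integrable_mult hermite_L2)

lemma coef_cmult: "coef (\<lambda>x. c * f x) \<alpha> = c * coef f \<alpha>"
  by (simp add: coef_def mult.assoc)

lemma coef_cong_AE: "AE x in gauss. f x = g x \<Longrightarrow> f \<in> borel_measurable borel \<Longrightarrow> g \<in> borel_measurable borel \<Longrightarrow> coef f \<alpha> = coef g \<alpha>"
  unfolding coef_def by (rule integral_cong_AE) auto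

lemma dist_hermite_sum:
  assumes f: "f \<in> L2 gauss" and A: "finite A"
  shows "(\<integral>x. (f x - hermite_sum A f x)\<^sup>2 \<partial>gauss) = (\<integral>x. (f x)\<^sup>2 \<partial>gauss) - (\<Sum>\<alpha>\<in>A. (coef f \<alpha>)\<^sup>2)"
proof -
  let ?S = "hermite_sum A f"
  have S: "?S \<in> L2 gauss" by (rule hermite_sum_L2)
  have "(\<integral>x. (f x - ?S x)\<^sup>2 \<partial>gauss) = (\<integral>x. (f x)\<^sup>2 - 2 * (?S x * f x) + ?S x * ?S x \<partial>gauss)"
    by (simp add: power2_diff power2_eq_square algebra_simps)
  also have "\<dots> = (\<integral>x. (f x)\<^sup>2 \<partial>gauss) - 2 * (\<integral>x. ?S x * f x \<partial>gauss) + (\<integral>x. ?S x * ?S x \<partial>gauss)"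
    by (simp add: L2_integrable_mult S f L2_integrable_sq)
  also have "\<dots> = (\<integral>x. (f x)\<^sup>2 \<partial>gauss) - (\<Sum>\<alpha>\<in>A. (coef f \<alpha>)\<^sup>2)"
    using A by (simp add: inner_hermite_sum S f coef_hermite_sum power2_eq_square)
  finally show ?thesis .
qed

lemma bessel:
  assumes "f \<in> L2 gauss" "finite A"
  shows "(\<Sum>\<alpha>\<in>A. (coef f \<alpha>)\<^sup>2) \<le> (\<integral>x. (f x)\<^sup>2 \<partial>gauss)"
proof -
  have "0 \<le> (\<integral>x. (f x - hermite_sum A f x)\<^sup>2 \<partial>gauss)" by simp
  then show ?thesis using dist_hermite_sum[OF assms] by simp
qed

section \<open>Completeness of the Hermite polynomials\<close>

text \<open>Boxes are a generator stable under intersection, so the measures with densities the positive and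
  the negative part of \<open>F\<close> agree everywhere.\<close>

lemma integrable_box_zero_imp_AE_zero:
  fixes F :: "'a::euclidean_space \<Rightarrow> real"
  assumes F: "integrable lborel F"
    and 0: "\<And>a b. (\<integral>x. F x * indicator (box a b) x \<partial>lborel) = 0"
  shows "AE x in lborel. F x = 0"
proof -
  have [measurable]: "F \<in> borel_measurable borel" using F by (simp add: integrable_iff_bounded)
  define P N where "P x = max 0 (F x)" and "N x = max 0 (- F x)" for x
  have [measurable]: "P \<in> borel_measurable borel" "N \<in> borel_measurable borel"
    unfolding P_def[abs_def] N_def[abs_def] by measurable
  have PN: "F x = P x - N x" "P x \<ge> 0" "N x \<ge> 0" "\<bar>P x\<bar> \<le> \<bar>F x\<bar>" "\<bar>N x\<bar> \<le> \<bar>F x\<bar>" for x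
    by (auto simp: P_def N_def)
  have iP: "integrable lborel P" and iN: "integrable lborel N"
    by (rule Bochner_Integration.integrable_bound[OF F]; use PN in simp)+
  have ib: "integrable lborel (\<lambda>x. G x * indicator (box a b) x)" if "integrable lborel G" for G :: "'a \<Rightarrow> real" and a b
    using integrable_real_mult_indicator[of "box a b" lborel G] that by simp
  have em: "emeasure (density lborel (\<lambda>x. ennreal (G x))) (box a b) = ennreal (\<integral>x. G x * indicator (box a b) x \<partial>lborel)"
    if "integrable lborel G" "\<And>x. G x \<ge> 0" for G :: "'a \<Rightarrow> real" and a b
  proof -
    have [measurable]: "G \<in> borel_measurable borel" using that by (simp add: integrable_iff_bounded)
    have "emeasure (density lborel (\<lambda>x. ennreal (G x))) (box a b) = (\<integral>\<^sup>+x. ennreal (G x * indicator (box a b) x) \<partial>lborel)"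
      by (subst emeasure_density) (auto simp: ennreal_mult' ennreal_indicator that intro!: nn_integral_cong)
    also have "\<dots> = ennreal (\<integral>x. G x * indicator (box a b) x \<partial>lborel)"
      by (rule nn_integral_eq_integral) (use that ib in auto)
    finally show ?thesis .
  qed
  have eq: "density lborel (\<lambda>x. ennreal (P x)) = density lborel (\<lambda>x. ennreal (N x))"
  proof (rule measure_eqI_generator_eq)
    let ?E = "range (\<lambda>(a, b). box a b::'a set)"
    show "Int_stable ?E"
      by (auto simp: Int_stable_def box_Int_box)
    show "?E \<subseteq> Pow UNIV" "sets (density lborel (\<lambda>x. ennreal (P x))) = sigma_sets UNIV ?E"
       "sets (density lborel (\<lambda>x. ennreal (N x))) = sigma_sets UNIV ?E"
      by (simp_all add: borel_eq_box)
    let ?A = "\<lambda>n::nat. box (- (real n *\<^sub>R One)) (real n *\<^sub>R One) :: 'a set"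
    show "range ?A \<subseteq> ?E" "(\<Union>i. ?A i) = UNIV"
      unfolding UN_box_eq_UNIV by auto
    show "emeasure (density lborel (\<lambda>x. ennreal (P x))) (?A i) \<noteq> \<infinity>" for i
      by (simp add: em iP PN)
    fix X assume "X \<in> ?E"
    then obtain a b where X: "X = box a b" by auto
    have "(\<integral>x. P x * indicator (box a b) x \<partial>lborel) - (\<integral>x. N x * indicator (box a b) x \<partial>lborel) = 0"
      using 0[of a b] unfolding PN(1) by (simp add: left_diff_distrib ib iP iN)
    then show "emeasure (density lborel (\<lambda>x. ennreal (P x))) X = emeasure (density lborel (\<lambda>x. ennreal (N x))) X"
      by (simp add: X em iP iN PN)
  qed
  have "AE x in lborel. ennreal (P x) = ennreal (N x)"
    using eq by (subst (asm) sigma_finite_measure.density_unique_iff) (auto intro: sigma_finite_lborel)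
  then show ?thesis by eventually_elim (simp add: PN)
qed

text \<open>Exponential integrability lets one expand \<open>exp (\<i> t X)\<close> into its power series under the integral,
  so the positive and the negative part of \<open>F\<close>, pushed forward by \<open>X\<close>, have the same characteristic
  function. Levy's uniqueness theorem finishes.\<close>

lemma exponential_moments_determine:
  fixes M :: "'a measure" and F X :: "'a \<Rightarrow> real"
  assumes [measurable]: "F \<in> borel_measurable M" "X \<in> borel_measurable M"
    and ex: "\<And>a. integrable M (\<lambda>x. F x * exp (a * \<bar>X x\<bar>))"
    and mom: "\<And>m. (\<integral>x. F x * X x ^ m \<partial>M) = 0"
    and A [measurable]: "A \<in> sets borel"
  shows "(\<integral>x. F x * indicator A (X x) \<partial>M) = 0"
proof -
  have iF: "integrable M F" using ex[of 0] by simp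
  have imom: "integrable M (\<lambda>x. F x * X x ^ m)" for m
  proof (rule Bochner_Integration.integrable_bound[OF integrable_mult_right[OF ex[of 1], of "fact m"]])
    have "\<bar>F x\<bar> * \<bar>X x\<bar> ^ m \<le> fact m * (\<bar>F x\<bar> * exp \<bar>X x\<bar>)" for x
      using mult_left_mono[OF power_le_fact_exp[of "\<bar>X x\<bar>" m], of "\<bar>F x\<bar>"] by (simp add: mult_ac)
    then show "AE x in M. norm (F x * X x ^ m) \<le> norm (fact m * (F x * exp (1 * \<bar>X x\<bar>)))"
      by (simp add: abs_mult power_abs)
  qed simp
  have four: "(\<integral>x. complex_of_real (F x) * iexp (t * X x) \<partial>M) = 0" for t
  proof -
    let ?z = "\<lambda>x. \<i> * complex_of_real (t * X x)"
    let ?s = "\<lambda>n x. complex_of_real (F x) * (\<Sum>m<n. ?z x ^ m /\<^sub>R fact m)"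
    have "(\<lambda>n. \<integral>x. ?s n x \<partial>M) \<longlonglongrightarrow> (\<integral>x. complex_of_real (F x) * iexp (t * X x) \<partial>M)"
    proof (rule integral_dominated_convergence[where w="\<lambda>x. \<bar>F x * exp (\<bar>t\<bar> * \<bar>X x\<bar>)\<bar>"])
      show "AE x in M. (\<lambda>n. ?s n x) \<longlonglongrightarrow> complex_of_real (F x) * iexp (t * X x)"
        using exp_converges[of "?z x" for x] by (intro AE_I2 tendsto_mult tendsto_const) (simp add: sums_def)
      show "integrable M (\<lambda>x. \<bar>F x * exp (\<bar>t\<bar> * \<bar>X x\<bar>)\<bar>)" using ex by (intro integrable_abs)
      have "norm (\<Sum>m<n. ?z x ^ m /\<^sub>R fact m) \<le> exp (\<bar>t\<bar> * \<bar>X x\<bar>)" for n x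
      proof -
        have "norm (\<Sum>m<n. ?z x ^ m /\<^sub>R fact m) \<le> (\<Sum>m<n. (\<bar>t\<bar> * \<bar>X x\<bar>) ^ m /\<^sub>R fact m)"
          by (rule order_trans[OF norm_sum]) (simp add: norm_power norm_mult abs_mult divide_inverse)
        also have "\<dots> \<le> exp (\<bar>t\<bar> * \<bar>X x\<bar>)"
          unfolding exp_def by (rule sum_le_suminf) (use summable_exp_generic[of "\<bar>t\<bar> * \<bar>X x\<bar>"] in auto)
        finally show ?thesis .
      qed
      then show "AE x in M. norm (?s n x) \<le> \<bar>F x * exp (\<bar>t\<bar> * \<bar>X x\<bar>)\<bar>" for n
        by (intro AE_I2) (simp add: norm_mult abs_mult mult_left_mono)
    qed measurable
    moreover have "(\<integral>x. ?s n x \<partial>M) = 0" for n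
    proof -
      have "(\<integral>x. ?s n x \<partial>M) = (\<integral>x. (\<Sum>m<n. ((\<i> * t) ^ m /\<^sub>R fact m) * complex_of_real (F x * X x ^ m)) \<partial>M)"
        by (rule Bochner_Integration.integral_cong) (simp_all add: sum_distrib_left power_mult_distrib scaleR_conv_of_real mult_ac)
      also have "\<dots> = (\<Sum>m<n. ((\<i> * t) ^ m /\<^sub>R fact m) * complex_of_real (\<integral>x. F x * X x ^ m \<partial>M))"
        by (subst Bochner_Integration.integral_sum) (auto intro!: integrable_mult_right integrable_of_real imom simp del: of_real_mult)
      finally show ?thesis by (simp add: mom)
    qed
    ultimately show ?thesis by (simp add: LIMSEQ_const_iff)
  qed
  define P N where "P x = max 0 (F x)" and "N x = max 0 (- F x)" for x
  have [measurable]: "P \<in> borel_measurable M" "N \<in> borel_measurable M"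
    unfolding P_def[abs_def] N_def[abs_def] by measurable
  have PN: "F x = P x - N x" "P x \<ge> 0" "N x \<ge> 0" "\<bar>P x\<bar> \<le> \<bar>F x\<bar>" "\<bar>N x\<bar> \<le> \<bar>F x\<bar>" for x
    by (auto simp: P_def N_def)
  have iP: "integrable M P" and iN: "integrable M N"
    by (rule Bochner_Integration.integrable_bound[OF iF]; use PN in simp)+
  define c where "c = (\<integral>x. P x \<partial>M)"
  have cN: "c = (\<integral>x. N x \<partial>M)"
    using mom[of 0] iP iN unfolding c_def PN(1) by simp
  show ?thesis
  proof (cases "c = 0")
    case True
    then have "AE x in M. P x = 0" "AE x in M. N x = 0"
      using integral_nonneg_eq_0_iff_AE[OF iP] integral_nonneg_eq_0_iff_AE[OF iN] PN cN c_def by auto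
    then have "AE x in M. F x * indicator A (X x) = 0"
      by eventually_elim (simp add: PN(1))
    then show ?thesis by (rule integral_eq_zero_AE)
  next
    case False
    have "c \<ge> 0" unfolding c_def by (simp add: PN)
    then have c: "c > 0" using False by simp
    \<comment> \<open>\<open>F\<close> has integral 0, so both parts have the same mass \<open>c\<close> and both push-forwards are probability measures.\<close>
    define \<mu> where "\<mu> G = distr (density M (\<lambda>x. ennreal (G x / c))) borel X" for G
    have rd: "real_distribution (\<mu> G)" and int: "\<And>h :: real \<Rightarrow> complex. h \<in> borel_measurable borel \<Longrightarrow> (\<integral>x. h x \<partial>\<mu> G) = (\<integral>x. (G x / c) *\<^sub>R h (X x) \<partial>M)"
      and meas: "measure (\<mu> G) A = (\<integral>x. G x * indicator A (X x) \<partial>M) / c"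
      if [measurable]: "G \<in> borel_measurable M" and G0: "\<And>x. G x \<ge> 0" and iG: "integrable M G" and Gc: "(\<integral>x. G x \<partial>M) = c" for G
    proof -
      have "emeasure (density M (\<lambda>x. ennreal (G x / c))) (space M) = (\<integral>\<^sup>+x. ennreal (G x / c) \<partial>M)"
        by (subst emeasure_density) (auto intro!: nn_integral_cong)
      also have "\<dots> = ennreal (\<integral>x. G x / c \<partial>M)"
        by (rule nn_integral_eq_integral) (use iG G0 c in auto)
      also have "\<dots> = 1" using Gc c by simp
      finally have "prob_space (density M (\<lambda>x. ennreal (G x / c)))"
        by (intro prob_spaceI) simp
      then interpret prob_space "density M (\<lambda>x. ennreal (G x / c))" .
      show "real_distribution (\<mu> G)" unfolding \<mu>_def by (intro real_distribution_distr) simp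
      show int: "(\<integral>x. h x \<partial>\<mu> G) = (\<integral>x. (G x / c) *\<^sub>R h (X x) \<partial>M)" if [measurable]: "h \<in> borel_measurable borel" for h :: "real \<Rightarrow> complex"
        unfolding \<mu>_def by (subst integral_distr, simp, simp, subst integral_density) (use G0 c in auto)
      have "measure (\<mu> G) A = (\<integral>x. indicator A x \<partial>\<mu> G)" by (simp add: \<mu>_def)
      also have "\<dots> = (\<integral>x. (G x / c) * indicator A (X x) \<partial>M)"
        unfolding \<mu>_def by (subst integral_distr, simp, simp, subst integral_density) (use G0 c in auto)
      finally show "measure (\<mu> G) A = (\<integral>x. G x * indicator A (X x) \<partial>M) / c" by simp
    qed
    have int': "integrable M (\<lambda>x. complex_of_real (G x) * iexp (t * X x))" if "integrable M G" for G t
    proof (rule Bochner_Integration.integrable_bound[OF that])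
      show "(\<lambda>x. complex_of_real (G x) * iexp (t * X x)) \<in> borel_measurable M" using that by measurable
    qed (simp add: norm_mult)
    have "char (\<mu> P) = char (\<mu> N)"
    proof
      fix t
      have e: "char (\<mu> G) t = (\<integral>x. complex_of_real (G x) * iexp (t * X x) \<partial>M) / c"
        if "G \<in> borel_measurable M" "\<And>x. G x \<ge> 0" "integrable M G" "(\<integral>x. G x \<partial>M) = c" for G
        unfolding char_def by (subst int[OF that]) (simp_all add: scaleR_conv_of_real flip: integral_divide_zero)
      have "(\<integral>x. complex_of_real (P x) * iexp (t * X x) \<partial>M) - (\<integral>x. complex_of_real (N x) * iexp (t * X x) \<partial>M) = 0"
        using four[of t] unfolding PN(1) of_real_diff left_diff_distrib
        by (subst (asm) Bochner_Integration.integral_diff) (use int' iP iN in auto)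
      then show "char (\<mu> P) t = char (\<mu> N) t"
        using e[of P] e[of N] iP iN PN cN c_def by simp
    qed
    then have "\<mu> P = \<mu> N"
      using rd[of P] rd[of N] iP iN PN cN c_def by (intro Levy_uniqueness) auto
    then have "(\<integral>x. P x * indicator A (X x) \<partial>M) = (\<integral>x. N x * indicator A (X x) \<partial>M)"
      using meas[of P] meas[of N] iP iN PN cN c_def c by simp
    moreover have "integrable M (\<lambda>x. G x * indicator A (X x))" if "integrable M G" for G :: "'a \<Rightarrow> real"
      by (rule Bochner_Integration.integrable_bound[OF that]) (use that in \<open>auto simp: indicator_def\<close>)
    ultimately show ?thesis unfolding PN(1) using iP iN by (simp add: left_diff_distrib)
  qed
qed

text \<open>The Hermite polynomials span all polynomials, as \<open>He n\<close> is monic of degree \<open>n\<close>.\<close>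

lemma poly_He_induct:
  assumes "\<And>c n. P (smult c (He n))" "\<And>p q. P p \<Longrightarrow> P q \<Longrightarrow> P (p + q)"
  shows "P p"
proof (induction "degree p" arbitrary: p rule: less_induct)
  case less
  let ?r = "p - smult (lead_coeff p) (He (degree p))"
  show ?case
  proof (cases "degree p = 0")
    case True
    then obtain a where "p = [:a:]" using degree_eq_zeroE by auto
    then show ?thesis using assms(1)[of a 0] by (simp add: one_pCons)
  next
    case False
    have "coeff ?r (degree p) = 0" by (simp add: lead_coeff_He)
    moreover have "degree ?r \<le> degree p" by (rule degree_diff_le) (auto intro: degree_smult_le[THEN order_trans])
    ultimately have "degree ?r < degree p" using False
      by (metis degree_0 le_neq_implies_less leading_coeff_neq_0 neq0_conv)
    then have "P ?r" by (rule less)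
    from assms(2)[OF this assms(1)[of "lead_coeff p" "degree p"]] show ?thesis by simp
  qed
qed

text \<open>Coordinate by coordinate, the Hermite factors of the test function are replaced by indicators: in
  the coordinate \<open>j\<close> the weighted function has vanishing moments, hence vanishing integrals over Borel
  sets of \<open>x $ j\<close>. In the end \<open>f\<close> integrates to zero over all boxes.\<close>

theorem hermite_complete:
  fixes f :: "real ^ 'n \<Rightarrow> real"
  assumes f: "f \<in> L2 gauss" and 0: "\<And>\<alpha>. coef f \<alpha> = 0"
  shows "AE x in gauss. f x = 0"
proof -
  have [measurable]: "f \<in> borel_measurable borel" using L2_measurable[OF f] by simp
  have ebi: "exp_bounded (indicator A)" if "A \<in> sets borel" for A
    by (rule exp_bounded_bounded[of _ 1]) (use that in \<open>auto simp: indicator_def\<close>)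
  have ebf: "exp_bounded ((w(j := v)) i)" if "\<And>i. exp_bounded (w i)" "exp_bounded v" for w v and i j :: 'n
    using that by auto
  have step: "(\<integral>x. f x * (\<Prod>i\<in>UNIV. (if i \<in> J then indicator (A i) else he (\<alpha> i)) (x $ i)) \<partial>gauss) = 0"
    if "finite J" "\<And>i. A i \<in> sets borel" for J :: "'n set" and A \<alpha>
    using that(1)
  proof (induction J arbitrary: \<alpha>)
    case empty
    then show ?case using 0[of \<alpha>] by (simp add: coef_def hermite_def)
  next
    case (insert j J)
    define w where "w i = (if i \<in> J then indicator (A i) else he (\<alpha> i))" for i
    have w: "exp_bounded (w i)" for i using ebi that(2) exp_bounded_he by (auto simp: w_def)
    define F where "F x = f x * (\<Prod>i\<in>UNIV - {j}. w i (x $ i))" for x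
    have Fw: "F x * v (x $ j) = f x * (\<Prod>i\<in>UNIV. (w(j := v)) i (x $ i))" for x and v :: "real \<Rightarrow> real"
      unfolding F_def by (subst (2) prod.remove[of _ j]) auto
    have int: "integrable gauss (\<lambda>x. F x * v (x $ j))" if "exp_bounded v" for v
      unfolding Fw by (intro L2_integrable_mult f prod_exp_bounded_L2 ebf w that)
    have [measurable]: "w i \<in> borel_measurable borel" for i using w by (rule exp_boundedD)
    have [measurable]: "F \<in> borel_measurable borel" unfolding F_def[abs_def] by measurable
    have he0: "(\<integral>x. F x * he m (x $ j) \<partial>gauss) = 0" for m
    proof -
      have "(\<lambda>i. if i \<in> J then indicator (A i) else he ((\<alpha>(j := m)) i)) = w(j := he m)"
        using insert.hyps by (auto simp: w_def fun_eq_iff)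
      then show ?thesis unfolding Fw using insert.IH[of "\<alpha>(j := m)"] by (simp add: fun_eq_iff)
    qed
    have p0: "(\<integral>x. F x * poly p (x $ j) \<partial>gauss) = 0" for p
    proof (induction p rule: poly_He_induct)
      case (1 c n)
      have "(\<integral>x. F x * poly (smult c (He n)) (x $ j) \<partial>gauss) = (\<integral>x. (c * sqrt (fact n)) * (F x * he n (x $ j)) \<partial>gauss)"
        by (simp add: he_def mult_ac)
      then show ?case by (simp only: integral_mult_right_zero he0)
    next
      case (2 p q)
      then show ?case by (simp add: distrib_left int exp_bounded_poly)
    qed
    have "(\<integral>x. F x * indicator (A j) (x $ j) \<partial>gauss) = 0"
    proof (rule exponential_moments_determine)
      show "integrable gauss (\<lambda>x. F x * exp (a * \<bar>x $ j\<bar>))" for a by (rule int[OF exp_bounded_exp])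
      show "(\<integral>x. F x * (x $ j) ^ m \<partial>gauss) = 0" for m
        using p0[of "monom 1 m"] by (simp add: poly_monom)
    qed (use that(2) in measurable)
    moreover have "(\<lambda>i. if i \<in> insert j J then indicator (A i) else he (\<alpha> i)) = w(j := indicator (A j))"
      by (auto simp: w_def fun_eq_iff)
    ultimately show ?case unfolding Fw by (simp add: fun_eq_iff)
  qed
  have "AE x in lborel. gauss_density x * f x = 0"
  proof (rule integrable_box_zero_imp_AE_zero)
    show "integrable lborel (\<lambda>x. gauss_density x * f x)"
      using gauss.L2_integrable[OF f] by (subst (asm) integrable_gauss_iff) auto
    fix a b :: "real ^ 'n"
    have "indicator (box a b) x = (\<Prod>i\<in>UNIV. indicator {a $ i <..< b $ i} (x $ i) :: real)" for x
      by (auto simp: indicator_def mem_box_cart)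
    then have "(\<integral>x. f x * indicator (box a b) x \<partial>gauss) = 0"
      using step[of UNIV "\<lambda>i. {a $ i <..< b $ i}"] by simp
    then show "(\<integral>x. gauss_density x * f x * indicator (box a b) x \<partial>lborel) = 0"
      by (subst (asm) integral_gauss) (auto simp: mult_ac)
  qed
  then show ?thesis unfolding AE_gauss_iff
    by eventually_elim (simp add: less_imp_neq[OF gauss_density_pos, symmetric])
qed

section \<open>Parseval's identity\<close>

text \<open>The Riesz-Fischer argument: consecutive differences are summable in \<open>L\<^sup>1\<close>, so the sequence
  converges almost everywhere, and Fatou's lemma turns the Cauchy bound into a bound for the limit.\<close>

lemma (in prob_space) L2_fast_Cauchy_limit:
  fixes S :: "nat \<Rightarrow> 'a \<Rightarrow> real"
  assumes S: "\<And>j. S j \<in> L2 M"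
    and C: "\<And>i j. j \<le> i \<Longrightarrow> (\<integral>x. (S j x - S i x)\<^sup>2 \<partial>M) \<le> (1 / 4) ^ j"
  obtains g where "g \<in> L2 M" "\<And>j. (\<integral>x. (S j x - g x)\<^sup>2 \<partial>M) \<le> (1 / 4) ^ j"
proof -
  have [measurable]: "S j \<in> borel_measurable M" for j using S by (rule L2_measurable)
  define d where "d j x = \<bar>S (Suc j) x - S j x\<bar>" for j x
  have d_L2: "d j \<in> L2 M" for j unfolding d_def by (intro L2_abs L2_diff S)
  have [measurable]: "d j \<in> borel_measurable M" for j using d_L2 by (rule L2_measurable)
  have id: "(\<integral>x. d j x \<partial>M) \<le> (1 / 2) ^ j" for j
  proof (rule power2_le_imp_le)
    have "(\<integral>x. d j x * 1 \<partial>M)\<^sup>2 \<le> (\<integral>x. (d j x)\<^sup>2 \<partial>M) * (\<integral>x. 1\<^sup>2 \<partial>M)"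
      by (rule L2_cauchy_schwarz[OF d_L2]) (simp add: L2_def)
    also have "(\<integral>x. (d j x)\<^sup>2 \<partial>M) = (\<integral>x. (S j x - S (Suc j) x)\<^sup>2 \<partial>M)"
      by (simp add: d_def power2_commute)
    also have "(\<integral>x. (S j x - S (Suc j) x)\<^sup>2 \<partial>M) * (\<integral>x. 1\<^sup>2 \<partial>M) \<le> (1 / 4) ^ j"
      using C[of j "Suc j"] by (simp add: prob_space)
    also have "(1 / 4) ^ j = (((1::real) / 2) ^ j)\<^sup>2"
      by (simp add: power2_eq_square power_mult_distrib[symmetric])
    finally show "(\<integral>x. d j x \<partial>M)\<^sup>2 \<le> ((1 / 2) ^ j)\<^sup>2" by simp
  qed simp
  have "(\<integral>\<^sup>+x. (\<Sum>j. ennreal (d j x)) \<partial>M) = (\<Sum>j. \<integral>\<^sup>+x. ennreal (d j x) \<partial>M)"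
    by (rule nn_integral_suminf) simp
  also have "\<dots> \<le> (\<Sum>j. ennreal ((1 / 2) ^ j))"
  proof (rule suminf_le)
    fix j
    have "(\<integral>\<^sup>+x. ennreal (d j x) \<partial>M) = ennreal (\<integral>x. d j x \<partial>M)"
      by (rule nn_integral_eq_integral[OF L2_integrable[OF d_L2]]) (simp add: d_def)
    then show "(\<integral>\<^sup>+x. ennreal (d j x) \<partial>M) \<le> ennreal ((1 / 2) ^ j)"
      using id[of j] by (simp add: ennreal_leI)
  qed auto
  also have "\<dots> = ennreal (\<Sum>j. (1 / 2) ^ j)"
    by (rule suminf_ennreal2) (auto intro: summable_geometric)
  also have "\<dots> < \<infinity>" by simp
  finally have "AE x in M. (\<Sum>j. ennreal (d j x)) \<noteq> \<infinity>"
    by (intro nn_integral_noteq_infinite) auto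
  then have conv: "AE x in M. convergent (\<lambda>j. S j x)"
  proof eventually_elim
    case (elim x)
    have "summable (\<lambda>j. d j x)"
      using elim by (intro summable_suminf_not_top) (auto simp: d_def)
    then have "summable (\<lambda>j. S (Suc j) x - S j x)"
      unfolding d_def by (rule summable_rabs_cancel)
    then obtain l where "(\<lambda>n. \<Sum>j<n. S (Suc j) x - S j x) \<longlonglongrightarrow> l"
      by (auto simp: summable_def sums_def)
    then have "(\<lambda>n. S n x - S 0 x + S 0 x) \<longlonglongrightarrow> l + S 0 x"
      by (intro tendsto_intros) (simp add: sum_lessThan_telescope[of "\<lambda>j. S j x"])
    then show ?case by (auto simp: convergent_def)
  qed
  define g where "g x = lim (\<lambda>j. S j x)" for x
  have [measurable]: "g \<in> borel_measurable M" unfolding g_def[abs_def] by (rule borel_measurable_lim_metric) simp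
  have Fatou: "(\<integral>\<^sup>+x. ennreal ((S j x - g x)\<^sup>2) \<partial>M) \<le> ennreal ((1 / 4) ^ j)" for j
  proof -
    \<comment> \<open>Fatou with \<open>j\<close> fixed and the other index going to infinity.\<close>
    have "(\<integral>\<^sup>+x. ennreal ((S j x - g x)\<^sup>2) \<partial>M) = (\<integral>\<^sup>+x. liminf (\<lambda>i. ennreal ((S j x - S i x)\<^sup>2)) \<partial>M)"
    proof (rule nn_integral_cong_AE, use conv in eventually_elim)
      case (elim x)
      then have "(\<lambda>i. S i x) \<longlonglongrightarrow> g x" unfolding g_def by (simp add: convergent_LIMSEQ_iff)
      then have "(\<lambda>i. ennreal ((S j x - S i x)\<^sup>2)) \<longlonglongrightarrow> ennreal ((S j x - g x)\<^sup>2)"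
        by (intro tendsto_intros)
      from lim_imp_Liminf[OF sequentially_bot this] show ?case by simp
    qed
    also have "\<dots> \<le> liminf (\<lambda>i. \<integral>\<^sup>+x. ennreal ((S j x - S i x)\<^sup>2) \<partial>M)"
      by (rule nn_integral_liminf) simp
    also have "\<dots> \<le> liminf (\<lambda>i. ennreal ((1 / 4) ^ j))"
    proof (rule Liminf_mono)
      show "eventually (\<lambda>i. (\<integral>\<^sup>+x. ennreal ((S j x - S i x)\<^sup>2) \<partial>M) \<le> ennreal ((1 / 4) ^ j)) sequentially"
        using eventually_ge_at_top[of j]
      proof eventually_elim
        case (elim i)
        have "(\<integral>\<^sup>+x. ennreal ((S j x - S i x)\<^sup>2) \<partial>M) = ennreal (\<integral>x. (S j x - S i x)\<^sup>2 \<partial>M)"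
          by (rule nn_integral_eq_integral[OF L2_integrable_sq[OF L2_diff[OF S S]]]) simp
        then show ?case using C[OF elim] by (simp add: ennreal_leI)
      qed
    qed
    finally show ?thesis by (simp add: Liminf_const)
  qed
  have int: "integrable M (\<lambda>x. (S j x - g x)\<^sup>2)" for j
    by (rule integrableI_bounded) (use Fatou[of j] in \<open>auto simp: le_less_trans\<close>)
  have "(\<lambda>x. S 0 x - (S 0 x - g x)) \<in> L2 M"
    by (intro L2_diff S L2I int) simp
  then have "g \<in> L2 M" by simp
  moreover have "(\<integral>x. (S j x - g x)\<^sup>2 \<partial>M) \<le> (1 / 4) ^ j" for j
    using Fatou[of j] nn_integral_eq_integral[OF int[of j]] by simp
  ultimately show ?thesis by (rule that)
qed

lemma finite_multi_order_le: "finite {\<alpha> :: 'n::finite \<Rightarrow> nat. multi_order \<alpha> \<le> N}"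
proof (rule finite_subset)
  show "{\<alpha> :: 'n \<Rightarrow> nat. multi_order \<alpha> \<le> N} \<subseteq> (\<Pi>\<^sub>E i\<in>UNIV. {..N})"
  proof (clarsimp simp: PiE_iff)
    fix \<alpha> :: "'n \<Rightarrow> nat" and i assume "multi_order \<alpha> \<le> N"
    then show "\<alpha> i \<le> N" using member_le_sum[of i UNIV \<alpha>] by simp
  qed
qed (auto intro: finite_PiE)

lemma finite_multi_order_less: "finite {\<alpha> :: 'n::finite \<Rightarrow> nat. multi_order \<alpha> < N}"
  by (rule finite_subset[OF _ finite_multi_order_le[of N]]) auto

lemma finite_multi_order_eq: "finite {\<alpha> :: 'n::finite \<Rightarrow> nat. multi_order \<alpha> = N}"
  by (rule finite_subset[OF _ finite_multi_order_le[of N]]) auto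

text \<open>A rapidly converging subsequence of the Hermite partial sums has a limit in \<open>L\<^sup>2\<close>. The limit has the
  same coefficients as \<open>f\<close>, so it is \<open>f\<close> by completeness.\<close>

theorem parseval:
  fixes f :: "real ^ 'n \<Rightarrow> real"
  assumes f: "f \<in> L2 gauss"
  shows "(\<lambda>N. \<Sum>\<alpha> | multi_order \<alpha> \<le> N. (coef f \<alpha>)\<^sup>2) \<longlonglongrightarrow> (\<integral>x. (f x)\<^sup>2 \<partial>gauss)"
proof -
  define I where "I N = {\<alpha> :: 'n \<Rightarrow> nat. multi_order \<alpha> \<le> N}" for N
  define \<sigma> where "\<sigma> N = (\<Sum>\<alpha>\<in>I N. (coef f \<alpha>)\<^sup>2)" for N
  have fin: "finite (I N)" for N unfolding I_def by (rule finite_multi_order_le)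
  have mono: "incseq \<sigma>"
    unfolding \<sigma>_def incseq_def by (auto intro!: sum_mono2 fin) (simp add: I_def)
  obtain L where L: "\<sigma> \<longlonglongrightarrow> L" "\<And>i. \<sigma> i \<le> L"
    using incseq_convergent[OF mono, of "\<integral>x. (f x)\<^sup>2 \<partial>gauss"] bessel[OF f fin] unfolding \<sigma>_def by blast
  have "\<forall>j. \<exists>n. \<forall>i\<ge>n. L - \<sigma> i \<le> (1 / 4) ^ j"
  proof
    fix j
    show "\<exists>n. \<forall>i\<ge>n. L - \<sigma> i \<le> (1 / 4) ^ j"
      using LIMSEQ_D[OF L(1), of "(1/4)^j"] by (auto simp: abs_le_iff abs_less_iff) (smt (verit) real_norm_def)
  qed
  then obtain n where n: "\<And>j i. n j \<le> i \<Longrightarrow> L - \<sigma> i \<le> (1 / 4) ^ j" by metis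
  \<comment> \<open>Adding up the thresholds makes the subsequence monotone; the summand \<open>j\<close> makes it unbounded.\<close>
  define m where "m j = j + (\<Sum>i\<le>j. n i)" for j
  have m: "n j \<le> m j" "j \<le> m j" for j
    unfolding m_def by (auto intro: member_le_sum trans_le_add2)
  have m_mono: "j \<le> i \<Longrightarrow> m j \<le> m i" for i j unfolding m_def by (intro add_mono sum_mono2) auto
  define S where "S j = hermite_sum (I (m j)) f" for j
  have cauchy: "(\<integral>x. (S j x - S i x)\<^sup>2 \<partial>gauss) \<le> (1 / 4) ^ j" if "j \<le> i" for i j
  proof -
    have sub: "I (m j) \<subseteq> I (m i)" using m_mono[OF that] by (auto simp: I_def)
    have Sj: "S j = hermite_sum (I (m j)) (S i)"
      unfolding S_def hermite_sum_def[of "I (m j)"] using sub fin by (auto simp: fun_eq_iff coef_hermite_sum intro!: sum.cong)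
    have Si: "S i \<in> L2 gauss" by (simp add: S_def hermite_sum_L2)
    have "(\<integral>x. (S j x - S i x)\<^sup>2 \<partial>gauss) = (\<integral>x. (S i x - hermite_sum (I (m j)) (S i) x)\<^sup>2 \<partial>gauss)"
      by (subst Sj) (simp add: power2_commute)
    also have "\<dots> = (\<integral>x. (S i x)\<^sup>2 \<partial>gauss) - (\<Sum>\<alpha>\<in>I (m j). (coef (S i) \<alpha>)\<^sup>2)"
      by (rule dist_hermite_sum[OF Si fin])
    also have "(\<integral>x. (S i x)\<^sup>2 \<partial>gauss) = \<sigma> (m i)"
      using inner_hermite_sum[of "S i" "I (m i)" f] fin unfolding S_def
      by (simp add: hermite_sum_L2 power2_eq_square coef_hermite_sum \<sigma>_def)
    also have "(\<Sum>\<alpha>\<in>I (m j). (coef (S i) \<alpha>)\<^sup>2) = \<sigma> (m j)"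
      unfolding S_def \<sigma>_def using sub fin by (auto intro!: sum.cong simp: coef_hermite_sum)
    finally show ?thesis using L(2)[of "m i"] n[OF m(1)[of j]] by simp
  qed
  have S: "S j \<in> L2 gauss" for j by (simp add: S_def hermite_sum_L2)
  obtain g where g: "g \<in> L2 gauss" "\<And>j. (\<integral>x. (S j x - g x)\<^sup>2 \<partial>gauss) \<le> (1 / 4) ^ j"
    using gauss.L2_fast_Cauchy_limit[OF S cauchy] by blast
  have "coef (\<lambda>x. f x - g x) \<alpha> = 0" for \<alpha>
  proof -
    have "(coef (\<lambda>x. S j x - g x) \<alpha>)\<^sup>2 \<le> (1 / 4) ^ j" for j
      using L2_cauchy_schwarz[OF L2_diff[OF S[of j] g(1)] hermite_L2[of \<alpha>]] g(2)[of j]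
      by (simp add: coef_def hermite_orthonormal power2_eq_square[of "hermite _ _"])
    moreover have "coef (\<lambda>x. S j x - g x) \<alpha> = coef (\<lambda>x. f x - g x) \<alpha>" if "j \<ge> multi_order \<alpha>" for j
    proof -
      have "\<alpha> \<in> I (m j)" using that m(2)[of j] by (simp add: I_def)
      then show ?thesis using f g S fin by (simp add: coef_diff S_def coef_hermite_sum hermite_sum_L2)
    qed
    ultimately have "\<forall>j\<ge>multi_order \<alpha>. (coef (\<lambda>x. f x - g x) \<alpha>)\<^sup>2 \<le> (1 / 4) ^ j" by metis
    then have "(coef (\<lambda>x. f x - g x) \<alpha>)\<^sup>2 \<le> 0"
      by (intro LIMSEQ_le_const[OF LIMSEQ_realpow_zero[of "1/4"]]) auto
    then show ?thesis by simp
  qed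
  then have "AE x in gauss. f x - g x = 0"
    by (intro hermite_complete L2_diff f g(1))
  then have fg: "(\<integral>x. (f x - S j x)\<^sup>2 \<partial>gauss) = (\<integral>x. (S j x - g x)\<^sup>2 \<partial>gauss)" for j
    using L2_measurable[OF f] L2_measurable[OF g(1)] L2_measurable[OF S[of j]]
    by (intro integral_cong_AE) (auto simp: power2_commute)
  have "(\<integral>x. (f x)\<^sup>2 \<partial>gauss) - L \<le> (1 / 4) ^ j" for j
    using fg[of j] g(2)[of j] dist_hermite_sum[OF f fin, of "m j"] L(2)[of "m j"]
    unfolding S_def \<sigma>_def by linarith
  then have "(\<integral>x. (f x)\<^sup>2 \<partial>gauss) - L \<le> 0"
    by (intro LIMSEQ_le_const[OF LIMSEQ_realpow_zero[of "1/4"]]) auto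
  moreover have "L \<le> (\<integral>x. (f x)\<^sup>2 \<partial>gauss)"
    by (rule LIMSEQ_le_const2[OF L(1)]) (use bessel[OF f fin] in \<open>auto simp: \<sigma>_def\<close>)
  ultimately have "L = (\<integral>x. (f x)\<^sup>2 \<partial>gauss)" by simp
  then show ?thesis using L(1) unfolding \<sigma>_def I_def by simp
qed

lemma parseval_inner:
  fixes f g :: "real ^ 'n \<Rightarrow> real"
  assumes f: "f \<in> L2 gauss" and g: "g \<in> L2 gauss"
  shows "(\<lambda>N. \<Sum>\<alpha> | multi_order \<alpha> \<le> N. coef f \<alpha> * coef g \<alpha>) \<longlonglongrightarrow> (\<integral>x. f x * g x \<partial>gauss)"
proof -
  have "(\<lambda>N. ((\<Sum>\<alpha> | multi_order \<alpha> \<le> N. (coef (\<lambda>x. f x + g x) \<alpha>)\<^sup>2) - (\<Sum>\<alpha> | multi_order \<alpha> \<le> N. (coef (\<lambda>x. f x - g x) \<alpha>)\<^sup>2)) / 4)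
     \<longlonglongrightarrow> ((\<integral>x. (f x + g x)\<^sup>2 \<partial>gauss) - (\<integral>x. (f x - g x)\<^sup>2 \<partial>gauss)) / 4"
    by (intro tendsto_intros parseval L2_add L2_diff f g) simp
  moreover have "((\<Sum>\<alpha> | multi_order \<alpha> \<le> N. (coef (\<lambda>x. f x + g x) \<alpha>)\<^sup>2) - (\<Sum>\<alpha> | multi_order \<alpha> \<le> N. (coef (\<lambda>x. f x - g x) \<alpha>)\<^sup>2)) / 4
     = (\<Sum>\<alpha> | multi_order \<alpha> \<le> N. coef f \<alpha> * coef g \<alpha>)" for N
  proof -
    have "coef (\<lambda>x. f x + g x) \<alpha> = coef f \<alpha> + coef g \<alpha>" for \<alpha>
      unfolding coef_def using f g by (simp add: distrib_right L2_integrable_mult hermite_L2)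
    then show ?thesis using f g
      by (simp add: coef_diff sum_subtractf[symmetric] sum_divide_distrib power2_sum power2_diff algebra_simps)
  qed
  moreover have "((\<integral>x. (f x + g x)\<^sup>2 \<partial>gauss) - (\<integral>x. (f x - g x)\<^sup>2 \<partial>gauss)) / 4 = (\<integral>x. f x * g x \<partial>gauss)"
  proof -
    have "(\<integral>x. (f x + g x)\<^sup>2 \<partial>gauss) - (\<integral>x. (f x - g x)\<^sup>2 \<partial>gauss) = (\<integral>x. (f x + g x)\<^sup>2 - (f x - g x)\<^sup>2 \<partial>gauss)"
      by (rule Bochner_Integration.integral_diff[symmetric]) (intro L2_integrable_sq L2_add L2_diff f g)+
    also have "\<dots> = (\<integral>x. 4 * (f x * g x) \<partial>gauss)"
      by (simp add: power2_sum power2_diff algebra_simps)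
    finally show ?thesis by simp
  qed
  ultimately show ?thesis by simp
qed

section \<open>Smooth functions of product form and test functions\<close>

text \<open>\<open>D m\<close> is the derivative of order \<open>m\<close> of the smooth function \<open>D 0\<close>. Carrying the whole sequence
  avoids iterated choices of derivatives.\<close>

definition derivs :: "(nat \<Rightarrow> real \<Rightarrow> real) \<Rightarrow> bool" where
  "derivs D \<longleftrightarrow> (\<forall>m x. (D m has_real_derivative D (Suc m) x) (at x))"

lemma derivsD: "derivs D \<Longrightarrow> (D m has_real_derivative D (Suc m) x) (at x)"
  by (simp add: derivs_def)

lemma derivs_continuous: "derivs D \<Longrightarrow> continuous_on A (D m)"
  by (meson derivsD DERIV_isCont continuous_at_imp_continuous_on)

lemma derivs_poly: "derivs (\<lambda>m. poly ((pderiv ^^ m) p))"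
  by (simp add: derivs_def poly_DERIV)

lemma derivs_affine:
  assumes "derivs D" shows "derivs (\<lambda>m x. c ^ m * D m (c * x + d))"
  unfolding derivs_def
proof (intro allI)
  fix m x
  have "((\<lambda>x. c * x + d) has_real_derivative c) (at x)"
    by (auto intro!: derivative_eq_intros)
  from DERIV_cmult[OF DERIV_chain2[OF derivsD[OF assms] this], of "c ^ m" m]
  show "((\<lambda>x. c ^ m * D m (c * x + d)) has_real_derivative c ^ Suc m * D (Suc m) (c * x + d)) (at x)"
    by (simp add: mult_ac)
qed

text \<open>The derivatives of the product \<open>D 0 * E 0\<close>.\<close>

definition leibniz :: "(nat \<Rightarrow> real \<Rightarrow> real) \<Rightarrow> (nat \<Rightarrow> real \<Rightarrow> real) \<Rightarrow> nat \<Rightarrow> real \<Rightarrow> real" where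
  "leibniz D E m x = (\<Sum>j\<le>m. real (m choose j) * D (m - j) x * E j x)"

lemma leibniz_0 [simp]: "leibniz D E 0 x = D 0 x * E 0 x"
  by (simp add: leibniz_def)

lemma leibniz_Suc: "leibniz D E (Suc m) x = leibniz (\<lambda>k. D (Suc k)) E m x + leibniz D (\<lambda>k. E (Suc k)) m x"
proof -
  have "leibniz D E (Suc m) x = D (Suc m) x * E 0 x + (\<Sum>j\<le>m. real (Suc m choose Suc j) * D (m - j) x * E (Suc j) x)"
    unfolding leibniz_def by (subst sum.atMost_Suc_shift) simp
  also have "\<dots> = (D (Suc m) x * E 0 x + (\<Sum>j\<le>m. real (m choose Suc j) * D (m - j) x * E (Suc j) x)) + leibniz D (\<lambda>k. E (Suc k)) m x"
    by (simp add: leibniz_def sum.distrib[symmetric] algebra_simps)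
  also have "D (Suc m) x * E 0 x + (\<Sum>j\<le>m. real (m choose Suc j) * D (m - j) x * E (Suc j) x)
     = (\<Sum>j\<le>Suc m. real (m choose j) * D (Suc m - j) x * E j x)"
    by (subst sum.atMost_Suc_shift) simp
  also have "\<dots> = leibniz (\<lambda>k. D (Suc k)) E m x"
    unfolding leibniz_def sum.atMost_Suc by (auto simp: Suc_diff_le intro!: sum.cong)
  finally show ?thesis .
qed

lemma derivs_leibniz:
  assumes D: "derivs D" and E: "derivs E" shows "derivs (leibniz D E)"
  unfolding derivs_def
proof (intro allI)
  fix m x
  have "((\<lambda>x. \<Sum>j\<le>m. real (m choose j) * D (m - j) x * E j x) has_real_derivative
      (\<Sum>j\<le>m. real (m choose j) * D (Suc (m - j)) x * E j x + real (m choose j) * D (m - j) x * E (Suc j) x)) (at x)"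
    by (auto intro!: derivative_eq_intros derivsD[OF D] derivsD[OF E] sum.cong simp: algebra_simps)
  then show "(leibniz D E m has_real_derivative leibniz D E (Suc m) x) (at x)"
    unfolding leibniz_Suc unfolding leibniz_def[abs_def] sum.distrib .
qed

primrec bump_poly :: "nat \<Rightarrow> real poly" where
  "bump_poly 0 = 1"
| "bump_poly (Suc m) = [:0, 0, 1:] * (bump_poly m - pderiv (bump_poly m))"

text \<open>The derivatives of the function that is \<open>exp (- 1 / x)\<close> for \<open>x > 0\<close> and vanishes otherwise.\<close>

definition flat :: "nat \<Rightarrow> real \<Rightarrow> real" where
  "flat m x = (if x > 0 then poly (bump_poly m) (1 / x) * exp (- (1 / x)) else 0)"

lemma poly_exp_at_0: "((\<lambda>x. poly p (1 / x) * exp (- (1 / x))) \<longlongrightarrow> 0) (at_right (0::real))"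
proof -
  have "((\<lambda>y. poly p y * exp (- y)) \<longlongrightarrow> 0) (at_top :: real filter)"
  proof -
    have "((\<lambda>y. \<Sum>i\<le>degree p. coeff p i * (y ^ i / exp y)) \<longlongrightarrow> (\<Sum>i\<le>degree p. coeff p i * 0)) (at_top :: real filter)"
      by (intro tendsto_intros tendsto_power_div_exp_0)
    then show ?thesis
      by (simp add: poly_altdef sum_distrib_right exp_minus divide_inverse mult.assoc)
  qed
  from filterlim_compose[OF this filterlim_inverse_at_top_right] show ?thesis
    by (simp add: inverse_eq_divide)
qed

text \<open>Away from the origin this is calculus; at the origin every difference quotient from the right is a
  polynomial in \<open>1 / x\<close> times \<open>exp (- 1 / x)\<close>, which tends to 0.\<close>

lemma derivs_flat: "derivs flat"
  unfolding derivs_def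
proof (intro allI)
  fix m and x :: real
  consider "x > 0" | "x < 0" | "x = 0" by linarith
  then show "(flat m has_real_derivative flat (Suc m) x) (at x)"
  proof cases
    case 1
    have "((\<lambda>x. poly (bump_poly m) (1 / x) * exp (- (1 / x))) has_real_derivative flat (Suc m) x) (at x)"
      using 1 by (auto intro!: derivative_eq_intros DERIV_chain2[OF poly_DERIV] simp: flat_def field_simps power2_eq_square)
    then show ?thesis
      by (rule has_field_derivative_transform_within_open[of _ _ _ "{0<..}"]) (use 1 in \<open>auto simp: flat_def\<close>)
  next
    case 2
    have "((\<lambda>x. 0) has_real_derivative flat (Suc m) x) (at x)"
      using 2 by (auto simp: flat_def)
    then show ?thesis
      by (rule has_field_derivative_transform_within_open[of _ _ _ "{..<0}"]) (use 2 in \<open>auto simp: flat_def\<close>)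
  next
    case 3
    have r: "((\<lambda>h. (flat m (0 + h) - flat m 0) / h) \<longlongrightarrow> 0) (at_right 0)"
    proof (rule Lim_transform_eventually[OF poly_exp_at_0[of "[:0,1:] * bump_poly m"]])
      show "\<forall>\<^sub>F h in at_right 0. poly ([:0,1:] * bump_poly m) (1 / h) * exp (- (1 / h)) = (flat m (0 + h) - flat m 0) / h"
        by (auto simp: eventually_at_right_less flat_def intro!: eventually_mono[OF eventually_at_right_less[of 0]])
    qed
    have l: "((\<lambda>h. (flat m (0 + h) - flat m 0) / h) \<longlongrightarrow> 0) (at_left 0)"
      by (rule Lim_transform_eventually[OF tendsto_const])
         (auto simp: flat_def eventually_at_left_field intro!: exI[of _ "-1"])
    have "((\<lambda>h. (flat m (0 + h) - flat m 0) / h) \<longlongrightarrow> 0) (at 0)"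
      using l r by (simp add: filterlim_split_at)
    then show ?thesis using 3 by (simp add: DERIV_def flat_def)
  qed
qed

lemma flat_0: "flat 0 x = (if x > 0 then exp (- (1 / x)) else 0)"
  by (simp add: flat_def)

lemma flat_neg: "x \<le> 0 \<Longrightarrow> flat m x = 0"
  by (simp add: flat_def)

text \<open>The derivatives of \<open>exp (- 1 / (c * (x - a))) * exp (- 1 / (c * (b - x)))\<close> on \<open>(a, b)\<close>. As \<open>c\<close> grows
  this tends to the indicator function of \<open>(a, b)\<close>.\<close>

definition bump :: "real \<Rightarrow> real \<Rightarrow> real \<Rightarrow> nat \<Rightarrow> real \<Rightarrow> real" where
  "bump c a b = leibniz (\<lambda>m x. c ^ m * flat m (c * x + (- c * a))) (\<lambda>m x. (- c) ^ m * flat m ((- c) * x + c * b))"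

lemma derivs_bump: "derivs (bump c a b)"
  unfolding bump_def by (intro derivs_leibniz derivs_affine derivs_flat)

lemma bump_outside:
  assumes "c > 0" "x \<notin> {a<..<b}" shows "bump c a b m x = 0"
proof -
  have "c * x + (- c * a) \<le> 0 \<or> (- c) * x + c * b \<le> 0"
    using assms by (auto simp: not_less)
  then show ?thesis unfolding bump_def leibniz_def
    by (elim disjE; intro sum.neutral ballI) (simp_all add: flat_neg)
qed

lemma bump_0_bounds: "0 \<le> bump c a b 0 x" "bump c a b 0 x \<le> 1"
  by (auto simp: bump_def flat_0 intro!: mult_le_one)

lemma bump_0_tendsto: "(\<lambda>n. bump (real (Suc n)) a b 0 x) \<longlonglongrightarrow> indicator {a<..<b} x"
proof (cases "x \<in> {a<..<b}")
  case False
  then show ?thesis by (simp add: bump_outside del: of_nat_Suc)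
next
  case True
  have "(\<lambda>n. exp (- (inverse (real (Suc n)) * (1 / (x - a)))) * exp (- (inverse (real (Suc n)) * (1 / (b - x)))))
     \<longlonglongrightarrow> exp (- (0 * (1 / (x - a)))) * exp (- (0 * (1 / (b - x))))"
    by (intro tendsto_intros LIMSEQ_inverse_real_of_nat)
  moreover have "bump (real (Suc n)) a b 0 x
     = exp (- (inverse (real (Suc n)) * (1 / (x - a)))) * exp (- (inverse (real (Suc n)) * (1 / (b - x))))" for n
  proof -
    have "real (Suc n) * x + (- real (Suc n) * a) = real (Suc n) * (x - a)"
         "(- real (Suc n)) * x + real (Suc n) * b = real (Suc n) * (b - x)" by (simp_all add: algebra_simps)
    then show ?thesis unfolding bump_def leibniz_0 flat_0
      using True by (simp add: divide_inverse inverse_mult_distrib del: of_nat_Suc)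
  qed
  ultimately show ?thesis using True by simp
qed

text \<open>The partial derivative of multi-order \<open>m\<close> of \<open>\<Prod>i. D i 0 (x $ i)\<close>. Test functions, Hermite
  polynomials and Hermite functions are all of this form, and on it iterated partial derivatives
  only change \<open>m\<close>.\<close>

definition prodfun :: "('n::finite \<Rightarrow> nat \<Rightarrow> real \<Rightarrow> real) \<Rightarrow> ('n \<Rightarrow> nat) \<Rightarrow> real ^ 'n \<Rightarrow> real" where
  "prodfun D m x = (\<Prod>i\<in>UNIV. D i (m i) (x $ i))"

lemma prodfun_has_derivative:
  fixes D :: "'n::finite \<Rightarrow> nat \<Rightarrow> real \<Rightarrow> real"
  assumes "\<And>i. derivs (D i)"
  shows "(prodfun D m has_derivative (\<lambda>y. \<Sum>i\<in>UNIV. D i (Suc (m i)) (x $ i) * y $ i * (\<Prod>j\<in>UNIV - {i}. D j (m j) (x $ j)))) (at x)"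
proof -
  have 1: "((\<lambda>x. D i (m i) (x $ i)) has_derivative (\<lambda>y. D i (Suc (m i)) (x $ i) * y $ i)) (at x)" for i
  proof -
    have "(D i (m i) has_derivative (\<lambda>y. D i (Suc (m i)) (x $ i) * y)) (at (x $ i))"
      using derivsD[OF assms] by (simp add: has_field_derivative_def)
    from has_derivative_compose[OF bounded_linear.has_derivative[OF bounded_linear_vec_nth has_derivative_ident] this]
    show ?thesis .
  qed
  show ?thesis unfolding prodfun_def[abs_def]
    by (rule has_derivative_eq_rhs[OF has_derivative_prod[OF 1]]) auto
qed

lemma prodfun_differentiable: "(\<And>i. derivs (D i)) \<Longrightarrow> prodfun D m differentiable (at x)"
  using prodfun_has_derivative[where D=D and m=m and x=x] by (auto simp: differentiable_def)

lemma partial_deriv_prodfun: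
  fixes D :: "'n::finite \<Rightarrow> nat \<Rightarrow> real \<Rightarrow> real"
  assumes "\<And>i. derivs (D i)"
  shows "partial_deriv j (prodfun D m) = prodfun D (m(j := Suc (m j)))"
proof
  fix x
  have "partial_deriv j (prodfun D m) x = (\<Sum>i\<in>UNIV. D i (Suc (m i)) (x $ i) * axis j 1 $ i * (\<Prod>j\<in>UNIV - {i}. D j (m j) (x $ j)))"
    unfolding partial_deriv_def
    by (subst frechet_derivative_at[OF prodfun_has_derivative[OF assms, where m=m and x=x], symmetric]) simp
  also have "\<dots> = (\<Sum>i\<in>UNIV. if i = j then D i (Suc (m i)) (x $ i) * (\<Prod>j\<in>UNIV - {i}. D j (m j) (x $ j)) else 0)"
    by (rule sum.cong) (auto simp: axis_def)
  also have "\<dots> = D j (Suc (m j)) (x $ j) * (\<Prod>i\<in>UNIV - {j}. D i (m i) (x $ i))" by simp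
  also have "\<dots> = prodfun D (m(j := Suc (m j))) x"
    unfolding prodfun_def by (subst (2) prod.remove[of _ j]) auto
  finally show "partial_deriv j (prodfun D m) x = prodfun D (m(j := Suc (m j))) x" .
qed

lemma iter_partial_Cons: "iter_partial (j # js) f = partial_deriv j (iter_partial js f)"
  and iter_partial_Nil: "iter_partial [] f = f"
  by (simp_all add: iter_partial_def)

lemma iter_partial_prodfun:
  assumes "\<And>i. derivs (D i)"
  shows "iter_partial js (prodfun D m) = prodfun D (\<lambda>i. m i + count_list js i)"
proof (induction js)
  case Nil then show ?case by (simp add: iter_partial_Nil)
next
  case (Cons j js)
  have "(\<lambda>i. m i + count_list js i)(j := Suc (m j + count_list js j)) = (\<lambda>i. m i + count_list (j # js) i)"
    by auto
  then show ?case by (simp add: iter_partial_Cons Cons partial_deriv_prodfun[OF assms])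
qed

lemma prodfun_continuous: "(\<And>i. derivs (D i)) \<Longrightarrow> continuous_on A (prodfun D m)"
  by (meson prodfun_differentiable differentiable_imp_continuous_within continuous_at_imp_continuous_on)

lemma prodfun_measurable: "(\<And>i. derivs (D i)) \<Longrightarrow> prodfun D m \<in> borel_measurable borel"
  by (intro borel_measurable_continuous_onI prodfun_continuous)

lemma prodfun_test:
  fixes D :: "'n::finite \<Rightarrow> nat \<Rightarrow> real \<Rightarrow> real"
  assumes D: "\<And>i. derivs (D i)" and supp: "\<And>i x. x \<notin> {a $ i .. b $ i} \<Longrightarrow> D i (m i) x = 0"
  shows "prodfun D m \<in> test_functions"
proof -
  have "{x. prodfun D m x \<noteq> 0} \<subseteq> cbox a b"
    using supp by (force simp: prodfun_def mem_box_cart)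
  then have "bounded {x. prodfun D m x \<noteq> 0}" by (rule bounded_subset[OF bounded_cbox])
  then have "compact (closure {x. prodfun D m x \<noteq> 0})" by simp
  then show ?thesis unfolding test_functions_def
    by (simp add: iter_partial_prodfun[OF D] prodfun_differentiable[OF D])
qed

lemma test_iter:
  assumes "\<phi> \<in> test_functions"
  shows "iter_partial js \<phi> differentiable (at x)"
    and "continuous_on A (iter_partial js \<phi>)"
    and "x \<notin> closure {x. \<phi> x \<noteq> 0} \<Longrightarrow> iter_partial js \<phi> x = 0"
proof -
  show d: "iter_partial js \<phi> differentiable (at x)" for x using assms by (simp add: test_functions_def)
  show "continuous_on A (iter_partial js \<phi>)"
    by (meson d differentiable_imp_continuous_within continuous_at_imp_continuous_on)
  let ?U = "- closure {x. \<phi> x \<noteq> 0}"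
  have "\<forall>x\<in>?U. iter_partial js \<phi> x = 0"
  proof (induction js)
    case Nil
    then show ?case using closure_subset by (force simp: iter_partial_Nil)
  next
    case (Cons j js)
    show ?case
    proof
      fix x assume x: "x \<in> ?U"
      have "((\<lambda>_. 0) has_derivative (\<lambda>_. 0)) (at x)" by simp
      then have "(iter_partial js \<phi> has_derivative (\<lambda>_. 0)) (at x)"
        by (rule has_derivative_transform_within_open[of _ _ _ _ ?U]) (use x Cons in auto)
      then have "frechet_derivative (iter_partial js \<phi>) (at x) = (\<lambda>_. 0)"
        using frechet_derivative_at by metis
      then show "iter_partial (j # js) \<phi> x = 0" by (simp add: iter_partial_Cons partial_deriv_def)
    qed
  qed
  then show "x \<notin> closure {x. \<phi> x \<noteq> 0} \<Longrightarrow> iter_partial js \<phi> x = 0" by auto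
qed

lemma locally_integrable_measurable:
  fixes f :: "real ^ 'n \<Rightarrow> real"
  assumes f: "locally_integrable f" shows "f \<in> borel_measurable borel"
proof -
  have m: "(\<lambda>x. indicator (cball 0 (real n)) x *\<^sub>R f x) \<in> borel_measurable borel" for n :: nat
    using f compact_cball[of 0 "real n"] unfolding locally_integrable_def set_integrable_def
    by (metis borel_measurable_integrable measurable_lborel2)
  show ?thesis
  proof (rule borel_measurable_LIMSEQ_real[OF _ m])
    fix x :: "real ^ 'n"
    obtain N where N: "norm x \<le> real N" using real_arch_simple by blast
    show "(\<lambda>n. indicator (cball 0 (real n)) x *\<^sub>R f x) \<longlonglongrightarrow> f x"
      by (rule tendsto_eventually, rule eventually_sequentiallyI[of N]) (use N in auto)
  qed
qed

lemma locally_integrable_mult_compact: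
  fixes f u :: "real ^ 'n \<Rightarrow> real"
  assumes f: "locally_integrable f" and K: "compact K" and u: "continuous_on UNIV u" "\<And>x. x \<notin> K \<Longrightarrow> u x = 0"
  shows "integrable lborel (\<lambda>x. f x * u x)"
proof -
  have [measurable]: "f \<in> borel_measurable borel" using f by (rule locally_integrable_measurable)
  have [measurable]: "u \<in> borel_measurable borel" using u by (intro borel_measurable_continuous_onI)
  have "compact (u ` K)" using u K by (intro compact_continuous_image) (auto intro: continuous_on_subset)
  then obtain B where B: "\<And>x. x \<in> K \<Longrightarrow> \<bar>u x\<bar> \<le> B" by (force dest!: compact_imp_bounded simp: bounded_iff)
  have "integrable lborel (\<lambda>x. B * \<bar>indicator K x *\<^sub>R f x\<bar>)"
    using f K unfolding locally_integrable_def set_integrable_def by (intro integrable_mult_right integrable_abs) auto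
  then show ?thesis
  proof (rule Bochner_Integration.integrable_bound)
    show "AE x in lborel. norm (f x * u x) \<le> norm (B * \<bar>indicator K x *\<^sub>R f x\<bar>)"
    proof (rule AE_I2)
      fix x
      show "norm (f x * u x) \<le> norm (B * \<bar>indicator K x *\<^sub>R f x\<bar>)"
      proof (cases "x \<in> K")
        case True
        have "\<bar>f x\<bar> * \<bar>u x\<bar> \<le> \<bar>f x\<bar> * \<bar>B\<bar>" using B[OF True] by (intro mult_left_mono) auto
        then show ?thesis using True by (simp add: abs_mult mult.commute)
      qed (simp add: u)
    qed
  qed simp
qed

lemma locally_integrable_continuous: "continuous_on UNIV f \<Longrightarrow> locally_integrable f"
  unfolding locally_integrable_def set_integrable_def
  using borel_integrable_compact[of _ f] by (auto intro: continuous_on_subset[of UNIV] simp: indicator_scaleR_eq_if)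

lemma locally_integrable_mult_test:
  assumes "locally_integrable f" "\<phi> \<in> test_functions"
  shows "integrable lborel (\<lambda>x. f x * iter_partial js \<phi> x)"
  by (rule locally_integrable_mult_compact[where K="closure {x. \<phi> x \<noteq> 0}"])
     (use assms test_iter[OF assms(2)] in \<open>auto simp: test_functions_def\<close>)

section \<open>Weak derivatives\<close>

lemma list_with_counts: "\<exists>js. \<forall>i. count_list js i = (\<kappa> :: 'n::finite \<Rightarrow> nat) i"
proof -
  obtain xs where "mset xs = Abs_multiset \<kappa>" by (metis ex_mset)
  moreover have "count (Abs_multiset \<kappa>) = \<kappa>" by (rule Abs_multiset_inverse) simp
  ultimately show ?thesis by (metis count_mset)
qed

lemma length_eq_multi_order: "(\<And>i. count_list js i = \<kappa> i) \<Longrightarrow> length js = multi_order (\<kappa> :: 'n::finite \<Rightarrow> nat)"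
  using sum_count_set[of js UNIV] by simp

text \<open>The fundamental lemma of the calculus of variations: products of bumps converge boundedly to
  indicators of boxes.\<close>

lemma test_zero_imp_AE_zero:
  fixes g :: "real ^ 'n \<Rightarrow> real"
  assumes g: "locally_integrable g" and 0: "\<And>\<phi>. \<phi> \<in> test_functions \<Longrightarrow> (\<integral>x. g x * \<phi> x \<partial>lborel) = 0"
  shows "AE x in lborel. g x = 0"
proof -
  have [measurable]: "g \<in> borel_measurable borel" by (rule locally_integrable_measurable[OF g])
  have icb: "integrable lborel (\<lambda>x. \<bar>indicator (cbox a b) x * g x\<bar>)" for a b
    using g compact_cbox[of a b] unfolding locally_integrable_def set_integrable_def by (auto intro!: integrable_abs)
  have box: "(\<integral>x. g x * indicator (box a b) x \<partial>lborel) = 0" for a b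
  proof -
    define D where "D n i = bump (real (Suc n)) (a $ i) (b $ i)" for n and i :: 'n
    have D: "derivs (D n i)" for n i unfolding D_def by (rule derivs_bump)
    have m[measurable]: "prodfun (D n) (\<lambda>_. 0) \<in> borel_measurable borel" for n by (rule prodfun_measurable[OF D])
    have out: "x \<notin> {a $ i .. b $ i} \<Longrightarrow> D n i 0 x = 0" for n i x
      unfolding D_def by (rule bump_outside) auto
    have "prodfun (D n) (\<lambda>_. 0) \<in> test_functions" for n
      by (rule prodfun_test[OF D, of a b]) (rule out)
    then have z: "(\<integral>x. g x * prodfun (D n) (\<lambda>_. 0) x \<partial>lborel) = 0" for n by (rule 0)
    have "(\<lambda>n. \<integral>x. g x * prodfun (D n) (\<lambda>_. 0) x \<partial>lborel) \<longlonglongrightarrow> (\<integral>x. g x * indicator (box a b) x \<partial>lborel)"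
    proof (rule integral_dominated_convergence[OF _ _ icb])
      have "(\<lambda>n. prodfun (D n) (\<lambda>_. 0) x) \<longlonglongrightarrow> (\<Prod>i\<in>UNIV. indicator {a $ i <..< b $ i} (x $ i))" for x
        unfolding prodfun_def D_def by (intro tendsto_prod bump_0_tendsto)
      moreover have "(\<Prod>i\<in>UNIV. indicator {a $ i <..< b $ i} (x $ i) :: real) = indicator (box a b) x" for x :: "real ^ 'n"
        by (auto simp: indicator_def mem_box_cart)
      ultimately show "AE x in lborel. (\<lambda>n. g x * prodfun (D n) (\<lambda>_. 0) x) \<longlonglongrightarrow> g x * indicator (box a b) x"
        by (intro AE_I2 tendsto_intros) simp
      have "\<bar>prodfun (D n) (\<lambda>_. 0) x\<bar> \<le> indicator (cbox a b) x" for n x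
      proof (cases "x \<in> cbox a b")
        case True
        have "0 \<le> prodfun (D n) (\<lambda>_. 0) x" "prodfun (D n) (\<lambda>_. 0) x \<le> 1"
          unfolding prodfun_def D_def using bump_0_bounds by (auto intro!: prod_nonneg prod_le_1)
        then show ?thesis using True by simp
      next
        case False
        then obtain i where "x $ i \<notin> {a $ i .. b $ i}" by (auto simp: mem_box_cart)
        then have "prodfun (D n) (\<lambda>_. 0) x = 0"
          unfolding prodfun_def by (intro prod_zero) (use out in auto)
        then show ?thesis by simp
      qed
      then show "AE x in lborel. norm (g x * prodfun (D n) (\<lambda>_. 0) x) \<le> \<bar>indicator (cbox a b) x * g x\<bar>" for n
        by (intro AE_I2) (simp add: abs_mult mult.commute[of "\<bar>g _\<bar>"] mult_right_mono)
    qed measurable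
    then show ?thesis by (simp add: z LIMSEQ_const_iff)
  qed
  have "AE x in lborel. g x * indicator (box (- (real n *\<^sub>R One)) (real n *\<^sub>R One)) x = 0" for n
  proof (rule integrable_box_zero_imp_AE_zero)
    let ?B = "box (- (real n *\<^sub>R One)) (real n *\<^sub>R One) :: (real ^ 'n) set"
    show "integrable lborel (\<lambda>x. g x * indicator ?B x)"
      by (rule Bochner_Integration.integrable_bound[OF icb[of "- (real n *\<^sub>R One)" "real n *\<^sub>R One"]])
         (use box_subset_cbox[of "- (real n *\<^sub>R One :: real ^ 'n)" "real n *\<^sub>R One"] in \<open>auto simp: indicator_def abs_mult split: if_splits\<close>)
    fix a b :: "real ^ 'n"
    \<comment> \<open>An intersection of boxes is a box, so localizing to \<open>?B\<close> keeps the hypothesis.\<close>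
    obtain c d where cd: "?B \<inter> box a b = box c d" unfolding box_Int_box by blast
    have "(\<integral>x. g x * indicator ?B x * indicator (box a b) x \<partial>lborel) = (\<integral>x. g x * indicator (box c d) x \<partial>lborel)"
      by (simp add: cd[symmetric] indicator_inter_arith mult.assoc)
    then show "(\<integral>x. g x * indicator ?B x * indicator (box a b) x \<partial>lborel) = 0" by (simp add: box)
  qed
  then have "AE x in lborel. \<forall>n. g x * indicator (box (- (real n *\<^sub>R One)) (real n *\<^sub>R One)) x = 0"
    unfolding AE_all_countable by (rule allI)
  then show ?thesis
  proof eventually_elim
    case (elim x)
    have "x \<in> (\<Union>n::nat. box (- (real n *\<^sub>R One)) (real n *\<^sub>R One))" unfolding UN_box_eq_UNIV by simp
    then obtain n :: nat where "x \<in> box (- (real n *\<^sub>R One)) (real n *\<^sub>R One)" by blast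
    then show ?case using elim[rule_format, of n] by simp
  qed
qed

lemma weak_partial_unique:
  assumes "weak_partial \<kappa> f g" "weak_partial \<kappa> f h"
  shows "AE x in lborel. g x = h x"
proof -
  obtain js where js: "\<And>i. count_list js i = \<kappa> i" using list_with_counts by metis
  have g: "locally_integrable g" and h: "locally_integrable h"
    using assms by (auto simp: weak_partial_def)
  have "AE x in lborel. g x - h x = 0"
  proof (rule test_zero_imp_AE_zero)
    show "locally_integrable (\<lambda>x. g x - h x)"
      using g h unfolding locally_integrable_def by (auto intro: set_integral_diff)
    fix \<phi> :: "real ^ 'a \<Rightarrow> real" assume \<phi>: "\<phi> \<in> test_functions"
    have "(\<integral>x. g x * \<phi> x \<partial>lborel) = (\<integral>x. h x * \<phi> x \<partial>lborel)"
      using assms \<phi> js unfolding weak_partial_def by (metis (no_types, lifting) mult_cancel_left power_eq_0_iff zero_neq_neg_one)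
    moreover have "integrable lborel (\<lambda>x. g x * \<phi> x)" "integrable lborel (\<lambda>x. h x * \<phi> x)"
      using locally_integrable_mult_test[OF g \<phi>, of "[]"] locally_integrable_mult_test[OF h \<phi>, of "[]"]
      by (simp_all add: iter_partial_Nil)
    ultimately show "(\<integral>x. (g x - h x) * \<phi> x \<partial>lborel) = 0"
      by (simp add: left_diff_distrib)
  qed
  then show ?thesis by simp
qed

text \<open>Weak derivatives are unique up to null sets, so the one chosen in \<open>weak_D\<close> agrees with \<open>g\<close>.\<close>

lemma weak_D_eq:
  assumes "weak_partial \<kappa> f g"
  shows "AE x in lborel. weak_D \<kappa> f x = (\<Prod>i\<in>UNIV. 1 / sqrt (fact (\<kappa> i))) * g x"
proof -
  have "weak_partial \<kappa> f (SOME g. weak_partial \<kappa> f g)" by (rule someI[of "weak_partial \<kappa> f"]) (rule assms)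
  from weak_partial_unique[OF this assms] show ?thesis
    unfolding weak_D_def by eventually_elim simp
qed

lemma weak_D_measurable:
  assumes "weak_partial \<kappa> f g"
  shows "weak_D \<kappa> f \<in> borel_measurable borel"
proof -
  have "weak_partial \<kappa> f (SOME g. weak_partial \<kappa> f g)" by (rule someI[of "weak_partial \<kappa> f"]) (rule assms)
  then have "(SOME g. weak_partial \<kappa> f g) \<in> borel_measurable borel"
    by (auto simp: weak_partial_def intro: locally_integrable_measurable)
  then show ?thesis unfolding weak_D_def[abs_def] by simp
qed

lemma weak_D_L2:
  fixes f :: "real ^ 'n \<Rightarrow> real"
  assumes "weak_partial \<kappa> f g" "g \<in> L2 gauss"
  shows "weak_D \<kappa> f \<in> L2 gauss"
proof (rule L2_bound[OF L2_cmult[OF assms(2)]])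
  show "weak_D \<kappa> f \<in> borel_measurable gauss" using weak_D_measurable[OF assms(1)] by simp
  show "AE x in gauss. \<bar>weak_D \<kappa> f x\<bar> \<le> \<bar>(\<Prod>i\<in>UNIV. 1 / sqrt (fact (\<kappa> i))) * g x\<bar>"
    unfolding AE_gauss_iff using weak_D_eq[OF assms(1)] by eventually_elim simp
qed

lemma weak_partial_sum:
  fixes f g :: "'a \<Rightarrow> real ^ 'n \<Rightarrow> real"
  assumes "finite A" "\<And>\<alpha>. \<alpha> \<in> A \<Longrightarrow> weak_partial \<kappa> (f \<alpha>) (g \<alpha>)"
  shows "weak_partial \<kappa> (\<lambda>x. \<Sum>\<alpha>\<in>A. c \<alpha> * f \<alpha> x) (\<lambda>x. \<Sum>\<alpha>\<in>A. c \<alpha> * g \<alpha> x)"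
proof -
  have li: "locally_integrable (\<lambda>x. \<Sum>\<alpha>\<in>A. c \<alpha> * h \<alpha> x)" if "\<And>\<alpha>. \<alpha> \<in> A \<Longrightarrow> locally_integrable (h \<alpha>)" for h :: "'a \<Rightarrow> real ^ 'n \<Rightarrow> real"
    using that unfolding locally_integrable_def set_integrable_def scaleR_sum_right real_scaleR_def
    by (auto simp: sum_distrib_left mult.left_commute[of "indicator _ _"] intro!: Bochner_Integration.integrable_sum integrable_mult_right)
  have sum: "(\<integral>x. (\<Sum>\<alpha>\<in>A. c \<alpha> * h \<alpha> x) * iter_partial js \<phi> x \<partial>lborel) = (\<Sum>\<alpha>\<in>A. c \<alpha> * (\<integral>x. h \<alpha> x * iter_partial js \<phi> x \<partial>lborel))"
    if h: "\<And>\<alpha>. \<alpha> \<in> A \<Longrightarrow> locally_integrable (h \<alpha>)" and \<phi>: "\<phi> \<in> test_functions" for h :: "'a \<Rightarrow> real ^ 'n \<Rightarrow> real" and \<phi> js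
  proof -
    have "(\<integral>x. (\<Sum>\<alpha>\<in>A. c \<alpha> * h \<alpha> x) * iter_partial js \<phi> x \<partial>lborel) = (\<integral>x. (\<Sum>\<alpha>\<in>A. c \<alpha> * (h \<alpha> x * iter_partial js \<phi> x)) \<partial>lborel)"
      by (simp add: sum_distrib_right mult.assoc)
    also have "\<dots> = (\<Sum>\<alpha>\<in>A. (\<integral>x. c \<alpha> * (h \<alpha> x * iter_partial js \<phi> x) \<partial>lborel))"
      by (intro Bochner_Integration.integral_sum integrable_mult_right locally_integrable_mult_test h \<phi>)
    finally show ?thesis by simp
  qed
  have lf: "\<alpha> \<in> A \<Longrightarrow> locally_integrable (f \<alpha>)" and lg: "\<alpha> \<in> A \<Longrightarrow> locally_integrable (g \<alpha>)" for \<alpha>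
    using assms(2) by (auto simp: weak_partial_def)
  show ?thesis
    unfolding weak_partial_def
  proof (intro conjI ballI allI impI)
    fix \<phi> :: "real ^ 'n \<Rightarrow> real" and js assume \<phi>: "\<phi> \<in> test_functions" and js: "\<forall>i. count_list js i = \<kappa> i"
    have "(\<integral>x. (\<Sum>\<alpha>\<in>A. c \<alpha> * f \<alpha> x) * iter_partial js \<phi> x \<partial>lborel) = (\<Sum>\<alpha>\<in>A. c \<alpha> * (\<integral>x. f \<alpha> x * iter_partial js \<phi> x \<partial>lborel))"
      by (rule sum[OF lf \<phi>])
    also have "\<dots> = (\<Sum>\<alpha>\<in>A. c \<alpha> * ((-1) ^ multi_order \<kappa> * (\<integral>x. g \<alpha> x * \<phi> x \<partial>lborel)))"
      using assms(2) \<phi> js by (intro sum.cong) (auto simp: weak_partial_def)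
    also have "\<dots> = (-1) ^ multi_order \<kappa> * (\<Sum>\<alpha>\<in>A. c \<alpha> * (\<integral>x. g \<alpha> x * \<phi> x \<partial>lborel))"
      by (simp add: sum_distrib_left mult_ac)
    also have "\<dots> = (-1) ^ multi_order \<kappa> * (\<integral>x. (\<Sum>\<alpha>\<in>A. c \<alpha> * g \<alpha> x) * \<phi> x \<partial>lborel)"
      using sum[OF lg \<phi>, where js="[]"] by (simp add: iter_partial_Nil)
    finally show "(\<integral>x. (\<Sum>\<alpha>\<in>A. c \<alpha> * f \<alpha> x) * iter_partial js \<phi> x \<partial>lborel) = (-1) ^ multi_order \<kappa> * (\<integral>x. (\<Sum>\<alpha>\<in>A. c \<alpha> * g \<alpha> x) * \<phi> x \<partial>lborel)" .
  qed (auto intro: li lf lg)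
qed

lemma partial_deriv_along_axis:
  fixes w :: "real ^ 'n \<Rightarrow> real"
  assumes "\<And>x. w differentiable (at x)"
  shows "((\<lambda>t. w (x + t *\<^sub>R axis j 1)) has_real_derivative partial_deriv j w (x + t *\<^sub>R axis j 1)) (at t)"
proof -
  have "(w has_derivative frechet_derivative w (at (x + t *\<^sub>R axis j 1))) (at (x + t *\<^sub>R axis j 1))"
    using assms by (simp add: frechet_derivative_works)
  moreover have "((\<lambda>t. x + t *\<^sub>R axis j 1) has_derivative (\<lambda>t. t *\<^sub>R axis j 1)) (at t)"
    by (auto intro!: derivative_eq_intros)
  ultimately have d: "((\<lambda>t. w (x + t *\<^sub>R axis j 1)) has_derivative (\<lambda>h. frechet_derivative w (at (x + t *\<^sub>R axis j 1)) (h *\<^sub>R axis j 1))) (at t)"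
    by (rule has_derivative_compose[rotated])
  have "frechet_derivative w (at (x + t *\<^sub>R axis j 1)) (h *\<^sub>R axis j 1) = partial_deriv j w (x + t *\<^sub>R axis j 1) * h" for h
    unfolding partial_deriv_def using linear_frechet_derivative[OF assms] by (simp add: linear_cmul mult.commute)
  then show ?thesis using d unfolding has_field_derivative_def by (metis (no_types, lifting) ext)
qed

text \<open>The integral of \<open>w\<close> is invariant under translation in the direction \<open>j\<close>; differentiate it under
  the integral sign.\<close>

lemma integral_partial_deriv_zero:
  fixes w :: "real ^ 'n \<Rightarrow> real"
  assumes dw: "\<And>x. w differentiable (at x)" and cont: "continuous_on UNIV (partial_deriv j w)"
    and K: "compact K" "\<And>x. x \<notin> K \<Longrightarrow> w x = 0" "\<And>x. x \<notin> K \<Longrightarrow> partial_deriv j w x = 0"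
  shows "(\<integral>x. partial_deriv j w x \<partial>lborel) = 0"
proof -
  let ?e = "axis j 1 :: real ^ 'n"
  have cw: "continuous_on UNIV w"
    by (meson dw differentiable_imp_continuous_within continuous_at_imp_continuous_on)
  have [measurable]: "w \<in> borel_measurable borel" "partial_deriv j w \<in> borel_measurable borel"
    by (intro borel_measurable_continuous_onI cw cont)+
  have iw: "integrable lborel w"
  proof -
    have "integrable lborel (\<lambda>x. indicator K x *\<^sub>R w x)"
      by (rule borel_integrable_compact) (use K cw in \<open>auto intro: continuous_on_subset\<close>)
    moreover have "(\<lambda>x. indicator K x *\<^sub>R w x) = w" using K by (auto simp: fun_eq_iff indicator_def)
    ultimately show ?thesis by (simp only:)
  qed
  have tr: "distr lborel borel (\<lambda>x. c + x) = (lborel :: (real ^ 'n) measure)" for c by (rule lborel_distr_plus)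
  have iw': "integrable lborel (\<lambda>x. w (c + x))" for c
    using iw by (subst (asm) tr[of c, symmetric], subst (asm) integrable_distr_eq) auto
  have ew: "(\<integral>x. w (c + x) \<partial>lborel) = (\<integral>x. w x \<partial>lborel)" for c
    by (subst (2) tr[of c, symmetric], subst integral_distr) auto
  obtain B where B: "\<And>x. \<bar>partial_deriv j w x\<bar> \<le> B"
  proof -
    have "compact (partial_deriv j w ` K)" using K cont by (intro compact_continuous_image) (auto intro: continuous_on_subset)
    then obtain B where "\<And>x. x \<in> K \<Longrightarrow> \<bar>partial_deriv j w x\<bar> \<le> B" by (force dest!: compact_imp_bounded simp: bounded_iff)
    then have "\<bar>partial_deriv j w x\<bar> \<le> \<bar>B\<bar>" for x by (cases "x \<in> K") (force simp: K)+
    then show ?thesis by (rule that)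
  qed
  have B0: "B \<ge> 0" using B[of 0] by linarith
  obtain R where R: "\<And>x. x \<in> K \<Longrightarrow> norm x \<le> R" using compact_imp_bounded[OF K(1)] by (auto simp: bounded_iff)
  define h where "h n = inverse (real (Suc n))" for n
  have h: "h n > 0" "h n \<le> 1" for n by (auto simp: h_def inverse_eq_divide)
  have h0: "h \<longlonglongrightarrow> 0" unfolding h_def by (rule LIMSEQ_inverse_real_of_nat)
  define q where "q n x = (w (h n *\<^sub>R ?e + x) - w x) / h n" for n x
  have [measurable]: "q n \<in> borel_measurable borel" for n unfolding q_def[abs_def] by measurable
  have q0: "(\<integral>x. q n x \<partial>lborel) = 0" for n
    unfolding q_def using iw iw' ew by simp
  have "(\<lambda>n. \<integral>x. q n x \<partial>lborel) \<longlonglongrightarrow> (\<integral>x. partial_deriv j w x \<partial>lborel)"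
  proof (rule integral_dominated_convergence[where w="\<lambda>x. B * indicator (cball 0 (R + 1)) x"])
    show "integrable lborel (\<lambda>x::real ^ 'n. B * indicator (cball 0 (R + 1)) x)"
      using emeasure_bounded_finite[OF bounded_cball[of "0 :: real ^ 'n" "R + 1"]]
      by (intro integrable_mult_right integrable_real_indicator) auto
    show "AE x in lborel. (\<lambda>n. q n x) \<longlonglongrightarrow> partial_deriv j w x"
    proof (rule AE_I2)
      fix x
      have "((\<lambda>t. w (x + t *\<^sub>R ?e)) has_real_derivative partial_deriv j w x) (at 0)"
        using partial_deriv_along_axis[OF dw, of x j 0] by simp
      then have "((\<lambda>t. (w (x + t *\<^sub>R ?e) - w x) / t) \<longlongrightarrow> partial_deriv j w x) (at 0)"
        by (simp add: DERIV_def)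
      moreover have "filterlim h (at 0) sequentially"
        using h h0 by (auto simp: filterlim_at less_imp_neq[symmetric])
      ultimately show "(\<lambda>n. q n x) \<longlonglongrightarrow> partial_deriv j w x"
        unfolding q_def add.commute[of "_ *\<^sub>R _"] by (rule filterlim_compose)
    qed
    show "AE x in lborel. norm (q n x) \<le> B * indicator (cball 0 (R + 1)) x" for n
    proof (rule AE_I2)
      fix x
      show "norm (q n x) \<le> B * indicator (cball 0 (R + 1)) x"
      proof (cases "x \<in> cball 0 (R + 1)")
        case True
        obtain z where "w (x + h n *\<^sub>R ?e) - w (x + 0 *\<^sub>R ?e) = (h n - 0) * partial_deriv j w (x + z *\<^sub>R ?e)"
          using MVT2[of 0 "h n" "\<lambda>t. w (x + t *\<^sub>R ?e)" "\<lambda>t. partial_deriv j w (x + t *\<^sub>R ?e)"]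
            h(1)[of n] partial_deriv_along_axis[OF dw, of x j] by blast
        then have "q n x = partial_deriv j w (x + z *\<^sub>R ?e)"
          using h(1)[of n] by (simp add: q_def add.commute field_simps)
        then show ?thesis using B True by simp
      next
        case False
        then have x: "norm x > R + 1" by simp
        have "norm (h n *\<^sub>R ?e + x) \<ge> norm x - norm (h n *\<^sub>R ?e)"
          using norm_diff_ineq[of x "h n *\<^sub>R ?e"] by (simp add: add.commute)
        moreover have "norm (h n *\<^sub>R ?e) \<le> 1" using h[of n] by (simp add: norm_axis_1)
        ultimately have "h n *\<^sub>R ?e + x \<notin> K" "x \<notin> K" using R x by force+
        then show ?thesis using K False by (simp add: q_def)
      qed
    qed
  qed measurable
  then show ?thesis by (simp add: q0 LIMSEQ_const_iff)
qed

lemma partial_deriv_mult: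
  assumes "u differentiable (at x)" "v differentiable (at x)"
  shows "partial_deriv j (\<lambda>x. u x * v x) x = partial_deriv j u x * v x + u x * partial_deriv j v x"
proof -
  have "((\<lambda>x. u x * v x) has_derivative (\<lambda>h. u x * frechet_derivative v (at x) h + frechet_derivative u (at x) h * v x)) (at x)"
    using assms unfolding frechet_derivative_works by (rule has_derivative_mult)
  from frechet_derivative_at[OF this, symmetric] show ?thesis by (simp add: partial_deriv_def)
qed

lemma prodfun_ibp:
  fixes D :: "'n::finite \<Rightarrow> nat \<Rightarrow> real \<Rightarrow> real"
  assumes D: "\<And>i. derivs (D i)" and \<phi>: "\<phi> \<in> test_functions"
  shows "(\<integral>x. prodfun D m x * iter_partial (j # js) \<phi> x \<partial>lborel)
     = - (\<integral>x. prodfun D (m(j := Suc (m j))) x * iter_partial js \<phi> x \<partial>lborel)"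
proof -
  let ?u = "prodfun D m" and ?v = "iter_partial js \<phi>" and ?K = "closure {x. \<phi> x \<noteq> 0}"
  have K: "compact ?K" using \<phi> by (simp add: test_functions_def)
  note d = prodfun_differentiable[OF D, where m=m] test_iter(1)[OF \<phi>, where js=js]
  have pd: "partial_deriv j (\<lambda>x. ?u x * ?v x) = (\<lambda>x. prodfun D (m(j := Suc (m j))) x * ?v x + ?u x * iter_partial (j # js) \<phi> x)"
    by (auto simp: fun_eq_iff partial_deriv_mult[OF d] partial_deriv_prodfun[OF D] iter_partial_Cons)
  have "(\<integral>x. partial_deriv j (\<lambda>x. ?u x * ?v x) x \<partial>lborel) = 0"
  proof (rule integral_partial_deriv_zero[OF _ _ K])
    show "(\<lambda>x. ?u x * ?v x) differentiable (at x)" for x using d by (rule differentiable_mult)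
    show "continuous_on UNIV (partial_deriv j (\<lambda>x. ?u x * ?v x))"
      unfolding pd by (intro continuous_intros prodfun_continuous[OF D] test_iter(2)[OF \<phi>])
  qed (simp_all add: pd test_iter(3)[OF \<phi>])
  moreover have "integrable lborel (\<lambda>x. prodfun D m' x * iter_partial js' \<phi> x)" for m' js'
    by (rule locally_integrable_mult_test[OF locally_integrable_continuous[OF prodfun_continuous[OF D]] \<phi>])
  ultimately show ?thesis unfolding pd by simp
qed

text \<open>Classical derivatives are weak derivatives, by moving one partial derivative at a time.\<close>

lemma weak_partial_prodfun:
  fixes D :: "'n::finite \<Rightarrow> nat \<Rightarrow> real \<Rightarrow> real"
  assumes D: "\<And>i. derivs (D i)"
  shows "weak_partial \<kappa> (prodfun D m) (prodfun D (\<lambda>i. m i + \<kappa> i))"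
  unfolding weak_partial_def
proof (intro conjI ballI allI impI)
  fix \<phi> :: "real ^ 'n \<Rightarrow> real" and js assume \<phi>: "\<phi> \<in> test_functions" and js: "\<forall>i. count_list js i = \<kappa> i"
  have "(\<integral>x. prodfun D m x * iter_partial js \<phi> x \<partial>lborel) = (-1) ^ length js * (\<integral>x. prodfun D (\<lambda>i. m i + count_list js i) x * \<phi> x \<partial>lborel)"
  proof (induction js arbitrary: m)
    case Nil then show ?case by (simp add: iter_partial_Nil)
  next
    case (Cons j js)
    have e: "(\<lambda>i. (m(j := Suc (m j))) i + count_list js i) = (\<lambda>i. m i + count_list (j # js) i)" by auto
    show ?case unfolding prodfun_ibp[OF D \<phi>] Cons.IH e by simp
  qed
  then show "(\<integral>x. prodfun D m x * iter_partial js \<phi> x \<partial>lborel) = (-1) ^ multi_order \<kappa> * (\<integral>x. prodfun D (\<lambda>i. m i + \<kappa> i) x * \<phi> x \<partial>lborel)"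
    using js length_eq_multi_order[of js \<kappa>] by simp
qed (intro locally_integrable_continuous prodfun_continuous D)+

text \<open>The derivatives of \<open>He b\<close> times the Gaussian density.\<close>

definition hermite_derivs :: "nat \<Rightarrow> nat \<Rightarrow> real \<Rightarrow> real" where
  "hermite_derivs b m x = (-1) ^ m * (poly (He (b + m)) x * std_normal_density x)"

lemma derivs_hermite_derivs: "derivs (hermite_derivs b)"
  unfolding derivs_def
proof (intro allI)
  fix m and x :: real
  have n: "(std_normal_density has_real_derivative - x * std_normal_density x) (at x)"
  proof -
    have "((\<lambda>x. c * exp (- x\<^sup>2 / 2)) has_real_derivative - x * (c * exp (- x\<^sup>2 / 2))) (at x)" for c
      by (auto intro!: derivative_eq_intros)
    then show ?thesis unfolding std_normal_density_def .
  qed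
  have "((\<lambda>x. poly (He (b + m)) x * std_normal_density x) has_real_derivative
     (poly (pderiv (He (b + m))) x * std_normal_density x + (- x * std_normal_density x) * poly (He (b + m)) x)) (at x)"
    by (rule DERIV_mult[OF poly_DERIV n])
  from DERIV_cmult[OF this, of "(-1) ^ m"]
  show "(hermite_derivs b m has_real_derivative hermite_derivs b (Suc m) x) (at x)"
    unfolding hermite_derivs_def[abs_def] by (simp add: algebra_simps)
qed

lemma bump_bounded: "\<exists>B. \<forall>x. \<bar>bump c a b m x\<bar> \<le> B" if "c > 0"
proof -
  have "compact (bump c a b m ` {a..b})"
    by (intro compact_continuous_image derivs_continuous[OF derivs_bump]) simp
  then obtain B where "\<And>x. x \<in> {a..b} \<Longrightarrow> \<bar>bump c a b m x\<bar> \<le> B" by (force dest!: compact_imp_bounded simp: bounded_iff)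
  then have "\<bar>bump c a b m x\<bar> \<le> \<bar>B\<bar>" for x
    using bump_outside[OF that, of x a b m]
    by (cases "x \<in> {a<..<b}") (auto intro: order_trans[OF _ abs_ge_self])
  then show ?thesis by blast
qed

text \<open>The derivatives of the bump dilated by the factor \<open>Suc n\<close>: those of positive order are uniformly
  bounded and tend to 0 with \<open>n\<close>, while the function itself tends to a positive constant.\<close>

definition cutoff :: "nat \<Rightarrow> nat \<Rightarrow> real \<Rightarrow> real" where
  "cutoff n m x = (inverse (real (Suc n))) ^ m * bump 1 (-1) 1 m (inverse (real (Suc n)) * x + 0)"

lemma derivs_cutoff: "derivs (cutoff n)"
  unfolding cutoff_def[abs_def] by (rule derivs_affine[OF derivs_bump])

lemma cutoff_outside: "x \<notin> {- real (Suc n) .. real (Suc n)} \<Longrightarrow> cutoff n m x = 0"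
proof -
  assume "x \<notin> {- real (Suc n) .. real (Suc n)}"
  then have "inverse (real (Suc n)) * x + 0 \<notin> {-1<..<1}"
    by (auto simp: field_simps del: of_nat_Suc simp del: of_nat_Suc)
  then show ?thesis unfolding cutoff_def using bump_outside[of 1] by simp
qed

lemma cutoff_tendsto: "(\<lambda>n. cutoff n m x) \<longlonglongrightarrow> (if m = 0 then bump 1 (-1) 1 0 0 else 0)"
proof -
  have "isCont (bump 1 (-1) 1 m) (0 * x + 0)" by (rule DERIV_isCont[OF derivsD[OF derivs_bump]])
  then have "(\<lambda>n. bump 1 (-1) 1 m (inverse (real (Suc n)) * x + 0)) \<longlonglongrightarrow> bump 1 (-1) 1 m (0 * x + 0)"
    by (rule isCont_tendsto_compose) (intro tendsto_intros LIMSEQ_inverse_real_of_nat)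
  then have "(\<lambda>n. cutoff n m x) \<longlonglongrightarrow> 0 ^ m * bump 1 (-1) 1 m (0 * x + 0)"
    unfolding cutoff_def by (intro tendsto_intros LIMSEQ_inverse_real_of_nat)
  then show ?thesis by (cases m) auto
qed

lemma cutoff_bounded: "\<exists>B. \<forall>n x. \<bar>cutoff n m x\<bar> \<le> B"
proof -
  obtain B where B: "\<And>x. \<bar>bump 1 (-1) 1 m x\<bar> \<le> B" using bump_bounded[of 1] by fastforce
  have "\<bar>cutoff n m x\<bar> \<le> 1 * B" for n x
    unfolding cutoff_def abs_mult
    by (intro mult_mono' B) (auto simp: power_abs inverse_eq_divide intro!: power_le_one)
  then show ?thesis by blast
qed

lemma cutoff_pos: "bump 1 (-1) 1 0 0 > 0"
  by (simp add: bump_def flat_0)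

lemma leibniz_cutoff_tendsto:
  "(\<lambda>n. leibniz D (cutoff n) m x) \<longlonglongrightarrow> D m x * bump 1 (-1) 1 0 0"
proof -
  have "(\<lambda>n. leibniz D (cutoff n) m x) \<longlonglongrightarrow> (\<Sum>j\<le>m. real (m choose j) * D (m - j) x * (if j = 0 then bump 1 (-1) 1 0 0 else 0))"
    unfolding leibniz_def by (intro tendsto_intros cutoff_tendsto)
  then show ?thesis by (simp add: if_distrib cong: if_cong)
qed

lemma leibniz_cutoff_dominated:
  "\<exists>w. exp_bounded w \<and> (\<forall>n x. \<bar>leibniz (hermite_derivs b) (cutoff n) m x\<bar> \<le> w x * std_normal_density x)"
proof -
  \<comment> \<open>The bound \<open>B j\<close> is uniform in \<open>n\<close>, so the dominating function does not depend on the cutoff.\<close>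
  obtain B where B: "\<And>j n x. \<bar>cutoff n j x\<bar> \<le> B j" using cutoff_bounded by metis
  define w where "w x = (\<Sum>j\<le>m. real (m choose j) * \<bar>poly (He (b + (m - j))) x\<bar> * B j)" for x
  have B0: "B j \<ge> 0" for j using B[of 0 j 0] by linarith
  have "exp_bounded w"
  proof -
    have "exp_bounded (\<lambda>x. \<Sum>j\<in>J. real (m choose j) * \<bar>poly (He (b + (m - j))) x\<bar> * B j)" for J
      by (induction J rule: infinite_finite_induct) (auto intro!: exp_bounded_add exp_bounded_mult exp_bounded_const exp_bounded_abs exp_bounded_poly)
    then show ?thesis unfolding w_def[abs_def] .
  qed
  moreover have "\<bar>leibniz (hermite_derivs b) (cutoff n) m x\<bar> \<le> w x * std_normal_density x" for n x
  proof -
    have "\<bar>leibniz (hermite_derivs b) (cutoff n) m x\<bar> \<le> (\<Sum>j\<le>m. real (m choose j) * (\<bar>poly (He (b + (m - j))) x\<bar> * std_normal_density x) * \<bar>cutoff n j x\<bar>)"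
      unfolding leibniz_def hermite_derivs_def
      by (rule order_trans[OF sum_abs]) (simp add: abs_mult power_abs)
    also have "\<dots> \<le> (\<Sum>j\<le>m. real (m choose j) * (\<bar>poly (He (b + (m - j))) x\<bar> * std_normal_density x) * B j)"
      by (intro sum_mono mult_left_mono B) auto
    finally show ?thesis unfolding w_def by (simp add: sum_distrib_right sum_distrib_left mult_ac)
  qed
  ultimately show ?thesis by blast
qed

text \<open>Apply the definition of the weak derivative to the test function obtained from the Hermite
  function \<open>\<Prod>i. He (\<beta> i) (x $ i)\<close> times the Gaussian density by a cutoff in each coordinate. By the
  Leibniz rule all derivatives that hit the cutoff disappear in the limit, and the remaining ones
  raise the index of \<open>He\<close>.\<close>

lemma integral_He_weak_partial:
  fixes f g :: "real ^ 'n \<Rightarrow> real"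
  assumes f: "f \<in> L2 gauss" and g: "g \<in> L2 gauss" and w: "weak_partial \<kappa> f g"
  shows "(\<integral>x. f x * (\<Prod>i\<in>UNIV. poly (He (\<beta> i + \<kappa> i)) (x $ i)) \<partial>gauss) = (\<integral>x. g x * (\<Prod>i\<in>UNIV. poly (He (\<beta> i)) (x $ i)) \<partial>gauss)"
proof -
  define c0 where "c0 = bump 1 (-1) 1 0 0"
  have c0: "c0 > 0" unfolding c0_def by (rule cutoff_pos)
  define D where "D n i = leibniz (hermite_derivs (\<beta> i)) (cutoff n)" for n and i :: 'n
  have D: "derivs (D n i)" for n i unfolding D_def by (intro derivs_leibniz derivs_hermite_derivs derivs_cutoff)
  have test: "prodfun (D n) (\<lambda>_. 0) \<in> test_functions" for n
    by (rule prodfun_test[OF D, of "\<chi> i. - real (Suc n)" "\<chi> i. real (Suc n)"])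
       (simp add: D_def cutoff_outside del: of_nat_Suc)
  have lim: "(\<lambda>n. \<integral>x. u x * prodfun (D n) m x \<partial>lborel) \<longlonglongrightarrow>
      c0 ^ CARD('n) * (-1) ^ multi_order m * (\<integral>x. u x * (\<Prod>i\<in>UNIV. poly (He (\<beta> i + m i)) (x $ i)) \<partial>gauss)"
    if u: "u \<in> L2 gauss" for u :: "real ^ 'n \<Rightarrow> real" and m
  proof -
    have [measurable]: "u \<in> borel_measurable borel" using L2_measurable[OF u] by simp
    have [measurable]: "prodfun (D n) m \<in> borel_measurable borel" for n by (rule prodfun_measurable[OF D])
    have "\<forall>i. \<exists>w. exp_bounded w \<and> (\<forall>n x. \<bar>D n i (m i) x\<bar> \<le> w x * std_normal_density x)"
      unfolding D_def using leibniz_cutoff_dominated by blast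
    then obtain w where w: "\<And>i. exp_bounded (w i)" "\<And>i n x. \<bar>D n i (m i) x\<bar> \<le> w i x * std_normal_density x"
      by metis
    have [measurable]: "w i \<in> borel_measurable borel" for i using w(1) by (rule exp_boundedD)
    have pm[measurable]: "poly (He k) \<in> borel_measurable borel" for k
      by (intro borel_measurable_continuous_onI continuous_intros)
    have dom: "integrable lborel (\<lambda>x. \<bar>gauss_density x * (u x * (\<Prod>i\<in>UNIV. w i (x $ i)))\<bar>)"
      using L2_integrable_mult[OF u prod_exp_bounded_L2[OF w(1)]]
      by (intro integrable_abs) (subst (asm) integrable_gauss_iff, auto)
    have "(\<lambda>n. \<integral>x. u x * prodfun (D n) m x \<partial>lborel) \<longlonglongrightarrow> (\<integral>x. u x * (\<Prod>i\<in>UNIV. hermite_derivs (\<beta> i) (m i) (x $ i) * c0) \<partial>lborel)"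
    proof (rule integral_dominated_convergence[OF _ _ dom])
      show "AE x in lborel. (\<lambda>n. u x * prodfun (D n) m x) \<longlonglongrightarrow> u x * (\<Prod>i\<in>UNIV. hermite_derivs (\<beta> i) (m i) (x $ i) * c0)"
        unfolding prodfun_def D_def c0_def by (intro AE_I2 tendsto_intros leibniz_cutoff_tendsto)
      show "AE x in lborel. norm (u x * prodfun (D n) m x) \<le> \<bar>gauss_density x * (u x * (\<Prod>i\<in>UNIV. w i (x $ i)))\<bar>" for n
      proof (rule AE_I2)
        fix x :: "real ^ 'n"
        have "\<bar>prodfun (D n) m x\<bar> \<le> (\<Prod>i\<in>UNIV. w i (x $ i) * std_normal_density (x $ i))"
          unfolding prodfun_def abs_prod by (intro prod_mono conjI w) auto
        also have "\<dots> \<le> \<bar>gauss_density x * (\<Prod>i\<in>UNIV. w i (x $ i))\<bar>"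
          by (simp add: gauss_density_eq_prod prod.distrib mult.commute)
        finally show "norm (u x * prodfun (D n) m x) \<le> \<bar>gauss_density x * (u x * (\<Prod>i\<in>UNIV. w i (x $ i)))\<bar>"
          by (simp add: abs_mult mult_left_mono mult.left_commute[of _ "\<bar>u x\<bar>"])
      qed
      show "(\<lambda>x. u x * (\<Prod>i\<in>UNIV. hermite_derivs (\<beta> i) (m i) (x $ i) * c0)) \<in> borel_measurable lborel"
        unfolding hermite_derivs_def by measurable
    qed measurable
    moreover have "(\<integral>x. u x * (\<Prod>i\<in>UNIV. hermite_derivs (\<beta> i) (m i) (x $ i) * c0) \<partial>lborel)
       = (\<integral>x. c0 ^ CARD('n) * (-1) ^ multi_order m * (gauss_density x * (u x * (\<Prod>i\<in>UNIV. poly (He (\<beta> i + m i)) (x $ i)))) \<partial>lborel)"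
      unfolding hermite_derivs_def gauss_density_eq_prod
      by (rule Bochner_Integration.integral_cong[OF refl]) (simp add: prod.distrib power_sum mult_ac)
    ultimately show ?thesis
      by (simp add: integral_gauss)
  qed
  obtain js where js: "\<And>i. count_list js i = \<kappa> i" using list_with_counts by metis
  have it: "iter_partial js (prodfun (D n) (\<lambda>_. 0)) = prodfun (D n) \<kappa>" for n
    by (simp add: iter_partial_prodfun[OF D] js)
  have eq: "(\<integral>x. f x * prodfun (D n) \<kappa> x \<partial>lborel) = (-1) ^ multi_order \<kappa> * (\<integral>x. g x * prodfun (D n) (\<lambda>_. 0) x \<partial>lborel)" for n
    using w test[of n] js it[of n] unfolding weak_partial_def by metis
  have "c0 ^ CARD('n) * (-1) ^ multi_order \<kappa> * (\<integral>x. f x * (\<Prod>i\<in>UNIV. poly (He (\<beta> i + \<kappa> i)) (x $ i)) \<partial>gauss)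
     = (-1) ^ multi_order \<kappa> * (c0 ^ CARD('n) * (-1) ^ multi_order (\<lambda>_::'n. 0) * (\<integral>x. g x * (\<Prod>i\<in>UNIV. poly (He (\<beta> i + 0)) (x $ i)) \<partial>gauss))"
    by (rule LIMSEQ_unique[OF lim[OF f, of \<kappa>, unfolded eq] tendsto_mult[OF tendsto_const lim[OF g, of "\<lambda>_. 0"]]])
  then show ?thesis using c0 by simp
qed

section \<open>Rotation invariance and the Ornstein-Uhlenbeck operators\<close>

interpretation gauss2: pair_prob_space "gauss :: (real ^ 'n) measure" "gauss :: (real ^ 'n) measure"
  by standard

lemma nn_integral_lborel_affine:
  fixes t :: "'a::euclidean_space"
  assumes [measurable]: "f \<in> borel_measurable borel" and c: "c > 0"
  shows "(\<integral>\<^sup>+x. f x \<partial>lborel) = ennreal (c ^ DIM('a)) * (\<integral>\<^sup>+x. f (t + c *\<^sub>R x) \<partial>lborel)"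
  by (subst lborel_affine[of c t]) (use c in \<open>auto simp: nn_integral_density nn_integral_distr nn_integral_cmult\<close>)

text \<open>The sine is written \<open>s\<close> and the cosine \<open>\<rho>\<close>. With this sign of the second component \<open>rot\<close> is a
  reflection, hence its own inverse.\<close>

definition rot :: "real \<Rightarrow> real \<Rightarrow> (real ^ 'n) \<times> (real ^ 'n) \<Rightarrow> (real ^ 'n) \<times> (real ^ 'n)" where
  "rot \<rho> s = (\<lambda>(x, y). (\<rho> *\<^sub>R x + s *\<^sub>R y, s *\<^sub>R x - \<rho> *\<^sub>R y))"

lemma rot_measurable [measurable]: "rot \<rho> s \<in> measurable (borel \<Otimes>\<^sub>M borel) (borel \<Otimes>\<^sub>M borel)"
  unfolding rot_def by measurable

text \<open>Two affine substitutions: first \<open>z = \<rho> x + s y\<close> for \<open>y\<close> with \<open>x\<close> fixed, then \<open>x = \<rho> z + s w\<close> with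
  \<open>z\<close> fixed. The Jacobian factors \<open>s ^ n\<close> cancel.\<close>

lemma nn_integral_lborel_rot:
  fixes H :: "(real ^ 'n) \<times> (real ^ 'n) \<Rightarrow> ennreal"
  assumes [measurable]: "H \<in> borel_measurable (borel \<Otimes>\<^sub>M borel)" and s: "s > 0" and rs: "\<rho>\<^sup>2 + s\<^sup>2 = 1"
  shows "(\<integral>\<^sup>+x. \<integral>\<^sup>+y. H (rot \<rho> s (x, y)) \<partial>lborel \<partial>lborel) = (\<integral>\<^sup>+x. \<integral>\<^sup>+y. H (x, y) \<partial>lborel \<partial>lborel)"
proof -
  let ?c = "ennreal (s ^ DIM(real ^ 'n))"
  have [measurable]: "H \<in> borel_measurable (lborel \<Otimes>\<^sub>M lborel)"
    using assms(1) by (simp cong: measurable_cong_sets)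
  have c: "?c \<noteq> 0" "?c \<noteq> \<infinity>" using s by auto
  have "?c * (\<integral>\<^sup>+x. \<integral>\<^sup>+y. H (rot \<rho> s (x, y)) \<partial>lborel \<partial>lborel)
     = (\<integral>\<^sup>+x. ?c * (\<integral>\<^sup>+y. H (rot \<rho> s (x, y)) \<partial>lborel) \<partial>lborel)"
    by (rule nn_integral_cmult[symmetric]) (unfold rot_def, measurable)
  also have "\<dots> = (\<integral>\<^sup>+x. \<integral>\<^sup>+z. H (z, (1 / s) *\<^sub>R (x - \<rho> *\<^sub>R z)) \<partial>lborel \<partial>lborel)"
  proof (rule nn_integral_cong)
    fix x :: "real ^ 'n"
    have "(1 / s) *\<^sub>R (x - \<rho> *\<^sub>R (\<rho> *\<^sub>R x + s *\<^sub>R y)) = s *\<^sub>R x - \<rho> *\<^sub>R y" for y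
    proof -
      have "x - \<rho> *\<^sub>R (\<rho> *\<^sub>R x + s *\<^sub>R y) = (1 - \<rho>\<^sup>2) *\<^sub>R x - (\<rho> * s) *\<^sub>R y"
        by (simp add: algebra_simps power2_eq_square)
      also have "1 - \<rho>\<^sup>2 = s\<^sup>2" using rs by simp
      finally show ?thesis using s by (simp add: scaleR_diff_right power2_eq_square)
    qed
    then show "?c * (\<integral>\<^sup>+y. H (rot \<rho> s (x, y)) \<partial>lborel) = (\<integral>\<^sup>+z. H (z, (1 / s) *\<^sub>R (x - \<rho> *\<^sub>R z)) \<partial>lborel)"
      by (subst nn_integral_lborel_affine[OF _ s, where t="\<rho> *\<^sub>R x"]) (simp_all add: rot_def)
  qed
  also have "\<dots> = (\<integral>\<^sup>+z. \<integral>\<^sup>+x. H (z, (1 / s) *\<^sub>R (x - \<rho> *\<^sub>R z)) \<partial>lborel \<partial>lborel)"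
    by (rule lborel_pair.Fubini') measurable
  also have "\<dots> = (\<integral>\<^sup>+z. ?c * (\<integral>\<^sup>+w. H (z, w) \<partial>lborel) \<partial>lborel)"
  proof (rule nn_integral_cong)
    fix z :: "real ^ 'n"
    show "(\<integral>\<^sup>+x. H (z, (1 / s) *\<^sub>R (x - \<rho> *\<^sub>R z)) \<partial>lborel) = ?c * (\<integral>\<^sup>+w. H (z, w) \<partial>lborel)"
      by (subst nn_integral_lborel_affine[OF _ s, where t="\<rho> *\<^sub>R z"]) (use s in \<open>simp_all\<close>)
  qed
  also have "\<dots> = ?c * (\<integral>\<^sup>+z. \<integral>\<^sup>+w. H (z, w) \<partial>lborel \<partial>lborel)"
    by (rule nn_integral_cmult) measurable
  finally show ?thesis using c by (simp add: ennreal_mult_cancel_left)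
qed

lemma gauss_density_rot:
  assumes rs: "\<rho>\<^sup>2 + s\<^sup>2 = 1"
  shows "gauss_density x * gauss_density y = gauss_density (\<rho> *\<^sub>R x + s *\<^sub>R y) * gauss_density (s *\<^sub>R x - \<rho> *\<^sub>R y)"
proof -
  have "(norm (\<rho> *\<^sub>R x + s *\<^sub>R y))\<^sup>2 + (norm (s *\<^sub>R x - \<rho> *\<^sub>R y))\<^sup>2 = (\<rho>\<^sup>2 + s\<^sup>2) * ((norm x)\<^sup>2 + (norm y)\<^sup>2)"
    unfolding power2_norm_eq_inner by (simp add: inner_add_left inner_add_right inner_diff_left inner_diff_right inner_commute power2_eq_square algebra_simps)
  then have "(norm x)\<^sup>2 + (norm y)\<^sup>2 = (norm (\<rho> *\<^sub>R x + s *\<^sub>R y))\<^sup>2 + (norm (s *\<^sub>R x - \<rho> *\<^sub>R y))\<^sup>2"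
    using rs by simp
  then have "- (norm x)\<^sup>2 / 2 + - (norm y)\<^sup>2 / 2
      = - (norm (\<rho> *\<^sub>R x + s *\<^sub>R y))\<^sup>2 / 2 + - (norm (s *\<^sub>R x - \<rho> *\<^sub>R y))\<^sup>2 / 2"
    by linarith
  from arg_cong[OF this, of exp]
  have "exp (- (norm x)\<^sup>2 / 2) * exp (- (norm y)\<^sup>2 / 2)
      = exp (- (norm (\<rho> *\<^sub>R x + s *\<^sub>R y))\<^sup>2 / 2) * exp (- (norm (s *\<^sub>R x - \<rho> *\<^sub>R y))\<^sup>2 / 2)"
    unfolding exp_add .
  moreover have "(k * a) * (k * b) = k * k * (a * b)" for k a b :: real by simp
  ultimately show ?thesis unfolding gauss_density_def by simp
qed

lemma nn_integral_gauss:
  "f \<in> borel_measurable borel \<Longrightarrow> (\<integral>\<^sup>+x. f x \<partial>gauss) = (\<integral>\<^sup>+x. ennreal (gauss_density x) * f x \<partial>lborel)"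
  unfolding gauss_def by (rule nn_integral_density) auto

lemma sets_gauss2: "sets (gauss \<Otimes>\<^sub>M gauss) = sets (borel \<Otimes>\<^sub>M borel)"
  by (intro sets_pair_measure_cong sets_gauss)

text \<open>The product density depends only on \<open>norm x ^ 2 + norm y ^ 2\<close>.\<close>

lemma distr_rot:
  assumes s: "s > 0" and rs: "\<rho>\<^sup>2 + s\<^sup>2 = 1"
  shows "distr (gauss \<Otimes>\<^sub>M gauss) (gauss \<Otimes>\<^sub>M gauss) (rot \<rho> s) = (gauss \<Otimes>\<^sub>M gauss :: ((real ^ 'n) \<times> (real ^ 'n)) measure)"
proof (rule measure_eqI)
  let ?G = "gauss \<Otimes>\<^sub>M gauss :: ((real ^ 'n) \<times> (real ^ 'n)) measure"
  have rm [measurable]: "rot \<rho> s \<in> measurable ?G ?G"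
    using rot_measurable by (simp cong: measurable_cong_sets add: sets_gauss2)
  fix A assume "A \<in> sets (distr ?G ?G (rot \<rho> s))"
  then have A: "A \<in> sets ?G" by simp
  then have [measurable]: "A \<in> sets (borel \<Otimes>\<^sub>M borel)" by (simp add: sets_gauss2)
  have nn: "(\<integral>\<^sup>+z. F z \<partial>?G) = (\<integral>\<^sup>+x. \<integral>\<^sup>+y. ennreal (gauss_density x) * ennreal (gauss_density y) * F (x, y) \<partial>lborel \<partial>lborel)"
    if F[measurable]: "F \<in> borel_measurable (borel \<Otimes>\<^sub>M borel)" for F
  proof -
    have [measurable]: "F \<in> borel_measurable ?G" using F by (simp cong: measurable_cong_sets add: sets_gauss2)
    have "(\<integral>\<^sup>+z. F z \<partial>?G) = (\<integral>\<^sup>+x. \<integral>\<^sup>+y. F (x, y) \<partial>gauss \<partial>gauss)"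
      by (rule gauss.nn_integral_fst[symmetric]) simp
    also have "\<dots> = (\<integral>\<^sup>+x. ennreal (gauss_density x) * (\<integral>\<^sup>+y. ennreal (gauss_density y) * F (x, y) \<partial>lborel) \<partial>lborel)"
      by (subst nn_integral_gauss) (auto simp: nn_integral_gauss)
    also have "\<dots> = (\<integral>\<^sup>+x. \<integral>\<^sup>+y. ennreal (gauss_density x) * ennreal (gauss_density y) * F (x, y) \<partial>lborel \<partial>lborel)"
      by (intro nn_integral_cong, subst nn_integral_cmult[symmetric]) (auto simp: mult.assoc)
    finally show ?thesis .
  qed
  have "emeasure (distr ?G ?G (rot \<rho> s)) A = (\<integral>\<^sup>+z. indicator A (rot \<rho> s z) \<partial>?G)"
    using A by (simp add: nn_integral_distr flip: nn_integral_indicator)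
  also have "\<dots> = (\<integral>\<^sup>+x. \<integral>\<^sup>+y. (\<lambda>(x, y). ennreal (gauss_density x) * ennreal (gauss_density y) * indicator A (x, y)) (rot \<rho> s (x, y)) \<partial>lborel \<partial>lborel)"
  proof -
    have "ennreal (gauss_density x) * ennreal (gauss_density y)
        = ennreal (gauss_density (\<rho> *\<^sub>R x + s *\<^sub>R y)) * ennreal (gauss_density (s *\<^sub>R x - \<rho> *\<^sub>R y))" for x y :: "real ^ 'n"
      using arg_cong[OF gauss_density_rot[OF rs, of x y], of ennreal]
      by (simp only: ennreal_mult'[OF less_imp_le[OF gauss_density_pos]])
    then show ?thesis by (subst nn) (simp_all add: rot_def)
  qed
  also have "\<dots> = (\<integral>\<^sup>+x. \<integral>\<^sup>+y. ennreal (gauss_density x) * ennreal (gauss_density y) * indicator A (x, y) \<partial>lborel \<partial>lborel)"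
    by (subst nn_integral_lborel_rot[OF _ s rs]) auto
  also have "\<dots> = (\<integral>\<^sup>+z. indicator A z \<partial>?G)" by (rule nn[symmetric]) measurable
  also have "\<dots> = emeasure ?G A" using A by simp
  finally show "emeasure (distr ?G ?G (rot \<rho> s)) A = emeasure ?G A" .
qed simp

lemma rot_rot:
  assumes rs: "\<rho>\<^sup>2 + s\<^sup>2 = 1" shows "rot \<rho> s (rot \<rho> s z) = z"
proof (cases z)
  case (Pair x y)
  have "\<rho> *\<^sub>R (\<rho> *\<^sub>R x + s *\<^sub>R y) + s *\<^sub>R (s *\<^sub>R x - \<rho> *\<^sub>R y) = (\<rho>\<^sup>2 + s\<^sup>2) *\<^sub>R x"
       "s *\<^sub>R (\<rho> *\<^sub>R x + s *\<^sub>R y) - \<rho> *\<^sub>R (s *\<^sub>R x - \<rho> *\<^sub>R y) = (\<rho>\<^sup>2 + s\<^sup>2) *\<^sub>R y"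
    by (simp_all add: algebra_simps power2_eq_square)
  then show ?thesis using rs Pair by (simp add: rot_def)
qed

lemma borel_measurable_gauss2:
  "F \<in> borel_measurable (borel \<Otimes>\<^sub>M borel) \<Longrightarrow> F \<in> borel_measurable (gauss \<Otimes>\<^sub>M gauss)"
  by (simp cong: measurable_cong_sets add: sets_gauss2)

lemma gauss2_rot:
  fixes F :: "(real ^ 'n) \<times> (real ^ 'n) \<Rightarrow> real"
  assumes [measurable]: "F \<in> borel_measurable (borel \<Otimes>\<^sub>M borel)" and s: "s > 0" and rs: "\<rho>\<^sup>2 + s\<^sup>2 = 1"
  shows "integrable (gauss \<Otimes>\<^sub>M gauss) (\<lambda>z. F (rot \<rho> s z)) \<longleftrightarrow> integrable (gauss \<Otimes>\<^sub>M gauss) F"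
    and "(\<integral>z. F (rot \<rho> s z) \<partial>(gauss \<Otimes>\<^sub>M gauss)) = (\<integral>z. F z \<partial>(gauss \<Otimes>\<^sub>M gauss))"
proof -
  let ?G = "gauss \<Otimes>\<^sub>M gauss :: ((real ^ 'n) \<times> (real ^ 'n)) measure"
  have rm [measurable]: "rot \<rho> s \<in> measurable ?G ?G"
    using rot_measurable by (simp cong: measurable_cong_sets add: sets_gauss2)
  have Fm [measurable]: "F \<in> borel_measurable ?G" by (rule borel_measurable_gauss2) (rule assms)
  show "integrable ?G (\<lambda>z. F (rot \<rho> s z)) \<longleftrightarrow> integrable ?G F"
    using integrable_distr_eq[OF rm Fm] unfolding distr_rot[OF s rs] by simp
  show "(\<integral>z. F (rot \<rho> s z) \<partial>?G) = (\<integral>z. F z \<partial>?G)"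
    using integral_distr[OF rm Fm] unfolding distr_rot[OF s rs] by simp
qed

lemma gauss2_tensor_L2:
  fixes u v :: "real ^ 'n \<Rightarrow> real"
  assumes u: "u \<in> L2 gauss" and v: "v \<in> L2 gauss"
  shows "(\<lambda>(x, y). u x * v y) \<in> L2 (gauss \<Otimes>\<^sub>M gauss)"
proof (rule L2I)
  have [measurable]: "u \<in> borel_measurable borel" "v \<in> borel_measurable borel"
    using L2_measurable[OF u] L2_measurable[OF v] by auto
  show "(\<lambda>(x, y). u x * v y) \<in> borel_measurable (gauss \<Otimes>\<^sub>M gauss)"
    by (rule borel_measurable_gauss2) measurable
  show "integrable (gauss \<Otimes>\<^sub>M gauss) (\<lambda>z. (case z of (x, y) \<Rightarrow> u x * v y)\<^sup>2)"
  proof (rule gauss2.Fubini_integrable)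
    show "(\<lambda>z. (case z of (x, y) \<Rightarrow> u x * v y)\<^sup>2) \<in> borel_measurable (gauss \<Otimes>\<^sub>M gauss)"
      by (rule borel_measurable_gauss2) measurable
  qed (simp_all add: power_mult_distrib L2_integrable_sq[OF u] L2_integrable_sq[OF v])
qed

lemma gauss2_mix_L2:
  fixes u :: "real ^ 'n \<Rightarrow> real"
  assumes u: "u \<in> L2 gauss" and s: "s > 0" and rs: "\<rho>\<^sup>2 + s\<^sup>2 = 1"
  shows "(\<lambda>(x, y). u (\<rho> *\<^sub>R x + s *\<^sub>R y)) \<in> L2 (gauss \<Otimes>\<^sub>M gauss)"
    and "AE x in gauss. (\<lambda>y. u (\<rho> *\<^sub>R x + s *\<^sub>R y)) \<in> L2 gauss"
    and "integrable gauss (\<lambda>x. \<integral>y. (u (\<rho> *\<^sub>R x + s *\<^sub>R y))\<^sup>2 \<partial>gauss)"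
proof -
  have [measurable]: "u \<in> borel_measurable borel" using L2_measurable[OF u] by auto
  have m: "(\<lambda>(x, y). u (\<rho> *\<^sub>R x + s *\<^sub>R y)) \<in> borel_measurable (borel \<Otimes>\<^sub>M borel)"
    by measurable
  have "(\<lambda>_. 1 :: real) \<in> L2 (gauss :: (real ^ 'n) measure)" by (simp add: L2_def)
  from L2_integrable_sq[OF gauss2_tensor_L2[OF u this]] have "integrable (gauss \<Otimes>\<^sub>M gauss) (\<lambda>z :: (real ^ 'n) \<times> (real ^ 'n). (u (fst z))\<^sup>2)"
    by (simp add: case_prod_beta)
  then have i: "integrable (gauss \<Otimes>\<^sub>M gauss) (\<lambda>z. (u (fst (rot \<rho> s z)))\<^sup>2)"
    by (subst gauss2_rot(1)[OF _ s rs]) measurable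
  then show L2: "(\<lambda>(x, y). u (\<rho> *\<^sub>R x + s *\<^sub>R y)) \<in> L2 (gauss \<Otimes>\<^sub>M gauss)"
    using borel_measurable_gauss2[OF m] by (simp add: L2_def rot_def case_prod_beta)
  show "integrable gauss (\<lambda>x. \<integral>y. (u (\<rho> *\<^sub>R x + s *\<^sub>R y))\<^sup>2 \<partial>gauss)"
    using gauss2.integrable_fst'[OF i] by (simp add: rot_def)
  show "AE x in gauss. (\<lambda>y. u (\<rho> *\<^sub>R x + s *\<^sub>R y)) \<in> L2 gauss"
    using gauss2.AE_integrable_fst'[OF i] by eventually_elim (auto simp: rot_def L2_def)
qed

text \<open>For \<open>\<kappa> = 0\<close> this is the Ornstein-Uhlenbeck operator. For general \<open>\<kappa>\<close> it is the Hermite coefficient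
  at \<open>\<kappa>\<close> of \<open>u (\<rho> x + s Y)\<close> as a function of \<open>Y\<close>.\<close>

definition mehler :: "real \<Rightarrow> real \<Rightarrow> ('n \<Rightarrow> nat) \<Rightarrow> (real ^ 'n \<Rightarrow> real) \<Rightarrow> real ^ 'n \<Rightarrow> real" where
  "mehler \<rho> s \<kappa> u x = (\<integral>y. u (\<rho> *\<^sub>R x + s *\<^sub>R y) * hermite \<kappa> y \<partial>gauss)"

lemma mehler_L2:
  fixes u :: "real ^ 'n \<Rightarrow> real"
  assumes u: "u \<in> L2 gauss" and s: "s > 0" and rs: "\<rho>\<^sup>2 + s\<^sup>2 = 1"
  shows "mehler \<rho> s \<kappa> u \<in> L2 gauss"
proof (rule L2I)
  have [measurable]: "u \<in> borel_measurable borel" using L2_measurable[OF u] by auto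
  show m [measurable]: "mehler \<rho> s \<kappa> u \<in> borel_measurable gauss"
    unfolding mehler_def[abs_def] by measurable
  show "integrable gauss (\<lambda>x. (mehler \<rho> s \<kappa> u x)\<^sup>2)"
  proof (rule Bochner_Integration.integrable_bound[OF gauss2_mix_L2(3)[OF u s rs]])
    show "AE x in gauss. norm ((mehler \<rho> s \<kappa> u x)\<^sup>2) \<le> norm (\<integral>y. (u (\<rho> *\<^sub>R x + s *\<^sub>R y))\<^sup>2 \<partial>gauss)"
      using gauss2_mix_L2(2)[OF u s rs]
    proof eventually_elim
      case (elim x)
      have "(mehler \<rho> s \<kappa> u x)\<^sup>2 \<le> (\<integral>y. (u (\<rho> *\<^sub>R x + s *\<^sub>R y))\<^sup>2 \<partial>gauss) * (\<integral>y. (hermite \<kappa> y)\<^sup>2 \<partial>gauss)"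
        unfolding mehler_def by (rule L2_cauchy_schwarz[OF elim hermite_L2])
      then show ?case by (simp add: power2_eq_square[of "hermite _ _"] hermite_orthonormal)
    qed
  qed simp
qed

definition mbinom :: "('n::finite \<Rightarrow> nat) \<Rightarrow> ('n \<Rightarrow> nat) \<Rightarrow> real" where
  "mbinom \<alpha> \<kappa> = (\<Prod>i\<in>UNIV. real (\<alpha> i choose \<kappa> i))"

lemma mbinom_nonneg: "mbinom \<alpha> \<kappa> \<ge> 0"
  by (simp add: mbinom_def prod_nonneg)

lemma sqrt_prod: "sqrt (\<Prod>i\<in>A. f i) = (\<Prod>i\<in>A. sqrt (f i))"
  by (induction A rule: infinite_finite_induct) (simp_all add: real_sqrt_mult)

lemma sqrt_fact_choose:
  "sqrt (fact (b + k)) = sqrt (real ((b + k) choose k)) * (sqrt (fact b) * sqrt (fact k))"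
proof -
  have "fact (b + k) = real ((b + k) choose k) * (fact b * fact k)"
    using binomial_fact[of k "b + k", where 'a=real] by (simp add: field_simps)
  then show ?thesis by (simp add: real_sqrt_mult)
qed

text \<open>The one-dimensional identity in every coordinate, with the normalizing factors collected into
  binomial coefficients.\<close>

lemma integral_hermite_rotate:
  fixes z :: "real ^ 'n"
  assumes rs: "\<rho>\<^sup>2 + s\<^sup>2 = 1"
  shows "(\<integral>w. hermite \<kappa> (s *\<^sub>R z - \<rho> *\<^sub>R w) * hermite \<beta> (\<rho> *\<^sub>R z + s *\<^sub>R w) \<partial>gauss)
     = s ^ multi_order \<kappa> * \<rho> ^ multi_order \<beta> * sqrt (mbinom (\<lambda>i. \<beta> i + \<kappa> i) \<kappa>) * hermite (\<lambda>i. \<beta> i + \<kappa> i) z"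
proof -
  have eb: "exp_bounded (\<lambda>w. he k (s * c - \<rho> * w) * he b (\<rho> * c + s * w))" for k b c
  proof -
    have 1: "(\<lambda>w. he k (s * c - \<rho> * w)) = poly (smult (1 / sqrt (fact k)) (pcompose (He k) [:s * c, - \<rho>:]))"
         "(\<lambda>w. he b (\<rho> * c + s * w)) = poly (smult (1 / sqrt (fact b)) (pcompose (He b) [:\<rho> * c, s:]))"
      by (auto simp: he_def fun_eq_iff poly_pcompose mult.commute)
    show ?thesis by (rule exp_bounded_mult; unfold 1; rule exp_bounded_poly)
  qed
  have "(\<integral>w. hermite \<kappa> (s *\<^sub>R z - \<rho> *\<^sub>R w) * hermite \<beta> (\<rho> *\<^sub>R z + s *\<^sub>R w) \<partial>gauss)
     = (\<Prod>i\<in>UNIV. \<integral>w. he (\<kappa> i) (s * z $ i - \<rho> * w) * he (\<beta> i) (\<rho> * z $ i + s * w) \<partial>gauss1)"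
    unfolding hermite_def prod.distrib[symmetric]
    using gauss_prod(2)[of "\<lambda>i w. he (\<kappa> i) (s * z $ i - \<rho> * w) * he (\<beta> i) (\<rho> * z $ i + s * w)", OF exp_bounded_integrable[OF eb]]
    by simp
  also have "\<dots> = (\<Prod>i\<in>UNIV. s ^ \<kappa> i * \<rho> ^ \<beta> i * sqrt (real ((\<beta> i + \<kappa> i) choose \<kappa> i)) * he (\<beta> i + \<kappa> i) (z $ i))"
  proof (rule prod.cong[OF refl])
    fix i
    have "(\<integral>w. he (\<kappa> i) (s * z $ i - \<rho> * w) * he (\<beta> i) (\<rho> * z $ i + s * w) \<partial>gauss1)
      = (\<integral>w. (1 / (sqrt (fact (\<kappa> i)) * sqrt (fact (\<beta> i)))) * (poly (He (\<kappa> i)) (s * z $ i - \<rho> * w) * poly (He (\<beta> i)) (\<rho> * z $ i + s * w)) \<partial>gauss1)"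
      by (simp add: he_def)
    also have "\<dots> = (1 / (sqrt (fact (\<kappa> i)) * sqrt (fact (\<beta> i)))) * (s ^ \<kappa> i * \<rho> ^ \<beta> i * poly (He (\<kappa> i + \<beta> i)) (z $ i))"
      unfolding integral_mult_right_zero integral_He_rotate[OF rs] ..
    also have "\<dots> = s ^ \<kappa> i * \<rho> ^ \<beta> i * sqrt (real ((\<beta> i + \<kappa> i) choose \<kappa> i)) * he (\<beta> i + \<kappa> i) (z $ i)"
      unfolding he_def sqrt_fact_choose by (simp add: add.commute field_simps)
    finally show "(\<integral>w. he (\<kappa> i) (s * z $ i - \<rho> * w) * he (\<beta> i) (\<rho> * z $ i + s * w) \<partial>gauss1)
      = s ^ \<kappa> i * \<rho> ^ \<beta> i * sqrt (real ((\<beta> i + \<kappa> i) choose \<kappa> i)) * he (\<beta> i + \<kappa> i) (z $ i)" .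
  qed
  also have "\<dots> = s ^ multi_order \<kappa> * \<rho> ^ multi_order \<beta> * sqrt (mbinom (\<lambda>i. \<beta> i + \<kappa> i) \<kappa>) * hermite (\<lambda>i. \<beta> i + \<kappa> i) z"
    by (simp add: prod.distrib power_sum mbinom_def hermite_def sqrt_prod)
  finally show ?thesis .
qed

text \<open>After the rotation the function \<open>u\<close> depends on the first variable only, and the second one can be
  integrated out of the Hermite polynomials. For \<open>\<kappa> = 0\<close> this diagonalizes the Ornstein-Uhlenbeck
  operator. In general it says that \<open>mehler \<rho> s \<kappa> u\<close> is \<open>s ^ multi_order \<kappa>\<close> times the Ornstein-Uhlenbeck
  operator applied to \<open>D\<^sup>\<kappa> u\<close>, without mentioning a derivative.\<close>

lemma coef_mehler:
  fixes u :: "real ^ 'n \<Rightarrow> real"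
  assumes u: "u \<in> L2 gauss" and s: "s > 0" and rs: "\<rho>\<^sup>2 + s\<^sup>2 = 1"
  shows "coef (mehler \<rho> s \<kappa> u) \<beta>
    = s ^ multi_order \<kappa> * \<rho> ^ multi_order \<beta> * sqrt (mbinom (\<lambda>i. \<beta> i + \<kappa> i) \<kappa>) * coef u (\<lambda>i. \<beta> i + \<kappa> i)"
proof -
  have [measurable]: "u \<in> borel_measurable borel" using L2_measurable[OF u] by auto
  define F where "F = (\<lambda>(x, y). u (\<rho> *\<^sub>R x + s *\<^sub>R y) * (hermite \<beta> x * hermite \<kappa> y))"
  define H where "H = (\<lambda>(z, w). u z * (hermite \<kappa> (s *\<^sub>R z - \<rho> *\<^sub>R w) * hermite \<beta> (\<rho> *\<^sub>R z + s *\<^sub>R w)))"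
  have Hm: "H \<in> borel_measurable (borel \<Otimes>\<^sub>M borel)" unfolding H_def by measurable
  have FH: "F z = H (rot \<rho> s z)" for z
  proof (cases z)
    case (Pair x y)
    have "s *\<^sub>R (\<rho> *\<^sub>R x + s *\<^sub>R y) - \<rho> *\<^sub>R (s *\<^sub>R x - \<rho> *\<^sub>R y) = y"
         "\<rho> *\<^sub>R (\<rho> *\<^sub>R x + s *\<^sub>R y) + s *\<^sub>R (s *\<^sub>R x - \<rho> *\<^sub>R y) = x"
      using rot_rot[OF rs, of "(x, y)"] by (simp_all add: rot_def)
    then show ?thesis by (simp add: Pair F_def H_def rot_def mult_ac)
  qed
  have "integrable (gauss \<Otimes>\<^sub>M gauss) (\<lambda>z. (case z of (x, y) \<Rightarrow> u (\<rho> *\<^sub>R x + s *\<^sub>R y)) * (case z of (x, y) \<Rightarrow> hermite \<beta> x * hermite \<kappa> y))"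
    by (intro L2_integrable_mult gauss2_mix_L2 gauss2_tensor_L2 hermite_L2 assms)
  then have iF: "integrable (gauss \<Otimes>\<^sub>M gauss) F" by (simp add: F_def case_prod_unfold)
  then have iH: "integrable (gauss \<Otimes>\<^sub>M gauss) H"
    using gauss2_rot(1)[OF Hm s rs] by (simp add: FH[abs_def])
  have "coef (mehler \<rho> s \<kappa> u) \<beta> = (\<integral>x. \<integral>y. F (x, y) \<partial>gauss \<partial>gauss)"
    unfolding coef_def mehler_def F_def by (simp add: mult_ac flip: integral_mult_left_zero)
  also have "\<dots> = (\<integral>z. F z \<partial>(gauss \<Otimes>\<^sub>M gauss))" by (rule gauss2.integral_fst'[OF iF])
  also have "\<dots> = (\<integral>z. H z \<partial>(gauss \<Otimes>\<^sub>M gauss))" unfolding FH by (rule gauss2_rot(2)[OF Hm s rs])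
  also have "\<dots> = (\<integral>z. \<integral>w. H (z, w) \<partial>gauss \<partial>gauss)" by (rule gauss2.integral_fst'[OF iH, symmetric])
  also have "\<dots> = (\<integral>z. (s ^ multi_order \<kappa> * \<rho> ^ multi_order \<beta> * sqrt (mbinom (\<lambda>i. \<beta> i + \<kappa> i) \<kappa>)) * (u z * hermite (\<lambda>i. \<beta> i + \<kappa> i) z) \<partial>gauss)"
    unfolding H_def prod.case integral_mult_right_zero integral_hermite_rotate[OF rs]
    unfolding integral_mult_right_zero[symmetric]
    by (rule Bochner_Integration.integral_cong) (simp_all only: mult_ac)
  finally show ?thesis by (simp add: coef_def)
qed

section \<open>Hermite coefficients of derivatives and the high-degree part\<close>

text \<open>Vandermonde's identity with several summands; splitting off the coordinate \<open>j\<close> reduces it to the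
  identity with two.\<close>

lemma sum_prod_choose:
  fixes \<alpha> :: "'n::finite \<Rightarrow> nat"
  assumes "finite I"
  shows "(\<Sum>\<kappa> | (\<forall>i. i \<notin> I \<longrightarrow> \<kappa> i = 0) \<and> (\<Sum>i\<in>I. \<kappa> i) = k. \<Prod>i\<in>I. (\<alpha> i choose \<kappa> i)) = ((\<Sum>i\<in>I. \<alpha> i) choose k)"
  using assms
proof (induction I arbitrary: k)
  case empty
  have "{\<kappa> :: 'n \<Rightarrow> nat. (\<forall>i. \<kappa> i = 0) \<and> 0 = k} = (if k = 0 then {\<lambda>_. 0} else {})" by auto
  then show ?case by (auto simp: binomial_eq_0)
next
  case (insert j I)
  define K where "K I k = {\<kappa> :: 'n \<Rightarrow> nat. (\<forall>i. i \<notin> I \<longrightarrow> \<kappa> i = 0) \<and> (\<Sum>i\<in>I. \<kappa> i) = k}" for I k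
  have fin: "finite (K I k)" for k
  proof (rule finite_subset[OF _ finite_multi_order_le[of k]])
    have "multi_order \<kappa> = (\<Sum>i\<in>I. \<kappa> i)" if "\<forall>i. i \<notin> I \<longrightarrow> \<kappa> i = 0" for \<kappa> :: "'n \<Rightarrow> nat"
      using that by (intro sum.mono_neutral_right) auto
    then show "K I k \<subseteq> {\<alpha>. multi_order \<alpha> \<le> k}" by (auto simp: K_def)
  qed
  have upd: "(\<Sum>i\<in>I. (\<kappa>(j := m)) i) = (\<Sum>i\<in>I. \<kappa> i)" for \<kappa> :: "'n \<Rightarrow> nat" and m
    using insert.hyps by (intro sum.cong) auto
  have "(\<Sum>\<kappa>\<in>K (insert j I) k. \<Prod>i\<in>insert j I. (\<alpha> i choose \<kappa> i))
      = (\<Sum>(m, \<kappa>)\<in>(SIGMA m:{..k}. K I (k - m)). (\<alpha> j choose m) * (\<Prod>i\<in>I. (\<alpha> i choose \<kappa> i)))"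
  proof (rule sum.reindex_bij_witness[where i="\<lambda>(m, \<kappa>). \<kappa>(j := m)" and j="\<lambda>\<kappa>. (\<kappa> j, \<kappa>(j := 0))"])
    fix \<kappa> assume \<kappa>: "\<kappa> \<in> K (insert j I) k"
    show "(\<kappa> j, \<kappa>(j := 0)) \<in> (SIGMA m:{..k}. K I (k - m))"
      using \<kappa> insert.hyps upd[of \<kappa> 0] by (auto simp: K_def)
    have "(\<Prod>i\<in>I. (\<alpha> i choose (\<kappa>(j := 0)) i)) = (\<Prod>i\<in>I. (\<alpha> i choose \<kappa> i))"
      using insert.hyps by (intro prod.cong) auto
    then show "(case (\<kappa> j, \<kappa>(j := 0)) of (m, \<kappa>) \<Rightarrow> (\<alpha> j choose m) * (\<Prod>i\<in>I. (\<alpha> i choose \<kappa> i))) = (\<Prod>i\<in>insert j I. (\<alpha> i choose \<kappa> i))"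
      using insert.hyps by simp
  next
    fix z assume z: "z \<in> (SIGMA m:{..k}. K I (k - m))"
    then obtain m \<kappa> where zz: "z = (m, \<kappa>)" "m \<le> k" "\<kappa> \<in> K I (k - m)" by auto
    then show "(case z of (m, \<kappa>) \<Rightarrow> \<kappa>(j := m)) \<in> K (insert j I) k"
      using insert.hyps upd[of \<kappa> m] by (auto simp: K_def)
    show "((case z of (m, \<kappa>) \<Rightarrow> \<kappa>(j := m)) j, (case z of (m, \<kappa>) \<Rightarrow> \<kappa>(j := m))(j := 0)) = z"
      using zz insert.hyps by (auto simp: K_def fun_eq_iff)
  qed auto
  also have "\<dots> = (\<Sum>m\<le>k. \<Sum>\<kappa>\<in>K I (k - m). (\<alpha> j choose m) * (\<Prod>i\<in>I. (\<alpha> i choose \<kappa> i)))"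
    by (rule sum.Sigma[symmetric]) (use fin in auto)
  also have "\<dots> = (\<Sum>m\<le>k. (\<alpha> j choose m) * ((\<Sum>i\<in>I. \<alpha> i) choose (k - m)))"
    using insert.IH by (simp add: sum_distrib_left[symmetric] K_def)
  also have "\<dots> = ((\<Sum>i\<in>insert j I. \<alpha> i) choose k)"
    using insert.hyps by (simp add: vandermonde)
  finally show ?case by (simp add: K_def)
qed

lemma sum_mbinom:
  "(\<Sum>\<kappa> | multi_order \<kappa> = k. mbinom \<alpha> \<kappa>) = real (multi_order \<alpha> choose k)" for \<alpha> :: "'n::finite \<Rightarrow> nat"
  using arg_cong[OF sum_prod_choose[of UNIV \<alpha> k], of real]
  by (simp add: mbinom_def)

lemma mbinom_eq_0: "\<not> (\<forall>i. \<kappa> i \<le> \<alpha> i) \<Longrightarrow> mbinom \<alpha> \<kappa> = 0"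
  by (auto simp: mbinom_def not_le intro!: prod_zero exI)

text \<open>By \<open>sum_mbinom\<close> the weights \<open>mbinom \<alpha> \<kappa>\<close> do not all vanish.\<close>

lemma sub_multi_index:
  fixes \<alpha> :: "'n::finite \<Rightarrow> nat"
  assumes "k \<le> multi_order \<alpha>"
  obtains \<kappa> where "multi_order \<kappa> = k" "\<And>i. \<kappa> i \<le> \<alpha> i"
proof -
  have "(\<Sum>\<kappa> | multi_order \<kappa> = k. mbinom \<alpha> \<kappa>) \<noteq> 0"
    unfolding sum_mbinom using assms by simp
  then obtain \<kappa> where "multi_order \<kappa> = k" "mbinom \<alpha> \<kappa> \<noteq> 0"
    using sum.not_neutral_contains_not_neutral by blast
  then show ?thesis using that mbinom_eq_0 by metis
qed

lemma mbinom_pos: "(\<And>i. \<kappa> i \<le> \<alpha> i) \<Longrightarrow> mbinom \<alpha> \<kappa> > 0"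
  by (auto simp: mbinom_def intro!: prod_pos)

lemma hermite_eq: "hermite \<alpha> x = (\<Prod>i\<in>UNIV. 1 / sqrt (fact (\<alpha> i))) * (\<Prod>i\<in>UNIV. poly (He (\<alpha> i)) (x $ i))"
  by (simp add: hermite_def he_def prod.distrib[symmetric])

lemma gauss_sobolevD:
  assumes "f \<in> gauss_sobolev k"
  shows "f \<in> L2 gauss" "multi_order \<kappa> \<le> k \<Longrightarrow> weak_D \<kappa> f \<in> L2 gauss" "multi_order \<kappa> \<le> k \<Longrightarrow> \<exists>g. weak_partial \<kappa> f g"
  using assms by (auto simp: gauss_sobolev_def gauss_L2_eq)

text \<open>In terms of Hermite polynomials: \<open>D\<^sup>\<kappa> h\<^sub>\<alpha> = sqrt (binom (\<alpha>, \<kappa>)) h\<^bsub>\<alpha> - \<kappa>\<^esub>\<close>.\<close>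

lemma coef_weak_D:
  fixes f :: "real ^ 'n \<Rightarrow> real"
  assumes f: "f \<in> gauss_sobolev k" and \<kappa>: "multi_order \<kappa> \<le> k"
  shows "coef (weak_D \<kappa> f) \<beta> = sqrt (mbinom (\<lambda>i. \<beta> i + \<kappa> i) \<kappa>) * coef f (\<lambda>i. \<beta> i + \<kappa> i)"
proof -
  define c where "c \<alpha> = (\<Prod>i\<in>UNIV. 1 / sqrt (fact (\<alpha> i)))" for \<alpha> :: "'n \<Rightarrow> nat"
  have c: "c \<alpha> > 0" for \<alpha> unfolding c_def by (intro prod_pos) simp
  note fD = gauss_sobolevD[OF f]
  define g where "g = (SOME g. weak_partial \<kappa> f g)"
  obtain g' where "weak_partial \<kappa> f g'" using fD(3)[OF \<kappa>] by blast
  then have g: "weak_partial \<kappa> f g" unfolding g_def by (rule someI[of "weak_partial \<kappa> f"])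
  have Dg: "weak_D \<kappa> f = (\<lambda>x. c \<kappa> * g x)" by (auto simp: weak_D_def g_def c_def fun_eq_iff)
  have gg: "g = (\<lambda>x. (1 / c \<kappa>) * weak_D \<kappa> f x)" unfolding Dg using c[of \<kappa>] by (simp add: fun_eq_iff)
  have g2: "g \<in> L2 gauss" unfolding gg by (rule L2_cmult[OF fD(2)[OF \<kappa>]])
  have "coef (weak_D \<kappa> f) \<beta> = c \<kappa> * c \<beta> * (\<integral>x. g x * (\<Prod>i\<in>UNIV. poly (He (\<beta> i)) (x $ i)) \<partial>gauss)"
    unfolding Dg coef_cmult coef_def hermite_eq c_def[symmetric] by (simp add: mult.left_commute)
  also have "(\<integral>x. g x * (\<Prod>i\<in>UNIV. poly (He (\<beta> i)) (x $ i)) \<partial>gauss) = (\<integral>x. f x * (\<Prod>i\<in>UNIV. poly (He (\<beta> i + \<kappa> i)) (x $ i)) \<partial>gauss)"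
    by (rule integral_He_weak_partial[OF fD(1) g2 g, symmetric])
  also have "c \<kappa> * c \<beta> = sqrt (mbinom (\<lambda>i. \<beta> i + \<kappa> i) \<kappa>) * c (\<lambda>i. \<beta> i + \<kappa> i)"
    unfolding c_def mbinom_def sqrt_prod prod.distrib[symmetric]
    by (rule prod.cong) (simp_all add: sqrt_fact_choose)
  also have "sqrt (mbinom (\<lambda>i. \<beta> i + \<kappa> i) \<kappa>) * c (\<lambda>i. \<beta> i + \<kappa> i) * (\<integral>x. f x * (\<Prod>i\<in>UNIV. poly (He (\<beta> i + \<kappa> i)) (x $ i)) \<partial>gauss)
     = sqrt (mbinom (\<lambda>i. \<beta> i + \<kappa> i) \<kappa>) * coef f (\<lambda>i. \<beta> i + \<kappa> i)"
    unfolding coef_def hermite_eq c_def[symmetric] mult.left_commute[of "f _" "c _"] integral_mult_right_zero by simp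
  finally show ?thesis .
qed

lemma pderiv_funpow_eq_0: "degree p < n \<Longrightarrow> (pderiv ^^ n) p = (0 :: real poly)"
proof (induction n arbitrary: p)
  case (Suc n)
  have z: "(pderiv ^^ n) (0 :: real poly) = 0" by (induction n) simp_all
  show ?case
  proof (cases "degree p = 0")
    case True
    then have "pderiv p = 0" by (simp add: pderiv_eq_0_iff)
    then show ?thesis using z by (simp add: funpow_Suc_right del: funpow.simps)
  next
    case False
    then have "degree (pderiv p) < n" using Suc.prems by (simp add: degree_pderiv)
    then show ?thesis using Suc.IH by (simp add: funpow_Suc_right del: funpow.simps)
  qed
qed simp

lemma hermite_sum_weak_partial:
  fixes f :: "real ^ 'n \<Rightarrow> real"
  assumes A: "finite A"
  obtains r where "weak_partial \<kappa> (hermite_sum A f) r" "r \<in> L2 gauss"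
    "(\<And>\<alpha>. \<alpha> \<in> A \<Longrightarrow> multi_order \<alpha> < multi_order \<kappa>) \<Longrightarrow> r = (\<lambda>x. 0)"
proof -
  define P where "P \<alpha> i m = poly ((pderiv ^^ m) (He (\<alpha> i)))" for \<alpha> and i :: 'n and m
  have P: "derivs (P \<alpha> i)" for \<alpha> i unfolding P_def by (rule derivs_poly)
  define c where "c \<alpha> = coef f \<alpha> * (\<Prod>i\<in>UNIV. 1 / sqrt (fact (\<alpha> i)))" for \<alpha>
  have h: "hermite_sum A f = (\<lambda>x. \<Sum>\<alpha>\<in>A. c \<alpha> * prodfun (P \<alpha>) (\<lambda>_. 0) x)"
    unfolding hermite_sum_def[abs_def] hermite_eq c_def prodfun_def P_def by (simp add: mult.assoc)
  define r where "r x = (\<Sum>\<alpha>\<in>A. c \<alpha> * prodfun (P \<alpha>) (\<lambda>i. 0 + \<kappa> i) x)" for x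
  show ?thesis
  proof (rule that[of r])
    show "weak_partial \<kappa> (hermite_sum A f) r"
      unfolding h r_def[abs_def] by (rule weak_partial_sum[OF A weak_partial_prodfun[OF P]])
    show "r \<in> L2 gauss"
      unfolding r_def[abs_def] prodfun_def P_def by (intro L2_sum L2_cmult prod_exp_bounded_L2 exp_bounded_poly)
    assume small: "\<And>\<alpha>. \<alpha> \<in> A \<Longrightarrow> multi_order \<alpha> < multi_order \<kappa>"
    show "r = (\<lambda>x. 0)"
    proof
      fix x
      show "r x = 0"
        unfolding r_def
      proof (rule sum.neutral, rule ballI)
        fix \<alpha> assume "\<alpha> \<in> A"
        then have "\<not> (\<forall>i. \<kappa> i \<le> \<alpha> i)" using small[of \<alpha>] sum_mono[of UNIV \<kappa> \<alpha>] by force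
        then obtain i where "\<alpha> i < \<kappa> i" by (auto simp: not_le)
        then have "P \<alpha> i (0 + \<kappa> i) y = 0" for y unfolding P_def by (simp add: pderiv_funpow_eq_0)
        then show "c \<alpha> * prodfun (P \<alpha>) (\<lambda>i. 0 + \<kappa> i) x = 0"
          unfolding prodfun_def by (auto intro!: prod_zero)
      qed
    qed
  qed
qed

lemma hermite_sum_in_null_space:
  fixes f :: "real ^ 'n \<Rightarrow> real"
  shows "hermite_sum {\<alpha>. multi_order \<alpha> < k} f \<in> grad_null_space k"
proof -
  let ?q = "hermite_sum {\<alpha>. multi_order \<alpha> < k} f"
  have "(\<exists>g. weak_partial \<kappa> ?q g) \<and> weak_D \<kappa> ?q \<in> L2 gauss" for \<kappa>
    by (rule hermite_sum_weak_partial[OF finite_multi_order_less, of \<kappa> k f]) (auto intro: weak_D_L2)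
  then have "?q \<in> gauss_sobolev k" by (simp add: gauss_sobolev_def gauss_L2_eq hermite_sum_L2)
  moreover have "AE x in gauss. weak_D \<kappa> ?q x = 0" if \<kappa>: "multi_order \<kappa> = k" for \<kappa>
  proof (rule hermite_sum_weak_partial[OF finite_multi_order_less, of \<kappa> k f])
    fix r assume "weak_partial \<kappa> ?q r" and r: "(\<And>\<alpha>. \<alpha> \<in> {\<alpha>. multi_order \<alpha> < k} \<Longrightarrow> multi_order \<alpha> < multi_order \<kappa>) \<Longrightarrow> r = (\<lambda>x. 0)"
    from weak_D_eq[OF this(1)] r \<kappa> show ?thesis unfolding AE_gauss_iff by simp
  qed
  ultimately show ?thesis by (simp add: grad_null_space_def)
qed

text \<open>Every \<open>\<alpha>\<close> of order at least \<open>k\<close> dominates some \<open>\<kappa>\<close> of order \<open>k\<close>, and the coefficient at \<open>\<alpha>\<close> is a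
  positive multiple of a coefficient of \<open>D\<^sup>\<kappa> g = 0\<close>.\<close>

lemma null_space_eq_hermite_sum:
  fixes g :: "real ^ 'n \<Rightarrow> real"
  assumes g: "g \<in> grad_null_space k"
  shows "AE x in gauss. g x = hermite_sum {\<alpha>. multi_order \<alpha> < k} g x"
proof -
  have gs: "g \<in> gauss_sobolev k" and 0: "\<And>\<kappa>. multi_order \<kappa> = k \<Longrightarrow> AE x in gauss. weak_D \<kappa> g x = 0"
    using g by (auto simp: grad_null_space_def)
  note gD = gauss_sobolevD[OF gs]
  have high: "coef g \<alpha> = 0" if \<alpha>: "\<not> multi_order \<alpha> < k" for \<alpha>
  proof -
    obtain \<kappa> where \<kappa>: "multi_order \<kappa> = k" "\<And>i. \<kappa> i \<le> \<alpha> i" using sub_multi_index[of k \<alpha>] \<alpha> by auto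
    have "coef (weak_D \<kappa> g) (\<lambda>i. \<alpha> i - \<kappa> i) = coef (\<lambda>x. 0) (\<lambda>i. \<alpha> i - \<kappa> i)"
      using 0[OF \<kappa>(1)] L2_measurable[OF gD(2)[of \<kappa>]] \<kappa> by (intro coef_cong_AE) auto
    then have "sqrt (mbinom \<alpha> \<kappa>) * coef g \<alpha> = 0"
      using coef_weak_D[OF gs, of \<kappa> "\<lambda>i. \<alpha> i - \<kappa> i"] \<kappa> by (simp add: coef_def)
    then show ?thesis using mbinom_pos[of \<kappa> \<alpha>] \<kappa>(2) by simp
  qed
  have "AE x in gauss. g x - hermite_sum {\<alpha>. multi_order \<alpha> < k} g x = 0"
  proof (rule hermite_complete)
    show "(\<lambda>x. g x - hermite_sum {\<alpha>. multi_order \<alpha> < k} g x) \<in> L2 gauss"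
      by (intro L2_diff gD hermite_sum_L2)
    fix \<alpha>
    show "coef (\<lambda>x. g x - hermite_sum {\<alpha>. multi_order \<alpha> < k} g x) \<alpha> = 0"
      using high[of \<alpha>] by (simp add: coef_diff gD hermite_sum_L2 coef_hermite_sum finite_multi_order_less)
  qed
  then show ?thesis by eventually_elim simp
qed

text \<open>The choice in the definition of \<open>high_part\<close> has a witness, \<open>f\<close> minus its Hermite sum of degree
  less than \<open>k\<close>, and any admissible choice has the coefficients of this witness.\<close>

lemma coef_high_part:
  fixes f :: "real ^ 'n \<Rightarrow> real"
  assumes f: "f \<in> L2 gauss"
  shows "high_part k f \<in> L2 gauss"
    and "coef (high_part k f) \<alpha> = (if multi_order \<alpha> < k then 0 else coef f \<alpha>)"
proof -
  let ?A = "{\<alpha> :: 'n \<Rightarrow> nat. multi_order \<alpha> < k}"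
  let ?P = "\<lambda>h. h \<in> gauss_L2 \<and> (\<lambda>x. f x - h x) \<in> grad_null_space k \<and> (\<forall>g\<in>grad_null_space k. gauss_inner h g = 0)"
  let ?h = "\<lambda>x. f x - hermite_sum ?A f x"
  have hL: "?h \<in> L2 gauss" by (intro L2_diff f hermite_sum_L2)
  have "?P ?h"
  proof (intro conjI ballI)
    show "?h \<in> gauss_L2" using hL by (simp add: gauss_L2_eq)
    show "(\<lambda>x. f x - (f x - hermite_sum ?A f x)) \<in> grad_null_space k"
      using hermite_sum_in_null_space[of k f] by simp
    fix g :: "real ^ 'n \<Rightarrow> real" assume g: "g \<in> grad_null_space k"
    then have gL: "g \<in> L2 gauss" by (auto simp: grad_null_space_def intro: gauss_sobolevD)
    have "gauss_inner ?h g = (\<integral>x. hermite_sum ?A g x * ?h x \<partial>gauss)"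
      unfolding gauss_inner_def
      using null_space_eq_hermite_sum[OF g] L2_measurable[OF gL] L2_measurable[OF hL] L2_measurable[OF hermite_sum_L2[of ?A g]]
      by (intro integral_cong_AE) (auto elim!: eventually_mono simp: mult.commute)
    also have "\<dots> = 0"
      unfolding inner_hermite_sum[OF hL]
      by (intro sum.neutral) (simp add: coef_diff f hermite_sum_L2 coef_hermite_sum finite_multi_order_less)
    finally show "gauss_inner ?h g = 0" .
  qed
  then have P: "?P (high_part k f)" unfolding high_part_def by (rule someI[of ?P])
  then show hp: "high_part k f \<in> L2 gauss" by (simp add: gauss_L2_eq)
  define q where "q x = f x - high_part k f x" for x
  have qn: "q \<in> grad_null_space k" using P unfolding q_def[abs_def] by simp
  have qL: "q \<in> L2 gauss" unfolding q_def[abs_def] by (intro L2_diff f hp)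
  show "coef (high_part k f) \<alpha> = (if multi_order \<alpha> < k then 0 else coef f \<alpha>)"
  proof (cases "multi_order \<alpha> < k")
    case True
    have e: "hermite_sum ?A (hermite \<alpha>) = hermite \<alpha>"
    proof
      fix x
      have "hermite_sum ?A (hermite \<alpha>) x = (\<Sum>\<beta>\<in>?A. if \<alpha> = \<beta> then hermite \<beta> x else 0)"
        unfolding hermite_sum_def coef_hermite by (intro sum.cong) auto
      then show "hermite_sum ?A (hermite \<alpha>) x = hermite \<alpha> x"
        using True by (simp add: finite_multi_order_less)
    qed
    have "gauss_inner (high_part k f) (hermite \<alpha>) = 0"
      using P hermite_sum_in_null_space[of k "hermite \<alpha>"] unfolding e by blast
    then show ?thesis using True by (simp add: gauss_inner_def coef_def)
  next
    case False
    have "coef q \<alpha> = coef (hermite_sum ?A q) \<alpha>"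
      using null_space_eq_hermite_sum[OF qn] L2_measurable[OF qL] L2_measurable[OF hermite_sum_L2[of ?A q]]
      by (intro coef_cong_AE) auto
    then have "coef q \<alpha> = 0" using False by (simp add: coef_hermite_sum finite_multi_order_less)
    then show ?thesis using False f hp unfolding q_def[abs_def] by (simp add: coef_diff)
  qed
qed

lemma high_weight_tendsto:
  fixes f :: "real ^ 'n \<Rightarrow> real"
  assumes f: "f \<in> L2 gauss"
  shows "(\<lambda>N. \<Sum>\<alpha> | k \<le> multi_order \<alpha> \<and> multi_order \<alpha> \<le> N. (coef f \<alpha>)\<^sup>2) \<longlonglongrightarrow> high_weight k f"
proof -
  have "high_weight k f = (\<integral>x. (high_part k f x)\<^sup>2 \<partial>gauss)"
  proof -
    have "\<bar>t\<bar> powr 2 = t\<^sup>2" for t :: real by (cases "t = 0") (auto simp: powr_numeral)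
    then show ?thesis unfolding high_weight_def gauss_Lp_norm_def
      by (simp add: powr_half_sqrt)
  qed
  moreover have "(\<Sum>\<alpha> | multi_order \<alpha> \<le> N. (coef (high_part k f) \<alpha>)\<^sup>2)
      = (\<Sum>\<alpha> | k \<le> multi_order \<alpha> \<and> multi_order \<alpha> \<le> N. (coef f \<alpha>)\<^sup>2)" for N
    by (rule sum.mono_neutral_cong_right) (auto simp: finite_multi_order_le coef_high_part[OF f])
  ultimately show ?thesis using parseval[OF coef_high_part(1)[OF f, of k]] by simp
qed

section \<open>The quadratic form of the Ornstein-Uhlenbeck operator\<close>

text \<open>Young's inequality for the conjugate exponents \<open>p\<close> and \<open>p / (p - 1)\<close>, in a form that includes
  \<open>p = 1\<close>. It also says that the graph of \<open>t \<mapsto> t powr p\<close> lies above its tangent at \<open>b\<close>.\<close>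

lemma young_powr:
  fixes a b p :: real
  assumes "1 \<le> p" "0 \<le> a" "0 \<le> b"
  shows "p * (a * b powr (p - 1)) \<le> a powr p + (p - 1) * b powr p"
proof (cases "p = 1")
  case True
  then show ?thesis using assms by (cases "b = 0") auto
next
  case False
  then have p: "p > 1" using assms by simp
  have "a * b powr (p - 1) \<le> a powr p / p + (b powr (p - 1)) powr (p / (p - 1)) / (p / (p - 1))"
    by (rule Youngs_inequality) (use p assms in \<open>auto simp: field_simps\<close>)
  also have "(b powr (p - 1)) powr (p / (p - 1)) = b powr p"
    using p by (simp add: powr_powr)
  finally have "p * (a * b powr (p - 1)) \<le> p * (a powr p / p + b powr p / (p / (p - 1)))"
    using p by (intro mult_left_mono) auto
  also have "p * (a powr p / p + b powr p / (p / (p - 1))) = a powr p + (p - 1) * b powr p"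
    using p by (simp add: distrib_left)
  finally show ?thesis .
qed

lemma prob_gauss [simp]: "measure gauss UNIV = 1"
  using gauss.prob_space by simp

lemma powr_le_one_plus_square:
  fixes t p :: real
  assumes "1 \<le> p" "p \<le> 2" "0 \<le> t"
  shows "t powr p \<le> 1 + t\<^sup>2"
proof (cases "t \<le> 1")
  case True
  then have "t powr p \<le> 1" using assms by (intro powr_le1) auto
  then show ?thesis using zero_le_power2[of t] by linarith
next
  case False
  then have "t powr p \<le> t powr 2" using assms by (intro powr_mono) auto
  then show ?thesis using False by (simp add: powr_numeral)
qed

lemma (in finite_measure) L2_integrable_powr:
  assumes v: "v \<in> L2 M" and p: "1 \<le> p" "p \<le> 2" and v0: "\<And>x. v x \<ge> 0"
  shows "integrable M (\<lambda>x. v x powr p)"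
proof (rule Bochner_Integration.integrable_bound)
  show "integrable M (\<lambda>x. 1 + (v x)\<^sup>2)" using L2_integrable_sq[OF v] by simp
  show "(\<lambda>x. v x powr p) \<in> borel_measurable M" using L2_measurable[OF v] by measurable
  show "AE x in M. norm (v x powr p) \<le> norm (1 + (v x)\<^sup>2)"
  proof (rule AE_I2)
    fix x
    have "0 \<le> 1 + (v x)\<^sup>2" by (simp add: add_nonneg_nonneg)
    then show "norm (v x powr p) \<le> norm (1 + (v x)\<^sup>2)"
      using powr_le_one_plus_square[OF p v0[of x]] by simp
  qed
qed

lemma gauss2_mix_integral:
  fixes g :: "real ^ 'n \<Rightarrow> real"
  assumes g: "integrable gauss g" and s: "s > 0" and rs: "\<rho>\<^sup>2 + s\<^sup>2 = 1"
  shows "AE x in gauss. integrable gauss (\<lambda>y. g (\<rho> *\<^sub>R x + s *\<^sub>R y))"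
    and "integrable gauss (\<lambda>x. \<integral>y. g (\<rho> *\<^sub>R x + s *\<^sub>R y) \<partial>gauss)"
    and "(\<integral>x. \<integral>y. g (\<rho> *\<^sub>R x + s *\<^sub>R y) \<partial>gauss \<partial>gauss) = (\<integral>x. g x \<partial>gauss)"
proof -
  have [measurable]: "g \<in> borel_measurable borel" using borel_measurable_integrable[OF g] by simp
  let ?F = "\<lambda>z :: (real ^ 'n) \<times> (real ^ 'n). g (fst z)"
  have F: "?F \<in> borel_measurable (borel \<Otimes>\<^sub>M borel)" by measurable
  have iF: "integrable (gauss \<Otimes>\<^sub>M gauss) ?F"
    by (rule gauss2.Fubini_integrable[OF borel_measurable_gauss2[OF F]]) (simp_all add: g integrable_abs)
  have iR: "integrable (gauss \<Otimes>\<^sub>M gauss) (\<lambda>z. ?F (rot \<rho> s z))"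
    using iF gauss2_rot(1)[OF F s rs] by simp
  show "AE x in gauss. integrable gauss (\<lambda>y. g (\<rho> *\<^sub>R x + s *\<^sub>R y))"
    using gauss2.AE_integrable_fst'[OF iR] by (simp add: rot_def)
  show "integrable gauss (\<lambda>x. \<integral>y. g (\<rho> *\<^sub>R x + s *\<^sub>R y) \<partial>gauss)"
    using gauss2.integrable_fst'[OF iR] by (simp add: rot_def)
  have "(\<integral>x. \<integral>y. g (\<rho> *\<^sub>R x + s *\<^sub>R y) \<partial>gauss \<partial>gauss) = (\<integral>z. ?F (rot \<rho> s z) \<partial>(gauss \<Otimes>\<^sub>M gauss))"
    using gauss2.integral_fst'[OF iR] by (simp add: rot_def)
  also have "\<dots> = (\<integral>z. ?F z \<partial>(gauss \<Otimes>\<^sub>M gauss))" by (rule gauss2_rot(2)[OF F s rs])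
  also have "\<dots> = (\<integral>x. g x \<partial>gauss)"
    using gauss2.integral_fst'[OF iF] by simp
  finally show "(\<integral>x. \<integral>y. g (\<rho> *\<^sub>R x + s *\<^sub>R y) \<partial>gauss \<partial>gauss) = (\<integral>x. g x \<partial>gauss)" .
qed

abbreviation ou :: "real \<Rightarrow> real \<Rightarrow> (real ^ 'n \<Rightarrow> real) \<Rightarrow> real ^ 'n \<Rightarrow> real" where
  "ou \<rho> s u \<equiv> mehler \<rho> s (\<lambda>_. 0) u"

lemma ou_eq: "ou \<rho> s u x = (\<integral>y. u (\<rho> *\<^sub>R x + s *\<^sub>R y) \<partial>gauss)"
  by (simp add: mehler_def)

lemma mbinom_zero [simp]: "mbinom \<alpha> (\<lambda>_. 0) = 1"
  by (simp add: mbinom_def)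

text \<open>Jensen's inequality in the pointwise average, via the tangent line at the mean value, followed by
  rotation invariance.\<close>

lemma ou_powr_contraction:
  fixes v :: "real ^ 'n \<Rightarrow> real"
  assumes v: "v \<in> L2 gauss" and v0: "\<And>x. v x \<ge> 0" and p: "1 \<le> p" "p \<le> 2"
    and s: "s > 0" and rs: "\<rho>\<^sup>2 + s\<^sup>2 = 1"
  shows "(\<integral>x. ou \<rho> s v x powr p \<partial>gauss) \<le> (\<integral>x. v x powr p \<partial>gauss)"
proof -
  have ou: "ou \<rho> s v x \<ge> 0" for x unfolding ou_eq by (intro Bochner_Integration.integral_nonneg) (use v0 in auto)
  note iv = gauss.L2_integrable_powr[OF v p v0]
  have "(\<integral>x. ou \<rho> s v x powr p \<partial>gauss) \<le> (\<integral>x. \<integral>y. v (\<rho> *\<^sub>R x + s *\<^sub>R y) powr p \<partial>gauss \<partial>gauss)"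
  proof (rule integral_mono_AE)
    show "integrable gauss (\<lambda>x. ou \<rho> s v x powr p)"
      by (rule gauss.L2_integrable_powr[OF mehler_L2[OF v s rs] p ou])
    show "integrable gauss (\<lambda>x. \<integral>y. v (\<rho> *\<^sub>R x + s *\<^sub>R y) powr p \<partial>gauss)"
      by (rule gauss2_mix_integral(2)[OF iv s rs])
    show "AE x in gauss. ou \<rho> s v x powr p \<le> (\<integral>y. v (\<rho> *\<^sub>R x + s *\<^sub>R y) powr p \<partial>gauss)"
      using gauss2_mix_integral(1)[OF iv s rs] gauss2_mix_L2(2)[OF v s rs]
    proof eventually_elim
      case (elim x)
      let ?w = "\<lambda>y. v (\<rho> *\<^sub>R x + s *\<^sub>R y)" and ?b = "ou \<rho> s v x"
      have iw: "integrable gauss ?w" by (rule gauss.L2_integrable[OF elim(2)])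
      have "(\<integral>y. p * (?w y * ?b powr (p - 1)) \<partial>gauss) \<le> (\<integral>y. ?w y powr p + (p - 1) * ?b powr p \<partial>gauss)"
        by (rule Bochner_Integration.integral_mono) (use iw elim(1) young_powr[OF p(1) v0 ou] in auto)
      then have "p * (?b * ?b powr (p - 1)) \<le> (\<integral>y. ?w y powr p \<partial>gauss) + (p - 1) * ?b powr p"
        using iw elim(1) by (simp add: ou_eq)
      moreover have "?b * ?b powr (p - 1) = ?b powr p"
        using ou[of x] by (cases "?b = 0") (simp_all add: powr_diff)
      ultimately show ?case by (simp add: algebra_simps)
    qed
  qed
  then show ?thesis by (simp add: gauss2_mix_integral(3)[OF iv s rs])
qed

lemma grad_norm_L2:
  fixes f :: "real ^ 'n \<Rightarrow> real"
  assumes f: "f \<in> gauss_sobolev k"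
  shows "grad_norm k f \<in> L2 gauss"
proof (rule L2I)
  have m: "weak_D \<kappa> f \<in> L2 gauss" if "\<kappa> \<in> {\<kappa>. multi_order \<kappa> = k}" for \<kappa> using gauss_sobolevD(2)[OF f] that by simp
  note [measurable] = L2_measurable[OF m]
  show "grad_norm k f \<in> borel_measurable gauss"
    unfolding grad_norm_def[abs_def] by measurable
  have "(\<lambda>x. (grad_norm k f x)\<^sup>2) = (\<lambda>x. \<Sum>\<kappa> | multi_order \<kappa> = k. (weak_D \<kappa> f x)\<^sup>2)"
    unfolding grad_norm_def by (simp add: sum_nonneg)
  then show "integrable gauss (\<lambda>x. (grad_norm k f x)\<^sup>2)"
    by (simp only:) (intro Bochner_Integration.integrable_sum L2_integrable_sq m)
qed

lemma sum_cauchy_schwarz_sqrt: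
  fixes a b :: "'a \<Rightarrow> real"
  shows "(\<Sum>i\<in>I. a i * b i) \<le> sqrt (\<Sum>i\<in>I. (a i)\<^sup>2) * sqrt (\<Sum>i\<in>I. (b i)\<^sup>2)"
proof -
  have "(\<Sum>i\<in>I. a i * b i) \<le> sqrt ((\<Sum>i\<in>I. a i * b i)\<^sup>2)" by simp
  also have "\<dots> \<le> sqrt ((\<Sum>i\<in>I. (a i)\<^sup>2) * (\<Sum>i\<in>I. (b i)\<^sup>2))"
    by (intro real_sqrt_le_mono Cauchy_Schwarz_ineq_sum)
  finally show ?thesis by (simp add: real_sqrt_mult)
qed

text \<open>Parseval writes each form on the right as a series with nonnegative terms, so finite partial sums
  are lower bounds; a shift of the summation index by \<open>\<kappa>\<close> and Vandermonde's identity collect them.\<close>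

lemma quadratic_form_lower:
  fixes f :: "real ^ 'n \<Rightarrow> real"
  assumes f: "f \<in> gauss_sobolev k" and s: "s > 0" and rs: "\<rho>\<^sup>2 + s\<^sup>2 = 1" and \<rho>: "\<rho> \<ge> 0"
  shows "(\<Sum>\<alpha> | k \<le> multi_order \<alpha> \<and> multi_order \<alpha> \<le> N. real (multi_order \<alpha> choose k) * \<rho> ^ (multi_order \<alpha> - k) * (coef f \<alpha>)\<^sup>2)
     \<le> (\<Sum>\<kappa> | multi_order \<kappa> = k. \<integral>x. weak_D \<kappa> f x * ou \<rho> s (weak_D \<kappa> f) x \<partial>gauss)"
proof -
  let ?I = "{\<alpha> :: 'n \<Rightarrow> nat. k \<le> multi_order \<alpha> \<and> multi_order \<alpha> \<le> N}"
  have finI: "finite ?I" by (rule finite_subset[OF _ finite_multi_order_le[of N]]) auto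
  have low: "(\<Sum>\<beta> | multi_order \<beta> \<le> N. \<rho> ^ multi_order \<beta> * (coef u \<beta>)\<^sup>2) \<le> (\<integral>x. u x * ou \<rho> s u x \<partial>gauss)"
    if u: "u \<in> L2 gauss" for u :: "real ^ 'n \<Rightarrow> real"
  proof (rule incseq_le[of "\<lambda>N. \<Sum>\<beta> | multi_order \<beta> \<le> N. \<rho> ^ multi_order \<beta> * (coef u \<beta>)\<^sup>2"])
    show "incseq (\<lambda>N. \<Sum>\<beta> | multi_order \<beta> \<le> N. \<rho> ^ multi_order \<beta> * (coef u (\<beta> :: 'n \<Rightarrow> nat))\<^sup>2)"
      unfolding incseq_def using \<rho> by (auto intro!: sum_mono2 finite_multi_order_le)
    have "coef u \<beta> * coef (ou \<rho> s u) \<beta> = \<rho> ^ multi_order \<beta> * (coef u \<beta>)\<^sup>2" for \<beta>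
      by (simp add: coef_mehler[OF u s rs] power2_eq_square)
    then show "(\<lambda>N. \<Sum>\<beta> | multi_order \<beta> \<le> N. \<rho> ^ multi_order \<beta> * (coef u \<beta>)\<^sup>2) \<longlonglongrightarrow> (\<integral>x. u x * ou \<rho> s u x \<partial>gauss)"
      using parseval_inner[OF u mehler_L2[OF u s rs, of "\<lambda>_. 0"]] by simp
  qed
  have one: "(\<Sum>\<alpha>\<in>?I. mbinom \<alpha> \<kappa> * \<rho> ^ (multi_order \<alpha> - k) * (coef f \<alpha>)\<^sup>2) \<le> (\<integral>x. weak_D \<kappa> f x * ou \<rho> s (weak_D \<kappa> f) x \<partial>gauss)"
    if \<kappa>: "multi_order \<kappa> = k" for \<kappa>
  proof -
    have "(\<Sum>\<alpha>\<in>?I. mbinom \<alpha> \<kappa> * \<rho> ^ (multi_order \<alpha> - k) * (coef f \<alpha>)\<^sup>2)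
        = (\<Sum>\<alpha>\<in>{\<alpha>\<in>?I. \<forall>i. \<kappa> i \<le> \<alpha> i}. mbinom \<alpha> \<kappa> * \<rho> ^ (multi_order \<alpha> - k) * (coef f \<alpha>)\<^sup>2)"
      by (rule sum.mono_neutral_right[OF finI]) (use mbinom_eq_0 in auto)
    also have "\<dots> = (\<Sum>\<beta>\<in>(\<lambda>\<alpha> i. \<alpha> i - \<kappa> i) ` {\<alpha>\<in>?I. \<forall>i. \<kappa> i \<le> \<alpha> i}. mbinom (\<lambda>i. \<beta> i + \<kappa> i) \<kappa> * \<rho> ^ multi_order \<beta> * (coef f (\<lambda>i. \<beta> i + \<kappa> i))\<^sup>2)"
    proof (subst sum.reindex)
      show "inj_on (\<lambda>\<alpha> i. \<alpha> i - \<kappa> i) {\<alpha>\<in>?I. \<forall>i. \<kappa> i \<le> \<alpha> i}"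
        by (auto simp: inj_on_def fun_eq_iff) (metis le_add_diff_inverse)
      show "(\<Sum>\<alpha>\<in>{\<alpha>\<in>?I. \<forall>i. \<kappa> i \<le> \<alpha> i}. mbinom \<alpha> \<kappa> * \<rho> ^ (multi_order \<alpha> - k) * (coef f \<alpha>)\<^sup>2)
        = sum ((\<lambda>\<beta>. mbinom (\<lambda>i. \<beta> i + \<kappa> i) \<kappa> * \<rho> ^ multi_order \<beta> * (coef f (\<lambda>i. \<beta> i + \<kappa> i))\<^sup>2) \<circ> (\<lambda>\<alpha> i. \<alpha> i - \<kappa> i)) {\<alpha>\<in>?I. \<forall>i. \<kappa> i \<le> \<alpha> i}"
        using \<kappa> by (intro sum.cong) (auto simp: sum_subtractf_nat)
    qed
    also have "\<dots> \<le> (\<Sum>\<beta> | multi_order \<beta> \<le> N. mbinom (\<lambda>i. \<beta> i + \<kappa> i) \<kappa> * \<rho> ^ multi_order \<beta> * (coef f (\<lambda>i. \<beta> i + \<kappa> i))\<^sup>2)"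
    proof (rule sum_mono2[OF finite_multi_order_le])
      show "(\<lambda>\<alpha> i. \<alpha> i - \<kappa> i) ` {\<alpha>\<in>?I. \<forall>i. \<kappa> i \<le> \<alpha> i} \<subseteq> {\<beta>. multi_order \<beta> \<le> N}"
      proof -
        have "multi_order (\<lambda>i. \<alpha> i - \<kappa> i) \<le> multi_order \<alpha>" for \<alpha> :: "'n \<Rightarrow> nat" by (rule sum_mono) simp
        then show ?thesis by (auto intro: order_trans)
      qed
    qed (use \<rho> in \<open>auto intro!: mult_nonneg_nonneg mbinom_nonneg\<close>)
    also have "\<dots> = (\<Sum>\<beta> | multi_order \<beta> \<le> N. \<rho> ^ multi_order \<beta> * (coef (weak_D \<kappa> f) \<beta>)\<^sup>2)"
      using \<kappa> by (simp add: coef_weak_D[OF f] power_mult_distrib mbinom_nonneg mult_ac)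
    also have "\<dots> \<le> (\<integral>x. weak_D \<kappa> f x * ou \<rho> s (weak_D \<kappa> f) x \<partial>gauss)"
      using \<kappa> by (intro low gauss_sobolevD(2)[OF f]) simp
    finally show ?thesis .
  qed
  have "(\<Sum>\<alpha>\<in>?I. real (multi_order \<alpha> choose k) * \<rho> ^ (multi_order \<alpha> - k) * (coef f \<alpha>)\<^sup>2)
      = (\<Sum>\<alpha>\<in>?I. \<Sum>\<kappa> | multi_order \<kappa> = k. mbinom \<alpha> \<kappa> * \<rho> ^ (multi_order \<alpha> - k) * (coef f \<alpha>)\<^sup>2)"
    by (simp add: sum_mbinom[symmetric] sum_distrib_right)
  also have "\<dots> = (\<Sum>\<kappa> | multi_order \<kappa> = k. \<Sum>\<alpha>\<in>?I. mbinom \<alpha> \<kappa> * \<rho> ^ (multi_order \<alpha> - k) * (coef f \<alpha>)\<^sup>2)"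
    by (rule sum.swap)
  also have "\<dots> \<le> (\<Sum>\<kappa> | multi_order \<kappa> = k. \<integral>x. weak_D \<kappa> f x * ou \<rho> s (weak_D \<kappa> f) x \<partial>gauss)"
    by (rule sum_mono) (simp add: one)
  finally show ?thesis .
qed

text \<open>The interpolation between the two bounds \<open>\<Gamma> \<le> 1\<close> and \<open>\<Gamma> \<le> s ^ k * ou \<rho> s v\<close> for the length
  \<open>\<Gamma>\<close> of the vector of all \<open>mehler \<rho> s \<kappa> f\<close> with \<open>multi_order \<kappa> = k\<close>.\<close>

lemma quadratic_form_upper:
  fixes f :: "real ^ 'n \<Rightarrow> real"
  assumes f: "f \<in> gauss_sobolev k" and b: "AE x in gauss. \<bar>f x\<bar> \<le> 1" and p: "1 \<le> p" "p \<le> 2"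
    and s: "s > 0" and rs: "\<rho>\<^sup>2 + s\<^sup>2 = 1"
  shows "s ^ k * (\<Sum>\<kappa> | multi_order \<kappa> = k. \<integral>x. weak_D \<kappa> f x * ou \<rho> s (weak_D \<kappa> f) x \<partial>gauss)
     \<le> (s ^ k) powr (p - 1) * (\<integral>x. grad_norm k f x powr p \<partial>gauss)"
proof -
  let ?K = "{\<kappa> :: 'n \<Rightarrow> nat. multi_order \<kappa> = k}"
  have finK: "finite ?K" by (rule finite_multi_order_eq)
  note fD = gauss_sobolevD[OF f]
  have [measurable]: "f \<in> borel_measurable borel" using L2_measurable[OF fD(1)] by simp
  have D: "weak_D \<kappa> f \<in> L2 gauss" if "\<kappa> \<in> ?K" for \<kappa> using fD(2) that by simp
  define v where "v = grad_norm k f"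
  have v: "v \<in> L2 gauss" unfolding v_def by (rule grad_norm_L2[OF f])
  have v0: "v x \<ge> 0" for x by (simp add: v_def grad_norm_def sum_nonneg)
  \<comment> \<open>Clipping changes \<open>f\<close> on a null set and makes the bound \<open>\<Gamma> x \<le> 1\<close> valid at every point, as Bessel's inequality needs.\<close>
  define f' where "f' x = max (-1) (min 1 (f x))" for x
  have [measurable]: "f' \<in> borel_measurable borel" unfolding f'_def[abs_def] by measurable
  have f'1: "\<bar>f' x\<bar> \<le> 1" for x by (auto simp: f'_def)
  have f'L: "f' \<in> L2 gauss" by (rule gauss.L2_bounded[OF _ f'1]) simp
  have ff': "AE x in gauss. f' x = f x" using b by eventually_elim (auto simp: f'_def)
  have cf': "coef f' \<alpha> = coef f \<alpha>" for \<alpha> by (rule coef_cong_AE[OF ff']) auto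
  define G where "G \<kappa> = mehler \<rho> s \<kappa> f'" for \<kappa>
  have GL: "G \<kappa> \<in> L2 gauss" for \<kappa> unfolding G_def by (rule mehler_L2[OF f'L s rs])
  have PL: "ou \<rho> s (weak_D \<kappa> f) \<in> L2 gauss" if "\<kappa> \<in> ?K" for \<kappa> by (rule mehler_L2[OF D[OF that] s rs])
  \<comment> \<open>Gaussian integration by parts, obtained by comparing Hermite coefficients.\<close>
  have GP: "AE x in gauss. G \<kappa> x = s ^ k * ou \<rho> s (weak_D \<kappa> f) x" if \<kappa>: "\<kappa> \<in> ?K" for \<kappa>
  proof -
    have "AE x in gauss. G \<kappa> x - s ^ k * ou \<rho> s (weak_D \<kappa> f) x = 0"
    proof (rule hermite_complete)
      show "(\<lambda>x. G \<kappa> x - s ^ k * ou \<rho> s (weak_D \<kappa> f) x) \<in> L2 gauss"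
        by (intro L2_diff L2_cmult GL PL \<kappa>)
      fix \<beta>
      have "coef (\<lambda>x. G \<kappa> x - s ^ k * ou \<rho> s (weak_D \<kappa> f) x) \<beta> = coef (G \<kappa>) \<beta> - s ^ k * coef (ou \<rho> s (weak_D \<kappa> f)) \<beta>"
        unfolding coef_diff[OF GL L2_cmult[OF PL[OF \<kappa>]]] coef_cmult ..
      also have "\<dots> = 0"
        using \<kappa> by (simp add: G_def coef_mehler[OF f'L s rs] coef_mehler[OF D s rs] cf' coef_weak_D[OF f])
      finally show "coef (\<lambda>x. G \<kappa> x - s ^ k * ou \<rho> s (weak_D \<kappa> f) x) \<beta> = 0" .
    qed
    then show ?thesis by eventually_elim simp
  qed
  define \<Gamma> where "\<Gamma> x = sqrt (\<Sum>\<kappa>\<in>?K. (G \<kappa> x)\<^sup>2)" for x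
  have \<Gamma>0: "\<Gamma> x \<ge> 0" for x by (simp add: \<Gamma>_def sum_nonneg)
  have \<Gamma>1: "\<Gamma> x \<le> 1" for x
  proof -
    let ?u = "\<lambda>y. f' (\<rho> *\<^sub>R x + s *\<^sub>R y)"
    have u: "?u \<in> L2 gauss" by (rule gauss.L2_bounded[OF _ f'1]) simp
    have "(\<Sum>\<kappa>\<in>?K. (G \<kappa> x)\<^sup>2) = (\<Sum>\<kappa>\<in>?K. (coef ?u \<kappa>)\<^sup>2)"
      by (simp add: G_def mehler_def coef_def)
    also have "\<dots> \<le> (\<integral>y. (?u y)\<^sup>2 \<partial>gauss)" by (rule bessel[OF u finK])
    also have "\<dots> \<le> (\<integral>y. 1 \<partial>(gauss :: (real ^ 'n) measure))"
      by (rule Bochner_Integration.integral_mono) (use L2_integrable_sq[OF u] f'1 in \<open>auto simp: abs_square_le_1\<close>)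
    finally show ?thesis by (simp add: \<Gamma>_def real_sqrt_le_1_iff)
  qed
  have allD: "AE x in gauss. \<forall>\<kappa>\<in>?K. (\<lambda>y. weak_D \<kappa> f (\<rho> *\<^sub>R x + s *\<^sub>R y)) \<in> L2 gauss"
    by (rule AE_finite_allI[OF finK]) (rule gauss2_mix_L2(2)[OF D s rs])
  have allG: "AE x in gauss. \<forall>\<kappa>\<in>?K. G \<kappa> x = s ^ k * ou \<rho> s (weak_D \<kappa> f) x"
    by (rule AE_finite_allI[OF finK]) (rule GP)
  have \<Gamma>P: "AE x in gauss. \<Gamma> x \<le> s ^ k * ou \<rho> s v x"
    using allD allG gauss2_mix_L2(2)[OF v s rs]
  proof eventually_elim
    case (elim x)
    let ?z = "\<lambda>y. \<rho> *\<^sub>R x + s *\<^sub>R y"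
    have iD: "integrable gauss (\<lambda>y. weak_D \<kappa> f (?z y))" if "\<kappa> \<in> ?K" for \<kappa>
      using elim(1) that by (intro gauss.L2_integrable) blast
    have iv: "integrable gauss (\<lambda>y. v (?z y))" by (rule gauss.L2_integrable[OF elim(3)])
    have Pv0: "ou \<rho> s v x \<ge> 0" unfolding ou_eq by (intro Bochner_Integration.integral_nonneg) (use v0 in auto)
    have "(\<Gamma> x)\<^sup>2 = (\<Sum>\<kappa>\<in>?K. G \<kappa> x * (s ^ k * ou \<rho> s (weak_D \<kappa> f) x))"
      unfolding \<Gamma>_def using elim(2) by (simp add: sum_nonneg power2_eq_square)
    also have "\<dots> = s ^ k * (\<Sum>\<kappa>\<in>?K. G \<kappa> x * ou \<rho> s (weak_D \<kappa> f) x)"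
      by (simp add: sum_distrib_left mult_ac)
    also have "(\<Sum>\<kappa>\<in>?K. G \<kappa> x * ou \<rho> s (weak_D \<kappa> f) x) = (\<integral>y. (\<Sum>\<kappa>\<in>?K. G \<kappa> x * weak_D \<kappa> f (?z y)) \<partial>gauss)"
      unfolding ou_eq by (subst Bochner_Integration.integral_sum) (use iD in auto)
    also have "\<dots> \<le> (\<integral>y. \<Gamma> x * v (?z y) \<partial>gauss)"
    proof (rule Bochner_Integration.integral_mono)
      show "integrable gauss (\<lambda>y. \<Sum>\<kappa>\<in>?K. G \<kappa> x * weak_D \<kappa> f (?z y))"
        by (intro Bochner_Integration.integrable_sum integrable_mult_right iD)
      show "integrable gauss (\<lambda>y. \<Gamma> x * v (?z y))" using iv by simp
      show "(\<Sum>\<kappa>\<in>?K. G \<kappa> x * weak_D \<kappa> f (?z y)) \<le> \<Gamma> x * v (?z y)" for y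
        unfolding \<Gamma>_def v_def grad_norm_def by (rule sum_cauchy_schwarz_sqrt)
    qed
    also have "\<dots> = \<Gamma> x * ou \<rho> s v x" by (simp add: ou_eq)
    finally have "\<Gamma> x * \<Gamma> x \<le> \<Gamma> x * (s ^ k * ou \<rho> s v x)"
      using s by (simp add: power2_eq_square mult_ac)
    then show ?case using \<Gamma>0[of x] Pv0 s by (cases "\<Gamma> x = 0") auto
  qed
  have Pv0: "ou \<rho> s v x \<ge> 0" for x unfolding ou_eq by (intro Bochner_Integration.integral_nonneg) (use v0 in auto)
  have PvL: "ou \<rho> s v \<in> L2 gauss" by (rule mehler_L2[OF v s rs])
  define c where "c = (s ^ k) powr (p - 1)"
  have c0: "c \<ge> 0" by (simp add: c_def)
  have pw: "AE x in gauss. (\<Sum>\<kappa>\<in>?K. weak_D \<kappa> f x * G \<kappa> x) \<le> c / p * (v x powr p + (p - 1) * ou \<rho> s v x powr p)"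
    using \<Gamma>P
  proof eventually_elim
    case (elim x)
    have "(\<Sum>\<kappa>\<in>?K. weak_D \<kappa> f x * G \<kappa> x) \<le> v x * \<Gamma> x"
      unfolding \<Gamma>_def v_def grad_norm_def by (rule sum_cauchy_schwarz_sqrt)
    also have "\<Gamma> x \<le> c * ou \<rho> s v x powr (p - 1)"
    proof (cases "\<Gamma> x = 0")
      case True then show ?thesis using c0 by simp
    next
      case False
      \<comment> \<open>This is where \<open>\<Gamma> \<le> 1\<close> and \<open>p \<le> 2\<close> enter. The case \<open>\<Gamma> x = 0\<close> is separate because \<open>0 powr 0 = 0\<close>.\<close>
      have "\<Gamma> x = \<Gamma> x powr 1" using \<Gamma>0[of x] by simp
      also have "\<dots> \<le> \<Gamma> x powr (p - 1)" using p \<Gamma>0 \<Gamma>1 by (intro powr_mono') auto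
      also have "\<dots> \<le> (s ^ k * ou \<rho> s v x) powr (p - 1)"
        using p \<Gamma>0 elim by (intro powr_mono2) auto
      also have "\<dots> = c * ou \<rho> s v x powr (p - 1)"
        unfolding c_def using s Pv0 by (simp add: powr_mult)
      finally show ?thesis .
    qed
    then have "v x * \<Gamma> x \<le> v x * (c * ou \<rho> s v x powr (p - 1))" using v0 by (rule mult_left_mono)
    also have "\<dots> = c / p * (p * (v x * ou \<rho> s v x powr (p - 1)))" using p by simp
    also have "\<dots> \<le> c / p * (v x powr p + (p - 1) * ou \<rho> s v x powr p)"
      using c0 p by (intro mult_left_mono young_powr v0 Pv0) auto
    finally show ?case by simp
  qed
  have iv: "integrable gauss (\<lambda>x. v x powr p)" by (rule gauss.L2_integrable_powr[OF v p v0])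
  have iP: "integrable gauss (\<lambda>x. ou \<rho> s v x powr p)" by (rule gauss.L2_integrable_powr[OF PvL p Pv0])
  have "s ^ k * (\<Sum>\<kappa>\<in>?K. \<integral>x. weak_D \<kappa> f x * ou \<rho> s (weak_D \<kappa> f) x \<partial>gauss)
     = (\<Sum>\<kappa>\<in>?K. \<integral>x. weak_D \<kappa> f x * G \<kappa> x \<partial>gauss)"
    unfolding sum_distrib_left
  proof (rule sum.cong[OF refl])
    fix \<kappa> assume \<kappa>: "\<kappa> \<in> ?K"
    have "(\<integral>x. weak_D \<kappa> f x * G \<kappa> x \<partial>gauss) = (\<integral>x. s ^ k * (weak_D \<kappa> f x * ou \<rho> s (weak_D \<kappa> f) x) \<partial>gauss)"
      using GP[OF \<kappa>] L2_measurable[OF D[OF \<kappa>]] L2_measurable[OF GL[of \<kappa>]] L2_measurable[OF PL[OF \<kappa>]]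
      by (intro integral_cong_AE) (auto elim!: eventually_mono)
    then show "s ^ k * (\<integral>x. weak_D \<kappa> f x * ou \<rho> s (weak_D \<kappa> f) x \<partial>gauss) = (\<integral>x. weak_D \<kappa> f x * G \<kappa> x \<partial>gauss)"
      by simp
  qed
  also have "\<dots> = (\<integral>x. (\<Sum>\<kappa>\<in>?K. weak_D \<kappa> f x * G \<kappa> x) \<partial>gauss)"
    by (rule Bochner_Integration.integral_sum[symmetric]) (intro L2_integrable_mult D GL)
  also have "\<dots> \<le> (\<integral>x. c / p * (v x powr p + (p - 1) * ou \<rho> s v x powr p) \<partial>gauss)"
    by (rule integral_mono_AE[OF _ _ pw])
       (use iv iP in \<open>auto intro!: Bochner_Integration.integrable_sum L2_integrable_mult D GL\<close>)
  also have "\<dots> = c / p * ((\<integral>x. v x powr p \<partial>gauss) + (p - 1) * (\<integral>x. ou \<rho> s v x powr p \<partial>gauss))"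
    using iv iP by simp
  also have "\<dots> \<le> c / p * ((\<integral>x. v x powr p \<partial>gauss) + (p - 1) * (\<integral>x. v x powr p \<partial>gauss))"
    using c0 p by (intro mult_left_mono add_left_mono ou_powr_contraction[OF v v0 p s rs]) auto
  also have "\<dots> = c * (\<integral>x. v x powr p \<partial>gauss)" using p by (simp add: field_simps)
  finally show ?thesis unfolding c_def v_def .
qed

section \<open>The constant and the theorem\<close>

text \<open>With \<open>s = sqrt (1 - \<rho>\<^sup>2)\<close> this is \<open>s powr (p - 2)\<close>. At \<open>\<rho> = 1\<close> its value is the default
  \<open>0 powr _ = 0\<close>, although the function tends to infinity there when \<open>p < 2\<close>.\<close>

definition kern :: "real \<Rightarrow> real \<Rightarrow> real" where
  "kern p \<rho> = (1 - \<rho>\<^sup>2) powr (p / 2 - 1)"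

lemma kern_nonneg: "kern p \<rho> \<ge> 0"
  by (simp add: kern_def)

lemma kern_bounds:
  assumes p: "1 \<le> p" "p \<le> 2" and \<rho>: "0 \<le> \<rho>" "\<rho> < 1"
  shows "1 \<le> kern p \<rho>" "kern p \<rho> \<le> (1 - \<rho>) powr (- (1 / 2))"
proof -
  have a: "\<rho>\<^sup>2 \<le> \<rho>" using \<rho> by (simp add: power2_eq_square mult_left_le)
  then have b: "0 < 1 - \<rho>\<^sup>2" "1 - \<rho>\<^sup>2 \<le> 1" "1 - \<rho> \<le> 1 - \<rho>\<^sup>2" using \<rho> by auto
  have "(1 - \<rho>\<^sup>2) powr 0 \<le> kern p \<rho>" unfolding kern_def using p b by (intro powr_mono') auto
  then show "1 \<le> kern p \<rho>" using b by simp
  have "kern p \<rho> \<le> (1 - \<rho>\<^sup>2) powr (- (1 / 2))" unfolding kern_def using p b by (intro powr_mono') auto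
  also have "\<dots> \<le> (1 - \<rho>) powr (- (1 / 2))" using b \<rho> by (intro powr_mono2') auto
  finally show "kern p \<rho> \<le> (1 - \<rho>) powr (- (1 / 2))" .
qed

lemma kern_mono:
  assumes p: "p \<le> 2" and "0 \<le> \<rho>" "\<rho> \<le> \<tau>" "\<tau> < 1"
  shows "kern p \<rho> \<le> kern p \<tau>"
proof -
  have "\<rho>\<^sup>2 \<le> \<tau>\<^sup>2" "\<tau>\<^sup>2 < 1" using assms by (auto intro!: power_mono simp: power_less_one_iff abs_square_less_1)
  then show ?thesis unfolding kern_def using p by (intro powr_mono2') auto
qed

lemma inv_sqrt_has_integral: "((\<lambda>\<rho>::real. (1 - \<rho>) powr (- (1 / 2))) has_integral 2) {0..1}"
proof -
  have "((\<lambda>\<rho>. (1 - \<rho>) powr (- (1 / 2))) has_integral (- 2 * sqrt (1 - 1) - (- 2 * sqrt (1 - 0)))) {0..1::real}"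
  proof (rule fundamental_theorem_of_calculus_interior)
    show "continuous_on {0..1} (\<lambda>\<rho>::real. - 2 * sqrt (1 - \<rho>))" by (intro continuous_intros)
    fix \<rho> :: real assume \<rho>: "\<rho> \<in> {0<..<1}"
    have "((\<lambda>\<rho>. - 2 * sqrt (1 - \<rho>)) has_real_derivative (1 - \<rho>) powr (- (1 / 2))) (at \<rho>)"
      using \<rho> by (auto intro!: derivative_eq_intros simp: powr_minus powr_half_sqrt field_simps)
    then show "((\<lambda>\<rho>. - 2 * sqrt (1 - \<rho>)) has_vector_derivative (1 - \<rho>) powr (- (1 / 2))) (at \<rho>)"
      by (simp add: has_real_derivative_iff_has_vector_derivative)
  qed simp
  then show ?thesis by simp
qed

context
  fixes p :: real
  assumes p: "1 \<le> p" "p \<le> 2"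
begin

definition kern_total :: real where "kern_total = integral {0..1} (kern p)"

lemma kern_integrable: "kern p integrable_on {0..1}"
proof (rule measurable_bounded_by_integrable_imp_integrable)
  show "kern p \<in> borel_measurable (lebesgue_on {0..1})"
  proof -
    have "kern p \<in> borel_measurable borel" unfolding kern_def[abs_def] by measurable
    then show ?thesis by (intro measurable_restrict_space1) (simp add: measurable_completion)
  qed
  show "(\<lambda>\<rho>::real. (1 - \<rho>) powr (- (1 / 2))) integrable_on {0..1}" using inv_sqrt_has_integral by blast
  show "norm (kern p \<rho>) \<le> (1 - \<rho>) powr (- (1 / 2))" if "\<rho> \<in> {0..1}" for \<rho>
    using that kern_bounds(2)[OF p, of \<rho>] by (cases "\<rho> = 1") (auto simp: kern_nonneg, simp add: kern_def)
qed simp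

lemma kern_total_bounds: "1 \<le> kern_total" "kern_total \<le> 2"
proof -
  have k: "(kern p has_integral kern_total) {0..1}" unfolding kern_total_def using kern_integrable by (rule integrable_integral)
  have "((\<lambda>x::real. if x = 1 then 0 else 1 :: real) has_integral 1) {0..1}"
    by (rule has_integral_spike_finite[of "{1}" _ _ "\<lambda>_. 1"]) (use has_integral_const_real[of "1::real" 0 1] in auto)
  from has_integral_le[OF this k] show "1 \<le> kern_total"
    using kern_bounds(1)[OF p] by (auto simp: kern_nonneg)
  show "kern_total \<le> 2"
  proof (rule has_integral_le[OF k inv_sqrt_has_integral])
    show "kern p \<rho> \<le> (1 - \<rho>) powr (- (1 / 2))" if "\<rho> \<in> {0..1}" for \<rho>
      using that kern_bounds(2)[OF p, of \<rho>] by (cases "\<rho> = 1") (auto, simp add: kern_def)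
  qed
qed

text \<open>The substitution \<open>\<rho> = 1 - 2 t\<close>, for which \<open>1 - \<rho>\<^sup>2 = 4 t (1 - t)\<close>.\<close>

lemma C_const_eq: "C_const p = 1 / kern_total"
proof -
  let ?g = "\<lambda>t::real. t powr (p / 2 - 1) * (1 - t) powr (p / 2 - 1)"
  have "((\<lambda>t. kern p (- 2 * t + 1)) has_integral kern_total / 2) {0..1/2}"
  proof -
    have "(kern p has_integral kern_total) (cbox 0 1)" unfolding kern_total_def using kern_integrable by (simp add: integrable_integral)
    from has_integral_affinity[OF this, of "- 2" 1]
    have "((\<lambda>t. kern p (- 2 * t + 1)) has_integral kern_total / 2) ((\<lambda>x. - (x / 2) + 1 / 2) ` {0..1})"
      by simp
    also have "(\<lambda>x::real. - (x / 2) + 1 / 2) ` {0..1} = {0..1/2}"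
    proof (intro equalityI subsetI)
      fix t :: real assume "t \<in> {0..1/2}"
      then show "t \<in> (\<lambda>x. - (x / 2) + 1 / 2) ` {0..1}" by (intro image_eqI[of _ _ "1 - 2 * t"]) (auto simp: field_simps)
    qed auto
    finally show ?thesis .
  qed
  then have "((\<lambda>t. 2 powr (2 - p) * kern p (- 2 * t + 1)) has_integral 2 powr (2 - p) * (kern_total / 2)) {0..1/2}"
    by (rule has_integral_mult_right)
  then have "(?g has_integral 2 powr (2 - p) * (kern_total / 2)) {0..1/2}"
  proof (rule has_integral_eq[rotated])
    fix t :: real assume t: "t \<in> {0..1/2}"
    have "1 - (- 2 * t + 1)\<^sup>2 = 2 powr 2 * (t * (1 - t))"
      by (simp add: powr_numeral power2_eq_square algebra_simps)
    then have "kern p (- 2 * t + 1) = (2 powr 2) powr (p / 2 - 1) * (t powr (p / 2 - 1) * (1 - t) powr (p / 2 - 1))"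
      unfolding kern_def using t by (simp only: powr_mult)
    also have "(2 powr 2) powr (p / 2 - 1) = (2::real) powr (p - 2)"
      unfolding powr_powr by (simp add: right_diff_distrib)
    finally show "2 powr (2 - p) * kern p (- 2 * t + 1) = ?g t"
      by (simp add: powr_add[symmetric] mult.assoc[symmetric])
  qed
  then have "incomplete_Beta (1 / 2) (p / 2) (p / 2) = 2 powr (2 - p) * (kern_total / 2)"
    unfolding incomplete_Beta_def by (rule integral_unique)
  also have "\<dots> = 2 powr (1 - p) * kern_total"
    by (simp add: powr_diff)
  finally show ?thesis unfolding C_const_def by simp
qed

text \<open>The integral of \<open>kern p\<close> over \<open>{\<rho>..1}\<close>. The derivative is easier to read off from an integral with
  variable upper end.\<close>

definition kern_tail :: "real \<Rightarrow> real" where "kern_tail \<rho> = kern_total - integral {0..\<rho>} (kern p)"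

lemma kern_tail_continuous: "continuous_on {0..1} kern_tail"
  unfolding kern_tail_def by (intro continuous_intros indefinite_integral_continuous_1 kern_integrable)

lemma kern_tail_deriv:
  assumes \<rho>: "\<rho> \<in> {0<..<1}"
  shows "(kern_tail has_real_derivative - kern p \<rho>) (at \<rho>)"
proof -
  have "isCont (kern p) \<rho>"
    unfolding kern_def[abs_def] using \<rho> by (intro continuous_intros) (auto simp: power2_eq_1_iff)
  then have "((\<lambda>u. integral {0..u} (kern p)) has_vector_derivative kern p \<rho>) (at \<rho> within ({0..1} - {}))"
    using \<rho> kern_integrable by (intro integral_has_vector_derivative_continuous_at) (auto intro: continuous_at_imp_continuous_within)
  moreover have "at \<rho> within ({0..1} - {}) = at \<rho>" using \<rho> by (auto intro!: at_within_interior)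
  ultimately have "((\<lambda>u. integral {0..u} (kern p)) has_real_derivative kern p \<rho>) (at \<rho>)"
    by (simp add: has_real_derivative_iff_has_vector_derivative)
  then show ?thesis unfolding kern_tail_def[abs_def] by (auto intro!: derivative_eq_intros)
qed

text \<open>\<open>kern p\<close> is nondecreasing on \<open>{\<rho>..<1}\<close>.\<close>

lemma kern_tail_ge:
  assumes \<rho>: "\<rho> \<in> {0<..<1}"
  shows "(1 - \<rho>) * kern p \<rho> \<le> kern_tail \<rho>"
proof -
  have ki: "kern p integrable_on {\<rho>..1}"
    using \<rho> by (intro integrable_on_subinterval[OF kern_integrable]) auto
  have "kern_tail \<rho> = integral {\<rho>..1} (kern p)"
    unfolding kern_tail_def kern_total_def using Henstock_Kurzweil_Integration.integral_combine[OF _ _ kern_integrable, of \<rho>] \<rho> by simp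
  then have kern_tail: "(kern p has_integral kern_tail \<rho>) {\<rho>..1}" using ki by (simp add: integrable_integral)
  have "((\<lambda>x::real. if x = 1 then 0 else kern p \<rho>) has_integral (1 - \<rho>) * kern p \<rho>) {\<rho>..1}"
    by (rule has_integral_spike_finite[of "{1}" _ _ "\<lambda>_. kern p \<rho>"]) (use has_integral_const_real[of "kern p \<rho>" \<rho> 1] \<rho> in auto)
  from has_integral_le[OF this kern_tail] show ?thesis
    using kern_mono[OF p(2)] \<rho> by (auto simp: kern_nonneg)
qed

lemma kern_tail_power_integral:
  "((\<lambda>\<rho>. real k * kern_tail \<rho> ^ (k - 1) * kern p \<rho>) has_integral kern_total ^ k) {0..1}" if "k > 0"
proof -
  have "((\<lambda>\<rho>. real k * kern_tail \<rho> ^ (k - 1) * kern p \<rho>) has_integral (- (kern_tail 1 ^ k) - - (kern_tail 0 ^ k))) {0..1}"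
  proof (rule fundamental_theorem_of_calculus_interior)
    show "continuous_on {0..1} (\<lambda>\<rho>. - (kern_tail \<rho> ^ k))" by (intro continuous_intros kern_tail_continuous)
    fix \<rho> :: real assume "\<rho> \<in> {0<..<1}"
    then have "((\<lambda>\<rho>. - (kern_tail \<rho> ^ k)) has_real_derivative real k * kern_tail \<rho> ^ (k - 1) * kern p \<rho>) (at \<rho>)"
      by (auto intro!: derivative_eq_intros kern_tail_deriv)
    then show "((\<lambda>\<rho>. - (kern_tail \<rho> ^ k)) has_vector_derivative real k * kern_tail \<rho> ^ (k - 1) * kern p \<rho>) (at \<rho>)"
      by (simp add: has_real_derivative_iff_has_vector_derivative)
  qed simp
  moreover have "kern_tail 1 = 0" "kern_tail 0 = kern_total" by (simp_all add: kern_tail_def kern_total_def)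
  ultimately show ?thesis using that by (simp add: power_0_left)
qed

end

text \<open>Differentiating the binomial tail telescopes. This evaluates the Beta integral of
  \<open>\<rho> ^ (m - k) * (1 - \<rho>) ^ (k - 1)\<close>.\<close>

lemma binomial_tail_deriv:
  assumes "k \<le> m"
  shows "((\<lambda>\<rho>. \<Sum>j<k. real (m choose j) * (1 - \<rho>) ^ j * \<rho> ^ (m - j)) has_real_derivative
     real k * real (m choose k) * \<rho> ^ (m - k) * (1 - \<rho>) ^ (k - 1)) (at \<rho>)"
  using assms
proof (induction k)
  case 0 then show ?case by simp
next
  case (Suc k)
  have d: "((\<lambda>\<rho>. real (m choose k) * (1 - \<rho>) ^ k * \<rho> ^ (m - k)) has_real_derivative
     real (m choose k) * (real (m - k) * (1 - \<rho>) ^ k * \<rho> ^ (m - k - 1) - real k * (1 - \<rho>) ^ (k - 1) * \<rho> ^ (m - k))) (at \<rho>)"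
    by (auto intro!: derivative_eq_intros simp: algebra_simps)
  have b: "real (m - k) * real (m choose k) = real (Suc k) * real (m choose Suc k)"
    using arg_cong[OF trans[OF binomial_absorb_comp[of m k] binomial_absorption[of k m, symmetric]], of real]
    by (simp only: of_nat_mult)
  have "real k * real (m choose k) * \<rho> ^ (m - k) * (1 - \<rho>) ^ (k - 1)
     + real (m choose k) * (real (m - k) * (1 - \<rho>) ^ k * \<rho> ^ (m - k - 1) - real k * (1 - \<rho>) ^ (k - 1) * \<rho> ^ (m - k))
     = (real (m - k) * real (m choose k)) * \<rho> ^ (m - Suc k) * (1 - \<rho>) ^ (Suc k - 1)"
    by (simp add: algebra_simps)
  then show ?case using DERIV_add[OF Suc.IH d] Suc.prems unfolding b by simp
qed

lemma binomial_tail_integral: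
  assumes "0 < k" "k \<le> m"
  shows "((\<lambda>\<rho>::real. real k * (1 - \<rho>) ^ (k - 1) * (real (m choose k) * \<rho> ^ (m - k))) has_integral 1) {0..1}"
proof -
  let ?T = "\<lambda>\<rho>::real. \<Sum>j<k. real (m choose j) * (1 - \<rho>) ^ j * \<rho> ^ (m - j)"
  have "((\<lambda>\<rho>::real. real k * (1 - \<rho>) ^ (k - 1) * (real (m choose k) * \<rho> ^ (m - k))) has_integral ?T 1 - ?T 0) {0..1}"
  proof (rule fundamental_theorem_of_calculus_interior)
    show "continuous_on {0..1} ?T" by (intro continuous_intros)
    show "(?T has_vector_derivative real k * (1 - \<rho>) ^ (k - 1) * (real (m choose k) * \<rho> ^ (m - k))) (at \<rho>)" for \<rho>
      using binomial_tail_deriv[OF assms(2), of \<rho>]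
      by (simp add: has_real_derivative_iff_has_vector_derivative[symmetric] mult_ac)
  qed simp
  moreover have "?T 0 = 0" using assms by (intro sum.neutral) auto
  moreover have "?T 1 = 1"
  proof -
    have "?T 1 = (\<Sum>j<k. if j = 0 then 1 else 0)" by (intro sum.cong) (auto simp: power_0_left)
    then show ?thesis using assms by simp
  qed
  ultimately show ?thesis by simp
qed

text \<open>The two bounds for the quadratic form give \<open>S \<rho> \<le> kern p \<rho> ^ k * E\<close>. The weight
  \<open>real k * (1 - \<rho>) ^ (k - 1)\<close> makes the integral of every term on the left equal to the squared
  coefficient, and leaves on the right at most the derivative of \<open>- (kern_tail p \<rho> ^ k) * E\<close>.\<close>

lemma hermite_weight_bound:
  fixes f :: "real ^ 'n \<Rightarrow> real"
  assumes f: "f \<in> gauss_sobolev k" and b: "AE x in gauss. \<bar>f x\<bar> \<le> 1" and p: "1 \<le> p" "p \<le> 2" and k: "k > 0"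
  shows "(\<Sum>\<alpha> | k \<le> multi_order \<alpha> \<and> multi_order \<alpha> \<le> N. (coef f \<alpha>)\<^sup>2) \<le> kern_total p ^ k * (\<integral>x. grad_norm k f x powr p \<partial>gauss)"
proof -
  let ?I = "{\<alpha> :: 'n \<Rightarrow> nat. k \<le> multi_order \<alpha> \<and> multi_order \<alpha> \<le> N}"
  have finI: "finite ?I" by (rule finite_subset[OF _ finite_multi_order_le[of N]]) auto
  define E where "E = (\<integral>x. grad_norm k f x powr p \<partial>gauss)"
  have E0: "E \<ge> 0" unfolding E_def by (intro Bochner_Integration.integral_nonneg) simp
  define S where "S \<rho> = (\<Sum>\<alpha>\<in>?I. real (multi_order \<alpha> choose k) * \<rho> ^ (multi_order \<alpha> - k) * (coef f \<alpha>)\<^sup>2)" for \<rho>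
  have S: "S \<rho> \<le> kern p \<rho> ^ k * E" if \<rho>: "\<rho> \<in> {0<..<1}" for \<rho>
  proof -
    define s where "s = sqrt (1 - \<rho>\<^sup>2)"
    have r1: "\<rho>\<^sup>2 < 1" using \<rho> by (simp add: abs_square_less_1)
    then have s: "s > 0" and rs: "\<rho>\<^sup>2 + s\<^sup>2 = 1" by (auto simp: s_def)
    have "s ^ k * S \<rho> \<le> s ^ k * (\<Sum>\<kappa> | multi_order \<kappa> = k. \<integral>x. weak_D \<kappa> f x * ou \<rho> s (weak_D \<kappa> f) x \<partial>gauss)"
      unfolding S_def using s \<rho> by (intro mult_left_mono quadratic_form_lower[OF f s rs]) auto
    also have "\<dots> \<le> (s ^ k) powr (p - 1) * E"
      unfolding E_def by (rule quadratic_form_upper[OF f b p s rs])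
    also have "(s ^ k) powr (p - 1) = s ^ k * (s ^ k) powr (p - 2)"
    proof -
      have "(s ^ k) powr (p - 1) = (s ^ k) powr (1 + (p - 2))" by simp
      also have "\<dots> = s ^ k * (s ^ k) powr (p - 2)" using s by (subst powr_add) simp
      finally show ?thesis .
    qed
    also have "(s ^ k) powr (p - 2) = kern p \<rho> ^ k"
    proof -
      have "s powr (p - 2) = kern p \<rho>"
        unfolding s_def kern_def using r1 by (simp add: powr_half_sqrt[symmetric] powr_powr diff_divide_distrib)
      moreover have "(s ^ k) powr (p - 2) = (s powr (p - 2)) ^ k"
        using s by (simp add: powr_power powr_realpow[symmetric] powr_powr mult.commute)
      ultimately show ?thesis by simp
    qed
    finally have "s ^ k * S \<rho> \<le> s ^ k * (kern p \<rho> ^ k * E)" by (simp add: mult.assoc)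
    then show ?thesis using s by simp
  qed
  have "((\<lambda>\<rho>. \<Sum>\<alpha>\<in>?I. (coef f \<alpha>)\<^sup>2 * (real k * (1 - \<rho>) ^ (k - 1) * (real (multi_order \<alpha> choose k) * \<rho> ^ (multi_order \<alpha> - k)))) has_integral (\<Sum>\<alpha>\<in>?I. (coef f \<alpha>)\<^sup>2 * 1)) {0..1::real}"
    by (intro has_integral_sum finI has_integral_mult_right binomial_tail_integral k) auto
  moreover have "(\<Sum>\<alpha>\<in>?I. (coef f \<alpha>)\<^sup>2 * (real k * (1 - \<rho>) ^ (k - 1) * (real (multi_order \<alpha> choose k) * \<rho> ^ (multi_order \<alpha> - k)))) = real k * (1 - \<rho>) ^ (k - 1) * S \<rho>" for \<rho>
    unfolding S_def sum_distrib_left by (intro sum.cong) auto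
  ultimately have 1: "((\<lambda>\<rho>. real k * (1 - \<rho>) ^ (k - 1) * S \<rho>) has_integral (\<Sum>\<alpha>\<in>?I. (coef f \<alpha>)\<^sup>2)) {0..1}"
    by simp
  have 2: "((\<lambda>\<rho>. real k * kern_tail p \<rho> ^ (k - 1) * kern p \<rho> * E) has_integral kern_total p ^ k * E) {0..1}"
    by (rule has_integral_mult_left[OF kern_tail_power_integral[OF p k]])
  have 3: "real k * (1 - \<rho>) ^ (k - 1) * S \<rho> \<le> real k * kern_tail p \<rho> ^ (k - 1) * kern p \<rho> * E" if \<rho>: "\<rho> \<in> {0<..<1}" for \<rho>
  proof -
    have "real k * (1 - \<rho>) ^ (k - 1) * S \<rho> \<le> real k * (1 - \<rho>) ^ (k - 1) * (kern p \<rho> ^ k * E)"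
      using \<rho> by (intro mult_left_mono S) auto
    also have "kern p \<rho> ^ k = kern p \<rho> ^ (k - 1) * kern p \<rho>"
      using k by (cases k) auto
    also have "real k * (1 - \<rho>) ^ (k - 1) * (kern p \<rho> ^ (k - 1) * kern p \<rho> * E)
       = real k * ((1 - \<rho>) * kern p \<rho>) ^ (k - 1) * kern p \<rho> * E"
      by (simp add: power_mult_distrib)
    also have "\<dots> \<le> real k * kern_tail p \<rho> ^ (k - 1) * kern p \<rho> * E"
      using \<rho> E0 by (intro mult_right_mono mult_left_mono power_mono kern_tail_ge[OF p]) (auto simp: kern_nonneg)
    finally show ?thesis .
  qed
  have "(\<Sum>\<alpha>\<in>?I. (coef f \<alpha>)\<^sup>2) \<le> kern_total p ^ k * E"
  proof (rule has_integral_le)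
    \<comment> \<open>The pointwise bound holds in the open interval only, so both integrands are set to 0 at the end points.\<close>
    show "((\<lambda>\<rho>. if \<rho> \<in> {0<..<1} then real k * (1 - \<rho>) ^ (k - 1) * S \<rho> else 0) has_integral (\<Sum>\<alpha>\<in>?I. (coef f \<alpha>)\<^sup>2)) {0..1}"
      by (rule has_integral_spike_finite[of "{0, 1}" _ _ "\<lambda>\<rho>. real k * (1 - \<rho>) ^ (k - 1) * S \<rho>"]) (use 1 in auto)
    show "((\<lambda>\<rho>. if \<rho> \<in> {0<..<1} then real k * kern_tail p \<rho> ^ (k - 1) * kern p \<rho> * E else 0) has_integral kern_total p ^ k * E) {0..1}"
      by (rule has_integral_spike_finite[of "{0, 1}" _ _ "\<lambda>\<rho>. real k * kern_tail p \<rho> ^ (k - 1) * kern p \<rho> * E"]) (use 2 in auto)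
  qed (use 3 in auto)
  then show ?thesis by (simp add: E_def)
qed

lemma weak_D_zero:
  fixes f :: "real ^ 'n \<Rightarrow> real"
  assumes f: "f \<in> gauss_sobolev k"
  shows "AE x in gauss. weak_D (\<lambda>_. 0) f x = f x"
proof -
  note fD = gauss_sobolevD[OF f]
  have D: "weak_D (\<lambda>_. 0) f \<in> L2 gauss" by (rule fD(2)) simp
  have "AE x in gauss. weak_D (\<lambda>_. 0) f x - f x = 0"
    by (rule hermite_complete) (auto simp: coef_diff D fD(1) coef_weak_D[OF f] intro!: L2_diff D fD(1))
  then show ?thesis by eventually_elim simp
qed

lemma gauss_Lp_norm_powr:
  assumes "1 \<le> p" "\<And>x. v x \<ge> 0"
  shows "gauss_Lp_norm p v powr p = (\<integral>x. v x powr p \<partial>gauss)"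
proof -
  have "(\<integral>x. v x powr p \<partial>gauss) \<ge> 0" by (intro Bochner_Integration.integral_nonneg) simp
  then show ?thesis using assms by (simp add: gauss_Lp_norm_def powr_powr)
qed

lemma grad_norm_lower_bound:
  fixes f :: "real ^ 'n \<Rightarrow> real"
  assumes f: "f \<in> gauss_sobolev k" and b: "gauss_Linf_norm f \<le> 1" and p: "1 \<le> p" "p \<le> 2"
  shows "C_const p ^ k * high_weight k f \<le> gauss_Lp_norm p (grad_norm k f) powr p"
proof -
  note fD = gauss_sobolevD[OF f]
  have b': "AE x in gauss. \<bar>f x\<bar> \<le> 1"
    using esssup_AE[of "\<lambda>x. ereal \<bar>f x\<bar>" gauss] b unfolding gauss_Linf_norm_def
    by (auto elim!: eventually_mono dest: order_trans)
  have gn: "gauss_Lp_norm p (grad_norm k f) powr p = (\<integral>x. grad_norm k f x powr p \<partial>gauss)"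
    by (rule gauss_Lp_norm_powr[OF p(1)]) (simp add: grad_norm_def sum_nonneg)
  show ?thesis
  proof (cases "k = 0")
    case True
    have hw: "high_weight 0 f = (\<integral>x. (f x)\<^sup>2 \<partial>gauss)"
      using LIMSEQ_unique[OF high_weight_tendsto[OF fD(1), of 0]] parseval[OF fD(1)] by simp
    have K: "{\<kappa> :: 'n \<Rightarrow> nat. multi_order \<kappa> = 0} = {\<lambda>_. 0}" by (auto simp: fun_eq_iff)
    have "(\<integral>x. (f x)\<^sup>2 \<partial>gauss) \<le> (\<integral>x. grad_norm k f x powr p \<partial>gauss)"
    proof (rule integral_mono_AE[OF L2_integrable_sq[OF fD(1)]])
      show "integrable gauss (\<lambda>x. grad_norm k f x powr p)"
        by (rule gauss.L2_integrable_powr[OF grad_norm_L2[OF f] p]) (simp add: grad_norm_def sum_nonneg)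
      show "AE x in gauss. (f x)\<^sup>2 \<le> grad_norm k f x powr p"
        using weak_D_zero[OF f] b'
      proof eventually_elim
        case (elim x)
        have "(f x)\<^sup>2 = \<bar>f x\<bar> powr 2" by (cases "f x = 0") (auto simp: powr_numeral)
        also have "\<dots> \<le> \<bar>f x\<bar> powr p" using p elim by (intro powr_mono') auto
        also have "\<bar>f x\<bar> = grad_norm k f x" unfolding grad_norm_def True K using elim by simp
        finally show ?case .
      qed
    qed
    then show ?thesis using True gn hw by simp
  next
    case False
    then have k: "k > 0" by simp
    have "high_weight k f \<le> kern_total p ^ k * (\<integral>x. grad_norm k f x powr p \<partial>gauss)"
      by (rule LIMSEQ_le_const2[OF high_weight_tendsto[OF fD(1)]])
         (use hermite_weight_bound[OF f b' p k] in auto)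
    then have "C_const p ^ k * high_weight k f \<le> (1 / kern_total p) ^ k * (kern_total p ^ k * (\<integral>x. grad_norm k f x powr p \<partial>gauss))"
      unfolding C_const_eq[OF p] using kern_total_bounds(1)[OF p] by (intro mult_left_mono) auto
    also have "\<dots> = (\<integral>x. grad_norm k f x powr p \<partial>gauss)"
      using kern_total_bounds(1)[OF p] by (simp add: power_one_over)
    finally show ?thesis by (simp add: gn)
  qed
qed

theorem theorem1p2:
  shows "(\<forall>(k::nat) (f :: real ^ 'n \<Rightarrow> real) (p::real).
            f \<in> gauss_sobolev k \<and> gauss_Linf_norm f \<le> 1 \<and> 1 \<le> p \<and> p \<le> 2 \<longrightarrow>
              gauss_Lp_norm p (grad_norm k f) powr p \<ge> C_const p ^ k * high_weight k f)
         \<and> (\<exists>c::real. c > 0 \<and> (\<forall>p. 1 \<le> p \<and> p \<le> 2 \<longrightarrow> C_const p \<ge> c))"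
proof (intro conjI allI impI exI[of _ "1 / 2 :: real"])
  show "C_const p \<ge> 1 / 2" if "1 \<le> p \<and> p \<le> 2" for p
  proof -
    have p: "1 \<le> p" "p \<le> 2" using that by auto
    show ?thesis unfolding C_const_eq[OF p] using kern_total_bounds[OF p] by (simp add: field_simps)
  qed
qed (use grad_norm_lower_bound in auto)

end
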